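(* The isometries of $(S\mathcal{O}(4), -\mathcal{K})$, where $-\mathcal{K}$ is the Killing metric of $S\mathcal{O}(4)$, are precisely the following maps: $$X \mapsto AXB, \qquad X \mapsto AX^{T}B, \qquad X \mapsto A\,\tau(X)B, \qquad X \mapsto A\,\tau(X)^{T}B,$$ where $A, B$ are matrices both in $S\mathcal{O}(4)$ or both in $\mathcal{O}(4)\setminus S\mathcal{O}(4)$, and $\tau: S\mathcal{O}(4) \to S\mathcal{O}(4)$ is the map $\rho(X_1)\,[J\rho(X_2)J] \mapsto \rho(X_1)\,[J\rho(X_2)J]^T$ ($X_1, X_2 \in SU(2)$) constructed by means of Cayley's factorization.
   Context: $\mathcal{O}(4)$ and $S\mathcal{O}(4)$ are the real orthogonal and special orthogonal groups of order $4$. The Killing tensor $\mathcal{K}$ of a Lie group is the left-invariant symmetric $(0,2)$-tensor whose value at the identity is the Killing form $\mathrm{tr}(ad_v\circ ad_w)$ of the Lie algebra; the Killing metric of a semi-simple Lie group is $-\mathcal{K}$, which is Riemannian for the compact semi-simple group $S\mathcal{O}(4)$. An isometry is a diffeomorphism of the group onto itself preserving the metric. Decomplexification map: for $z \in \mathbb{C}$ put $\rho(z) = \begin{pmatrix} \mathrm{Re}(z) & -\mathrm{Im}(z) \\ \mathrm{Im}(z) & \mathrm{Re}(z)\end{pmatrix}$; for $Z = (z_{ij}) \in M_2(\mathbb{C})$, $\rho(Z) \in M_4(\mathbb{R})$ is the block matrix with $2\times 2$ blocks $\rho(z_{ij})$. Then $\rho(SU(2))$ is a Lie subgroup of $S\mathcal{O}(4)$.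 Let $J = \mathrm{diag}(-1,1,1,1) \in \mathcal{O}(4)$. Cayley's factorization: every $X \in S\mathcal{O}(4)$ can be written as a (commutative) product $X = \rho(X_1)\,[J\rho(X_2)J]$ with $X_1, X_2 \in SU(2)$, and the pair $(X_1, X_2)$ is unique up to a simultaneous change of sign. Consequently the map $\tau(X) := \rho(X_1)\,[J\rho(X_2)J]^T = \rho(X_1)\,[J\rho(X_2^* )J]$ is well defined on $S\mathcal{O}(4)$, where $X_2^* = \overline{X_2}^T$. *)

theory Defs
  imports "HOL-Analysis.Analysis"
begin

section \<open>Smooth maps on subsets of Euclidean space\<close>

fun Ck_on :: "nat \<Rightarrow> 'a::real_normed_vector set \<Rightarrow> ('a \<Rightarrow> 'b::real_normed_vector) \<Rightarrow> bool" where
  "Ck_on 0 U f \<longleftrightarrow> continuous_on U f"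
| "Ck_on (Suc k) U f \<longleftrightarrow>
     (\<forall>x\<in>U. f differentiable (at x)) \<and> (\<forall>v. Ck_on k U (\<lambda>x. frechet_derivative f (at x) v))"

text \<open>Meant for open \<open>U\<close> in finite dimension, where continuity of all iterated directional
  derivatives is the usual notion of a \<open>C\<^sup>\<infinity>\<close> map.\<close>

definition smooth_on :: "'a::real_normed_vector set \<Rightarrow> ('a \<Rightarrow> 'b::real_normed_vector) \<Rightarrow> bool" where
  "smooth_on U f \<longleftrightarrow> (\<forall>k. Ck_on k U f)"

text \<open>From here on \<open>M\<close> stands for an embedded submanifold of a Euclidean space; maps on \<open>M\<close>
  are functions on the ambient space of which only the values on \<open>M\<close> matter.\<close>

definition smooth_map :: "'a::euclidean_space set \<Rightarrow> ('a \<Rightarrow> 'b::euclidean_space) \<Rightarrow> bool" where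
  "smooth_map M f \<longleftrightarrow>
     (\<forall>x\<in>M. \<exists>U F. open U \<and> x \<in> U \<and> smooth_on U F \<and> (\<forall>y\<in>U \<inter> M. F y = f y))"

definition diffeomorphism_of :: "'a::euclidean_space set \<Rightarrow> ('a \<Rightarrow> 'a) \<Rightarrow> bool" where
  "diffeomorphism_of M f \<longleftrightarrow> bij_betw f M M \<and> smooth_map M f \<and> smooth_map M (inv_into M f)"

definition curve_through ::
    "'a::euclidean_space set \<Rightarrow> 'a \<Rightarrow> 'a \<Rightarrow> (real \<Rightarrow> 'a) \<Rightarrow> bool" where
  "curve_through M x v c \<longleftrightarrow>
     (\<exists>e>0. smooth_on {-e<..<e} c \<and> c ` {-e<..<e} \<subseteq> M) \<and>
     c 0 = x \<and> (c has_vector_derivative v) (at 0)"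

definition tangent_space :: "'a::euclidean_space set \<Rightarrow> 'a \<Rightarrow> 'a set" where
  "tangent_space M x = {v. \<exists>c. curve_through M x v c}"

text \<open>The differential sends the velocity of a curve to the velocity of its image. For tangent
  \<open>v\<close> and smooth \<open>f\<close> the vector \<open>w\<close> exists and is unique; for other \<open>v\<close> the value is irrelevant.\<close>

definition differential ::
    "'a::euclidean_space set \<Rightarrow> ('a \<Rightarrow> 'b::euclidean_space) \<Rightarrow> 'a \<Rightarrow> 'a \<Rightarrow> 'b" where
  "differential M f x v =
     (THE w. \<forall>c. curve_through M x v c \<longrightarrow> (f \<circ> c has_vector_derivative w) (at 0))"

text \<open>A metric is a function \<open>g x v w\<close>, relevant for \<open>v\<close>, \<open>w\<close> tangent to \<open>M\<close> at \<open>x\<close>.\<close>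

definition isometry_of ::
    "'a::euclidean_space set \<Rightarrow> ('a \<Rightarrow> 'a \<Rightarrow> 'a \<Rightarrow> real) \<Rightarrow> ('a \<Rightarrow> 'a) \<Rightarrow> bool" where
  "isometry_of M g f \<longleftrightarrow> diffeomorphism_of M f \<and>
     (\<forall>x\<in>M. \<forall>v\<in>tangent_space M x. \<forall>w\<in>tangent_space M x.
        g (f x) (differential M f x v) (differential M f x w) = g x v w)"


section \<open>The Killing metric of a matrix Lie group\<close>

text \<open>Trace of an endomorphism of a subspace \<open>V\<close>; it does not depend on the chosen basis.\<close>

definition trace_on :: "'a::euclidean_space set \<Rightarrow> ('a \<Rightarrow> 'a) \<Rightarrow> real" where
  "trace_on V T =
     (let B = (SOME B. independent B \<and> span B = V) in \<Sum>b\<in>B. representation B (T b) b)"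

definition lie_algebra :: "(real^'n^'n) set \<Rightarrow> (real^'n^'n) set" where
  "lie_algebra G = tangent_space G (mat 1)"

definition ad :: "real^'n^'n \<Rightarrow> real^'n^'n \<Rightarrow> real^'n^'n" where
  "ad v w = v ** w - w ** v"

definition killing_form :: "(real^'n^'n) set \<Rightarrow> real^'n^'n \<Rightarrow> real^'n^'n \<Rightarrow> real" where
  "killing_form G v w = trace_on (lie_algebra G) (ad v \<circ> ad w)"

text \<open>Left translation by the inverse of \<open>X\<close> is the restriction of a linear map, so it carries
  tangent vectors at \<open>X\<close> to the Lie algebra by matrix multiplication.\<close>

definition killing_tensor ::
    "(real^'n^'n) set \<Rightarrow> real^'n^'n \<Rightarrow> real^'n^'n \<Rightarrow> real^'n^'n \<Rightarrow> real" where
  "killing_tensor G X V W = killing_form G (matrix_inv X ** V) (matrix_inv X ** W)"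

definition killing_metric ::
    "(real^'n^'n) set \<Rightarrow> real^'n^'n \<Rightarrow> real^'n^'n \<Rightarrow> real^'n^'n \<Rightarrow> real" where
  "killing_metric G X V W = - killing_tensor G X V W"


section \<open>Orthogonal groups and Cayley's factorization\<close>

definition O4 :: "(real^4^4) set" where
  "O4 = {X. orthogonal_matrix X}"

definition SO4 :: "(real^4^4) set" where
  "SO4 = {X. rotation_matrix X}"

definition conj_transpose :: "complex^'n^'m \<Rightarrow> complex^'m^'n" where
  "conj_transpose Z = (\<chi> i j. cnj (Z $ j $ i))"

definition SU2 :: "(complex^2^2) set" where
  "SU2 = {Z. conj_transpose Z ** Z = mat 1 \<and> Z ** conj_transpose Z = mat 1 \<and> det Z = 1}"

definition decomplexify :: "complex^2^2 \<Rightarrow> real^4^4" ("\<rho>") where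
  "\<rho> Z = vector
     [vector [Re (Z$1$1), - Im (Z$1$1), Re (Z$1$2), - Im (Z$1$2)],
      vector [Im (Z$1$1),   Re (Z$1$1), Im (Z$1$2),   Re (Z$1$2)],
      vector [Re (Z$2$1), - Im (Z$2$1), Re (Z$2$2), - Im (Z$2$2)],
      vector [Im (Z$2$1),   Re (Z$2$1), Im (Z$2$2),   Re (Z$2$2)]]"

definition J4 :: "real^4^4" where
  "J4 = (\<chi> i j. if i = j then (if i = 1 then -1 else 1) else 0)"

text \<open>Cayley's factorization makes the described matrix exist and be unique for \<open>X\<close> in
  \<open>SO4\<close>; elsewhere \<open>\<tau>\<close> is unspecified.\<close>

definition cayley_tau :: "real^4^4 \<Rightarrow> real^4^4" ("\<tau>") where
  "\<tau> X = (THE Y. \<exists>X1\<in>SU2. \<exists>X2\<in>SU2.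
     X = \<rho> X1 ** (J4 ** \<rho> X2 ** J4) \<and> Y = \<rho> X1 ** transpose (J4 ** \<rho> X2 ** J4))"

end

theory Submission
  imports Defs
begin

text \<open>
  The Killing metric of \<open>SO4\<close> is twice the metric induced from the Euclidean space of matrices,
  and \<open>so4\<close> is the sum of two commuting copies \<open>lmat\<close>, \<open>rmat\<close> of three-space with the cross
  product. For an isometry \<open>f\<close> let \<open>a V = f\<^sup>T (D\<^sub>V f)\<close> be the left-trivialized differential. The
  structure equation and the metric give the Koszul formula \<open>2 D\<^sub>U (a V) = a [U, V] -
  [a U, a V]\<close>. Taking \<open>U = V\<close>, \<open>a U\<close> is constant along the one-parameter subgroup of \<open>U\<close>, so \<open>f\<close> is
  determined by its value and its differential at the identity. Differentiating the formula once
  more, \<open>a\<close> preserves the curvature, \<open>[[a U, a V], a W] = a [[U, V], W]\<close>. Hence \<open>a\<close> preserves or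
  exchanges the two ideals and is orthogonal on each, that is, up to a sign on each ideal it is
  conjugation by an element of \<open>O4\<close>. The signs are realized at the identity by transposition and
  by \<open>\<tau>\<close>, which is the restriction of a linear isometry of the space of matrices.
\<close>

section \<open>Smooth maps\<close>

text \<open>An isometry fixing the identity need not preserve the bracket: transposition negates all
  of \<open>so4\<close>. Double brackets do not see such signs, which is why a curvature identity,
  and not a homomorphism property, is extracted from the metric; the signs lost on the way are what
  produce the four families. The factors of the final form arise as \<open>f (mat 1) ** C\<close>
  and \<open>transpose C\<close>, where \<open>C\<close> realizes the differential at the identity
  up to signs. As \<open>f (mat 1)\<close> has determinant one, both factors have the determinant of
  \<open>C\<close>. An exchange of the two ideals puts a factor \<open>J4\<close> into
  \<open>C\<close>, and this is how matrices outside \<open>SO4\<close> enter. No connection is ever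
  introduced. Functions on \<open>SO4\<close> are differentiated along left-invariant fields through
  smooth extensions to open sets of matrices, and the Koszul formula is read off from the structure
  equation alone. That information at the identity reaches every point rests on the polar form of
  unit quaternions, which puts each element of \<open>SO4\<close> on an explicit one-parameter
  subgroup.\<close>

lemma frechet_derivative_cong_open:
  assumes "open U" "x \<in> U" "\<And>y. y \<in> U \<Longrightarrow> F y = G y" "F differentiable at x"
  shows "G differentiable at x" "frechet_derivative G (at x) = frechet_derivative F (at x)"
proof -
  have "(F has_derivative frechet_derivative F (at x)) (at x)"
    using assms(4) by (simp add: frechet_derivative_works)
  then have "(G has_derivative frechet_derivative F (at x)) (at x)"
    by (rule has_derivative_transform_within_open[OF _ assms(1,2,3)])
  then show "G differentiable at x" "frechet_derivative G (at x) = frechet_derivative F (at x)"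
    by (auto simp: differentiable_def frechet_derivative_at[symmetric])
qed

lemma Ck_on_cong:
  assumes "open U"
  shows "\<lbrakk>\<And>y. y \<in> U \<Longrightarrow> F y = G y; Ck_on k U F\<rbrakk> \<Longrightarrow> Ck_on k U G"
proof (induction k arbitrary: F G)
  case 0
  then show ?case by (metis Ck_on.simps(1) continuous_on_cong)
next
  case (Suc k)
  note frechet = frechet_derivative_cong_open[OF \<open>open U\<close> _ Suc.prems(1)]
  show ?case
    using Suc.prems(2) frechet Suc.IH[of "\<lambda>x. frechet_derivative F (at x) v"
        "\<lambda>x. frechet_derivative G (at x) v" for v]
    by simp
qed

lemma Ck_on_subset: "\<lbrakk>Ck_on k U F; V \<subseteq> U\<rbrakk> \<Longrightarrow> Ck_on k V F"
  by (induction k arbitrary: F) (auto intro: continuous_on_subset)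

lemma Ck_on_SucD: "Ck_on (Suc k) U F \<Longrightarrow> Ck_on k U F"
proof (induction k arbitrary: F)
  case 0
  then show ?case
    by (auto intro!: continuous_at_imp_continuous_on differentiable_imp_continuous_within)
next
  case (Suc k)
  then show ?case by (metis Ck_on.simps(2))
qed

lemma Ck_on_const: "Ck_on k U (\<lambda>x. c)"
  by (induction k arbitrary: c) auto

text \<open>Replaces the chosen \<open>frechet_derivative\<close> by any explicit derivative
  \<open>F'\<close>, so that the inductions on the order can use the usual differentiation
  rules.\<close>

lemma Ck_on_Suc_I:
  assumes "open U" "\<And>x. x \<in> U \<Longrightarrow> (F has_derivative F' x) (at x)" "\<And>v. Ck_on k U (\<lambda>x. F' x v)"
  shows "Ck_on (Suc k) U F"
proof -
  have "\<And>x. x \<in> U \<Longrightarrow> frechet_derivative F (at x) = F' x"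
    using assms(2) by (simp add: frechet_derivative_at[symmetric])
  then show ?thesis
    using assms Ck_on_cong[OF assms(1), of "\<lambda>x. F' x v" "\<lambda>x. frechet_derivative F (at x) v" for v]
    by (auto simp: differentiable_def)
qed

lemma Ck_on_has_derivative:
  assumes "Ck_on (Suc k) U F" "x \<in> U"
  shows "(F has_derivative frechet_derivative F (at x)) (at x)"
  using assms by (simp add: frechet_derivative_works)

lemma Ck_on_add:
  assumes "open U"
  shows "\<lbrakk>Ck_on k U F; Ck_on k U G\<rbrakk> \<Longrightarrow> Ck_on k U (\<lambda>x. F x + G x)"
proof (induction k arbitrary: F G)
  case 0
  then show ?case by (auto intro: continuous_on_add)
next
  case (Suc k)
  show ?case
    using Suc by (intro Ck_on_Suc_I[OF \<open>open U\<close> has_derivative_add[OF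
          Ck_on_has_derivative[of k U F] Ck_on_has_derivative[of k U G]]]) auto
qed

text \<open>Each summand of the product rule keeps one factor undifferentiated;
  \<open>Ck_on_SucD\<close> lowers that factor to order \<open>k\<close>, where the induction
  hypothesis applies. Matrix products, scalar multiples, inner products and brackets are all
  instances.\<close>

lemma Ck_on_bilinear:
  assumes "bounded_bilinear B" "open U"
  shows "\<lbrakk>Ck_on k U F; Ck_on k U G\<rbrakk> \<Longrightarrow> Ck_on k U (\<lambda>x. B (F x) (G x))"
proof (induction k arbitrary: F G)
  case 0
  then show ?case by (auto intro: bounded_bilinear.continuous_on[OF assms(1)])
next
  case (Suc k)
  show ?case
  proof (rule Ck_on_Suc_I[OF \<open>open U\<close>])
    fix x assume "x \<in> U"
    then show "((\<lambda>x. B (F x) (G x)) has_derivative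
        (\<lambda>h. B (F x) (frechet_derivative G (at x) h) + B (frechet_derivative F (at x) h) (G x))) (at
            x)"
      using Suc.prems by (intro bounded_bilinear.FDERIV[OF assms(1)] Ck_on_has_derivative)
  next
    fix v
    show "Ck_on k U (\<lambda>x. B (F x) (frechet_derivative G (at x) v) + B (frechet_derivative F (at x) v)
        (G x))"
      using Suc.prems Ck_on_SucD[OF Suc.prems(1)] Ck_on_SucD[OF Suc.prems(2)]
      by (intro Ck_on_add[OF assms(2)] Suc.IH) auto
  qed
qed

lemma Ck_on_bounded_linear_compose:
  assumes "bounded_linear L" "open U"
  shows "Ck_on k U F \<Longrightarrow> Ck_on k U (\<lambda>x. L (F x))"
proof (induction k arbitrary: F)
  case 0
  then show ?case by (auto intro: bounded_linear.continuous_on[OF assms(1)])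
next
  case (Suc k)
  show ?case
    using Suc by (intro Ck_on_Suc_I[OF \<open>open U\<close> bounded_linear.has_derivative[OF assms(1)
          Ck_on_has_derivative[of k U F]]]) auto
qed

lemma Ck_on_bounded_linear:
  assumes "bounded_linear L" "open U"
  shows "Ck_on k U L"
proof (cases k)
  case 0
  then show ?thesis using assms(1) by (simp add: linear_continuous_on)
next
  case (Suc n)
  show ?thesis
    unfolding Suc by (rule Ck_on_Suc_I[OF assms(2) bounded_linear_imp_has_derivative[OF assms(1)]
        Ck_on_const])
qed

lemma Ck_on_sum:
  assumes "open U" "finite I"
  shows "(\<And>i. i \<in> I \<Longrightarrow> Ck_on k U (F i)) \<Longrightarrow> Ck_on k U (\<lambda>x. \<Sum>i\<in>I. F i x)"
  using assms(2) by (induction I rule: finite_induct) (auto intro: Ck_on_const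
      Ck_on_add[OF assms(1)])

section \<open>Symmetry of second derivatives\<close>

text \<open>Two applications of the mean value theorem, one in direction \<open>v\<close> to the
  difference of \<open>F\<close> along two opposite sides of the parallelogram, one in direction
  \<open>w\<close> to the derivative so obtained. The second difference on the left is symmetric in
  \<open>v\<close> and \<open>w\<close>, the right-hand side is not visibly so.\<close>

lemma second_difference_mean_value:
  fixes F :: "'a::real_normed_vector \<Rightarrow> real"
  assumes "Ck_on 2 U F" "h > 0"
    and sq: "\<And>s t. \<lbrakk>0 \<le> s; s \<le> h; 0 \<le> t; t \<le> h\<rbrakk> \<Longrightarrow> x + s *\<^sub>R v + t *\<^sub>R w \<in> U"
  obtains s t where "0 < s" "s < h" "0 < t" "t < h"
    "F (x + h *\<^sub>R v + h *\<^sub>R w) - F (x + h *\<^sub>R v) - F (x + h *\<^sub>R w) + F x =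
     h\<^sup>2 * frechet_derivative (\<lambda>y. frechet_derivative F (at y) v) (at (x + s *\<^sub>R v + t *\<^sub>R w)) w"
proof -
  define F' where "F' y = frechet_derivative F (at y)" for y
  define F'' where "F'' y = frechet_derivative (\<lambda>y. F' y v) (at y)" for y
  have C: "Ck_on (Suc 0) U (\<lambda>y. F' y v)" "Ck_on (Suc (Suc 0)) U F"
    using assms(1) by (auto simp: numeral_2_eq_2 F'_def)
  have d1: "(F has_derivative F' y) (at y)" and d2: "((\<lambda>y. F' y v) has_derivative F'' y) (at y)"
      if "y \<in> U" for y
    using Ck_on_has_derivative[OF C(1) that] Ck_on_has_derivative[OF C(2) that]
    by (auto simp: F'_def F''_def)
  have lin: "linear (F' y)" "linear (F'' y)" if "y \<in> U" for y
    using d1[OF that] d2[OF that] by (auto intro: has_derivative_linear)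
  have hd1: "((\<lambda>s. F (x + s *\<^sub>R v + t *\<^sub>R w)) has_real_derivative F' (x + s *\<^sub>R v + t *\<^sub>R w) v)
      (at s)"
    if "0 \<le> s" "s \<le> h" "0 \<le> t" "t \<le> h" for s t
  proof -
    have "((\<lambda>s. x + s *\<^sub>R v + t *\<^sub>R w) has_derivative (\<lambda>k. k *\<^sub>R v)) (at s)"
      by (auto intro!: derivative_eq_intros)
    from has_derivative_compose[OF this d1[OF sq[OF that]]] show ?thesis
      by (simp add: linear_scale[OF lin(1)[OF sq[OF that]]] has_field_derivative_def
          mult_commute_abs)
  qed
  have hd2: "((\<lambda>t. F' (x + s *\<^sub>R v + t *\<^sub>R w) v) has_real_derivative F'' (x + s *\<^sub>R v + t *\<^sub>R w) w)
      (at t)"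
    if "0 \<le> s" "s \<le> h" "0 \<le> t" "t \<le> h" for s t
  proof -
    have "((\<lambda>t. x + s *\<^sub>R v + t *\<^sub>R w) has_derivative (\<lambda>k. k *\<^sub>R w)) (at t)"
      by (auto intro!: derivative_eq_intros)
    from has_derivative_compose[OF this d2[OF sq[OF that]]] show ?thesis
      by (simp add: linear_scale[OF lin(2)[OF sq[OF that]]] has_field_derivative_def
          mult_commute_abs)
  qed
  obtain s where s: "0 < s" "s < h"
    "(F (x + h *\<^sub>R v + h *\<^sub>R w) - F (x + h *\<^sub>R v + 0 *\<^sub>R w)) - (F (x + 0 *\<^sub>R v + h *\<^sub>R w) - F (x +
        0 *\<^sub>R v + 0 *\<^sub>R w)) =
     (h - 0) * (F' (x + s *\<^sub>R v + h *\<^sub>R w) v - F' (x + s *\<^sub>R v + 0 *\<^sub>R w) v)"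
    using MVT2[OF \<open>h > 0\<close>, of "\<lambda>s. F (x + s *\<^sub>R v + h *\<^sub>R w) - F (x + s *\<^sub>R v + 0 *\<^sub>R w)"
        "\<lambda>s. F' (x + s *\<^sub>R v + h *\<^sub>R w) v - F' (x + s *\<^sub>R v + 0 *\<^sub>R w) v"]
      DERIV_diff[OF hd1[of _ h] hd1[of _ 0]] \<open>h > 0\<close> by auto
  moreover obtain t where "0 < t" "t < h"
    "F' (x + s *\<^sub>R v + h *\<^sub>R w) v - F' (x + s *\<^sub>R v + 0 *\<^sub>R w) v = (h - 0) * F'' (x + s *\<^sub>R v +
        t *\<^sub>R w) w"
    using MVT2[OF \<open>h > 0\<close>, of "\<lambda>t. F' (x + s *\<^sub>R v + t *\<^sub>R w) v"
        "\<lambda>t. F'' (x + s *\<^sub>R v + t *\<^sub>R w) w"]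
      hd2[of s] s(1,2) by auto
  ultimately show ?thesis
    using that[of s t] by (simp add: F''_def F'_def power2_eq_square algebra_simps)
qed

lemma second_derivative_symmetric_real:
  fixes F :: "'a::real_normed_vector \<Rightarrow> real"
  assumes "Ck_on 2 U F" "open U" "x \<in> U"
  shows "frechet_derivative (\<lambda>y. frechet_derivative F (at y) v) (at x) w =
         frechet_derivative (\<lambda>y. frechet_derivative F (at y) w) (at x) v" (is "?H v w x = ?H w v x")
proof (rule ccontr)
  assume neq: "?H v w x \<noteq> ?H w v x"
  \<comment> \<open>Half the gap: two values that agree cannot each be closer than \<open>e\<close>
    to the two sides.\<close>
  define e where "e = \<bar>?H v w x - ?H w v x\<bar> / 2"
  have "e > 0" using neq by (simp add: e_def)
  have cont: "continuous_on U (?H v w)" for v w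
    using assms(1) by (auto simp: numeral_2_eq_2)
  have "\<forall>\<^sub>F y in nhds x. y \<in> U \<and> \<bar>?H v w y - ?H v w x\<bar> < e \<and> \<bar>?H w v y - ?H w v x\<bar> < e"
  proof (intro eventually_conj)
    show "\<forall>\<^sub>F y in nhds x. y \<in> U"
      using assms(2,3) by (rule eventually_nhds_in_open)
    have *: "\<forall>\<^sub>F y in nhds x. \<bar>?H v w y - ?H v w x\<bar> < e" for v w
      using cont[of v w] assms(2,3) \<open>e > 0\<close>
      by (auto simp: continuous_on_eq_continuous_at continuous_at_eps_delta dist_real_def
          eventually_nhds_metric)
    show "\<forall>\<^sub>F y in nhds x. \<bar>?H v w y - ?H v w x\<bar> < e" "\<forall>\<^sub>F y in nhds x. \<bar>?H w v y - ?H w v x\<bar> < e"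
      by (rule *)+
  qed
  then obtain d where "d > 0"
    and d: "\<And>y. dist y x < d \<Longrightarrow> y \<in> U \<and> \<bar>?H v w y - ?H v w x\<bar> < e \<and> \<bar>?H w v y - ?H w v x\<bar> < e"
    by (auto simp: eventually_nhds_metric)
  \<comment> \<open>Keeps the whole parallelogram within distance \<open>d / 2\<close> of
    \<open>x\<close>; the summand \<open>1\<close> keeps the denominator positive when both
    directions vanish.\<close>
  define h where "h = d / (2 * (norm v + norm w + 1))"
  have "h > 0" using \<open>d > 0\<close> by (simp add: h_def add_nonneg_pos)
  have close: "dist (x + s *\<^sub>R v + t *\<^sub>R w) x < d" if "0 \<le> s" "s \<le> h" "0 \<le> t" "t \<le> h" for s t
  proof -
    have "norm (s *\<^sub>R v + t *\<^sub>R w) \<le> s * norm v + t * norm w"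
      using that norm_triangle_ineq[of "s *\<^sub>R v" "t *\<^sub>R w"] by simp
    also have "\<dots> \<le> h * norm v + h * norm w"
      using that by (intro add_mono mult_right_mono) auto
    also have "\<dots> \<le> h * (norm v + norm w + 1)"
      using \<open>h > 0\<close> by (simp add: algebra_simps)
    also have "\<dots> = d / 2"
    proof -
      have "norm v + norm w + 1 > 0" by (simp add: add_nonneg_pos)
      then show ?thesis by (simp add: h_def field_simps)
    qed
    also have "\<dots> < d" using \<open>d > 0\<close> by simp
    finally show ?thesis by (simp add: dist_norm add.assoc)
  qed
  obtain s t where st: "0 < s" "s < h" "0 < t" "t < h"
    "F (x + h *\<^sub>R v + h *\<^sub>R w) - F (x + h *\<^sub>R v) - F (x + h *\<^sub>R w) + F x =
     h\<^sup>2 * ?H v w (x + s *\<^sub>R v + t *\<^sub>R w)"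
    by (rule second_difference_mean_value[OF assms(1) \<open>h > 0\<close>, of x v w]) (use d close in auto)
  obtain t' s' where st': "0 < t'" "t' < h" "0 < s'" "s' < h"
    "F (x + h *\<^sub>R w + h *\<^sub>R v) - F (x + h *\<^sub>R w) - F (x + h *\<^sub>R v) + F x =
     h\<^sup>2 * ?H w v (x + t' *\<^sub>R w + s' *\<^sub>R v)"
  proof (rule second_difference_mean_value[OF assms(1) \<open>h > 0\<close>, of x w v])
    show "x + t' *\<^sub>R w + s' *\<^sub>R v \<in> U" if "0 \<le> t'" "t' \<le> h" "0 \<le> s'" "s' \<le> h" for t' s'
      using d[OF close[of s' t']] that by (simp add: add.commute add.left_commute)
  qed
  have swap: "x + h *\<^sub>R w + h *\<^sub>R v = x + h *\<^sub>R v + h *\<^sub>R w"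
      "x + t' *\<^sub>R w + s' *\<^sub>R v = x + s' *\<^sub>R v + t' *\<^sub>R w"
    by simp_all
  have "h\<^sup>2 * ?H v w (x + s *\<^sub>R v + t *\<^sub>R w) = h\<^sup>2 * ?H w v (x + s' *\<^sub>R v + t' *\<^sub>R w)"
    using st(5) st'(5) unfolding swap by linarith
  then have "?H v w (x + s *\<^sub>R v + t *\<^sub>R w) = ?H w v (x + s' *\<^sub>R v + t' *\<^sub>R w)"
    using \<open>h > 0\<close> by simp
  moreover have "\<bar>?H v w (x + s *\<^sub>R v + t *\<^sub>R w) - ?H v w x\<bar> < e"
    "\<bar>?H w v (x + s' *\<^sub>R v + t' *\<^sub>R w) - ?H w v x\<bar> < e"
    using d[OF close[of s t]] d[OF close[of s' t']] st st' by auto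
  ultimately show False
    by (simp add: e_def) argo
qed

lemma second_derivative_symmetric:
  fixes F :: "'a::real_normed_vector \<Rightarrow> 'b::euclidean_space"
  assumes "Ck_on 2 U F" "open U" "x \<in> U"
  shows "frechet_derivative (\<lambda>y. frechet_derivative F (at y) v) (at x) w =
         frechet_derivative (\<lambda>y. frechet_derivative F (at y) w) (at x) v"
proof (rule euclidean_eqI)
  fix b :: 'b
  have bl: "bounded_linear (\<lambda>z. z \<bullet> b)" by (rule bounded_linear_inner_left)
  have Fb: "Ck_on 2 U (\<lambda>y. F y \<bullet> b)"
    by (rule Ck_on_bounded_linear_compose[OF bl assms(2,1)])
  have 1: "frechet_derivative (\<lambda>y. F y \<bullet> b) (at y) = (\<lambda>v. frechet_derivative F (at y) v \<bullet> b)"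
      if "y \<in> U" for y
    using bounded_linear.has_derivative[OF bl Ck_on_has_derivative[of "Suc 0" U F y]] assms(1) that
    by (metis frechet_derivative_at numeral_2_eq_2)
  have 2: "frechet_derivative (\<lambda>y. frechet_derivative (\<lambda>y. F y \<bullet> b) (at y) v) (at x) w =
      frechet_derivative (\<lambda>y. frechet_derivative F (at y) v) (at x) w \<bullet> b" for v w
  proof -
    have "((\<lambda>y. frechet_derivative F (at y) v) has_derivative
            frechet_derivative (\<lambda>y. frechet_derivative F (at y) v) (at x)) (at x)"
      using assms(1) by (intro Ck_on_has_derivative[OF _ assms(3), of 0]) (simp add: numeral_2_eq_2)
    from bounded_linear.has_derivative[OF bl this]
    have "((\<lambda>y. frechet_derivative (\<lambda>y. F y \<bullet> b) (at y) v) has_derivative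
            (\<lambda>w. frechet_derivative (\<lambda>y. frechet_derivative F (at y) v) (at x) w \<bullet> b)) (at x)"
      by (rule has_derivative_transform_within_open[OF _ assms(2,3)]) (simp add: 1)
    then show ?thesis by (simp add: frechet_derivative_at[symmetric])
  qed
  show "frechet_derivative (\<lambda>y. frechet_derivative F (at y) v) (at x) w \<bullet> b =
         frechet_derivative (\<lambda>y. frechet_derivative F (at y) w) (at x) v \<bullet> b"
    using second_derivative_symmetric_real[OF Fb assms(2,3), of v w] by (simp add: 2)
qed

section \<open>Matrices\<close>

lemma bounded_bilinear_matrix_mult:
    "bounded_bilinear ((**) :: real^'n^'m \<Rightarrow> real^'p^'n \<Rightarrow> real^'p^'m)"
  unfolding bilinear_conv_bounded_bilinear[symmetric] bilinear_def linear_iff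
  by (auto simp: matrix_matrix_mult_def vec_eq_iff algebra_simps sum.distrib sum_distrib_left)

interpretation mm: bounded_bilinear "(**) :: real^'n^'m \<Rightarrow> real^'p^'n \<Rightarrow> real^'p^'m"
  by (rule bounded_bilinear_matrix_mult)

lemmas mm_simps = mm.add_left mm.add_right mm.diff_left mm.diff_right mm.scaleR_left mm.scaleR_right
  mm.minus_left mm.minus_right scaleR_add_right scaleR_diff_right matrix_mul_assoc

lemma transpose_add: "transpose (A + B) = transpose A + transpose (B :: 'a::plus^'n^'m)"
  by (simp add: transpose_def vec_eq_iff)

lemma transpose_minus: "transpose (- A) = - transpose (A :: 'a::uminus^'n^'m)"
  by (simp add: transpose_def vec_eq_iff)

lemma transpose_diff: "transpose (A - B) = transpose A - transpose (B :: 'a::minus^'n^'m)"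
  by (simp add: transpose_def vec_eq_iff)

lemma transpose_zero: "transpose (0 :: real^'n^'m) = 0"
  by (simp add: transpose_def vec_eq_iff)

lemma bounded_linear_transpose: "bounded_linear (transpose :: real^'n^'m \<Rightarrow> real^'m^'n)"
  unfolding linear_conv_bounded_linear[symmetric]
  by (rule linearI) (simp_all add: transpose_add transpose_scalar)

lemmas transpose_simps = transpose_add transpose_minus transpose_diff transpose_scalar
  matrix_transpose_mul transpose_transpose transpose_mat

lemma inner_matrix_mult_left:
  "(A ** B) \<bullet> C = B \<bullet> (transpose A ** C)" for A :: "real^'n^'m" and B :: "real^'p^'n"
proof -
  have "(A ** B) \<bullet> C = (\<Sum>i\<in>UNIV. \<Sum>j\<in>UNIV. \<Sum>k\<in>UNIV. A$i$k * B$k$j * C$i$j)"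
    by (simp add: inner_vec_def matrix_matrix_mult_def sum_distrib_right)
  also have "\<dots> = (\<Sum>i\<in>UNIV. \<Sum>k\<in>UNIV. \<Sum>j\<in>UNIV. A$i$k * B$k$j * C$i$j)"
    by (intro sum.cong refl sum.swap)
  also have "\<dots> = (\<Sum>k\<in>UNIV. \<Sum>i\<in>UNIV. \<Sum>j\<in>UNIV. A$i$k * B$k$j * C$i$j)"
    by (rule sum.swap)
  also have "\<dots> = (\<Sum>k\<in>UNIV. \<Sum>j\<in>UNIV. \<Sum>i\<in>UNIV. A$i$k * B$k$j * C$i$j)"
    by (intro sum.cong refl sum.swap)
  also have "\<dots> = B \<bullet> (transpose A ** C)"
    by (simp add: inner_vec_def matrix_matrix_mult_def transpose_def sum_distrib_left mult_ac)
  finally show ?thesis .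
qed

lemma inner_transpose: "transpose A \<bullet> transpose B = A \<bullet> (B :: real^'n^'m)"
  unfolding inner_vec_def transpose_def by (simp add: sum.swap[of _ "UNIV :: 'n set"])

lemma inner_matrix_mult_right:
  "(A ** B) \<bullet> C = A \<bullet> (C ** transpose B)" for A :: "real^'n^'m" and B :: "real^'p^'n"
proof -
  have "(A ** B) \<bullet> C = (transpose B ** transpose A) \<bullet> transpose C"
    using inner_transpose[of "A ** B" C] by (simp add: matrix_transpose_mul)
  also have "\<dots> = transpose A \<bullet> transpose (C ** transpose B)"
    by (simp add: inner_matrix_mult_left matrix_transpose_mul)
  finally show ?thesis by (simp add: inner_transpose)
qed

lemma vector_4 [simp]:
  "(vector [x,y,z,w] :: ('a::zero)^4) $ 1 = x"
  "(vector [x,y,z,w] :: ('a::zero)^4) $ 2 = y"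
  "(vector [x,y,z,w] :: ('a::zero)^4) $ 3 = z"
  "(vector [x,y,z,w] :: ('a::zero)^4) $ 4 = w"
  unfolding vector_def by simp_all

section \<open>The Lie algebra of skew matrices\<close>

definition so4 :: "(real^4^4) set" where
  "so4 = {V. transpose V = - V}"

text \<open>Left multiplication by the imaginary quaternion with coordinates \<open>u\<close>, in
  the basis 1, i, -j, k of the quaternions. The sign of j is chosen so that these matrices are the
  images under \<open>\<rho>\<close> of the traceless skew-Hermitian matrices.
  \<open>lmat_mult\<close> is then the quaternion product of imaginary elements.\<close>

definition lmat :: "real^3 \<Rightarrow> real^4^4" where
  "lmat u = vector
     [vector [0, - u$1, u$2, - u$3],
      vector [u$1, 0, u$3, u$2],
      vector [- u$2, - u$3, 0, u$1],
      vector [u$3, - u$2, - u$1, 0]]"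

text \<open>\<open>J4\<close> is minus quaternion conjugation, so this is right multiplication by
  the conjugate of \<open>u\<close>. The conjugate makes the assignment multiplicative rather than
  anti-multiplicative, with the same product rule as \<open>lmat\<close>.\<close>

definition rmat :: "real^3 \<Rightarrow> real^4^4" where
  "rmat u = J4 ** lmat u ** J4"

lemma J4_components:
  "J4 $ i $ j = (if i = j then (if i = 1 then -1 else 1) else 0)"
  by (simp add: J4_def)

lemma J4_J4: "J4 ** J4 = mat 1"
  by (simp add: vec_eq_iff forall_4 matrix_matrix_mult_def sum_4 J4_components mat_def)

lemma J4_J4_left: "J4 ** (J4 ** X) = X"
  by (simp add: matrix_mul_assoc J4_J4)

lemma transpose_J4: "transpose J4 = J4"
  by (simp add: vec_eq_iff J4_components transpose_def)

lemma det_J4: "det J4 = -1"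
proof -
  have "det J4 = (\<Prod>i\<in>UNIV. J4 $ i $ i)"
    by (rule det_diagonal) (simp add: J4_components)
  also have "\<dots> = (\<Prod>i\<in>{1, 2, 3, 4}. J4 $ i $ i)"
    by (simp only: UNIV_4)
  finally show ?thesis
    by (simp add: J4_components)
qed

lemma rmat_expand:
  "rmat u = vector
     [vector [0, u$1, - u$2, u$3],
      vector [- u$1, 0, u$3, u$2],
      vector [u$2, - u$3, 0, u$1],
      vector [- u$3, - u$2, - u$1, 0]]"
  by (simp add: rmat_def lmat_def vec_eq_iff forall_4 matrix_matrix_mult_def sum_4 J4_components)

lemma linear_lmat: "linear lmat"
  by (rule linearI) (simp_all add: lmat_def vec_eq_iff forall_4)

lemma linear_rmat: "linear rmat"
  by (rule linearI) (simp_all add: rmat_expand vec_eq_iff forall_4)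

lemmas lmat_linear = linear_add[OF linear_lmat] linear_scale[OF linear_lmat]
    linear_neg[OF linear_lmat]
  linear_diff[OF linear_lmat] linear_0[OF linear_lmat]
lemmas rmat_linear = linear_add[OF linear_rmat] linear_scale[OF linear_rmat]
    linear_neg[OF linear_rmat]
  linear_diff[OF linear_rmat] linear_0[OF linear_rmat]

lemma lmat_mult: "lmat u ** lmat v = lmat (cross3 u v) - (u \<bullet> v) *\<^sub>R mat 1"
  by (simp add: lmat_def vec_eq_iff forall_4 matrix_matrix_mult_def sum_4 mat_def inner_vec_def
      sum_3 cross3_def algebra_simps)

lemma rmat_mult: "rmat u ** rmat v = rmat (cross3 u v) - (u \<bullet> v) *\<^sub>R mat 1"
proof -
  have "rmat u ** rmat v = J4 ** (lmat u ** lmat v) ** J4"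
    by (simp add: rmat_def matrix_mul_assoc[symmetric] J4_J4_left)
  then show ?thesis
    by (simp add: lmat_mult rmat_def mm_simps J4_J4)
qed

text \<open>Associativity of the quaternions: a left and a right multiplication commute.\<close>

lemma lmat_rmat_commute: "lmat u ** rmat v = rmat v ** lmat u"
  by (simp add: rmat_expand lmat_def vec_eq_iff forall_4 matrix_matrix_mult_def sum_4 algebra_simps)

lemma transpose_lmat: "transpose (lmat u) = - lmat u"
  by (simp add: lmat_def vec_eq_iff forall_4 transpose_def)

lemma transpose_rmat: "transpose (rmat u) = - rmat u"
  by (simp add: rmat_expand vec_eq_iff forall_4 transpose_def)

lemma inner_lmat: "lmat u \<bullet> lmat v = 4 * (u \<bullet> v)"
  by (simp add: lmat_def inner_vec_def sum_3 sum_4)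

lemma inner_rmat: "rmat u \<bullet> rmat v = 4 * (u \<bullet> v)"
  by (simp add: rmat_expand inner_vec_def sum_3 sum_4)

lemma inner_lmat_rmat: "lmat u \<bullet> rmat v = 0" "rmat v \<bullet> lmat u = 0"
  by (simp_all add: lmat_def rmat_expand inner_vec_def sum_4)

lemma lmat_eq_iff: "lmat u = lmat v \<longleftrightarrow> u = v" and rmat_eq_iff: "rmat u = rmat v \<longleftrightarrow> u = v"
  by (auto simp: lmat_def rmat_expand vec_eq_iff forall_4 forall_3)

lemma so4_lmat: "lmat u \<in> so4" and so4_rmat: "rmat u \<in> so4"
  by (simp_all add: so4_def transpose_lmat transpose_rmat)

lemma subspace_so4: "subspace so4"
  by (auto simp: subspace_def so4_def transpose_simps transpose_zero)

text \<open>The splitting of a skew matrix into its self-dual and anti-self-dual parts. The entries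
  of \<open>lmat a + rmat b\<close> at complementary index pairs are, up to sign, the sums and
  differences of the coordinates of \<open>a\<close> and \<open>b\<close>, so half sums and half
  differences of entries recover both vectors.\<close>

lemma so4_decompose:
  assumes "V \<in> so4"
  obtains u v where "V = lmat u + rmat v"
proof
  have skew: "V $ j $ i = - V $ i $ j" for i j
  proof -
    have "transpose V $ i $ j = (- V) $ i $ j"
      using assms unfolding so4_def by (simp only: mem_Collect_eq)
    then show ?thesis by (simp only: transpose_def vec_lambda_beta uminus_vec_def
        vector_minus_component)
  qed
  have diag: "V$1$1 = 0" "V$2$2 = 0" "V$3$3 = 0" "V$4$4 = 0"
    using skew[of 1 1] skew[of 2 2] skew[of 3 3] skew[of 4 4] by linarith+
  show "V = lmat (vector [(V$2$1 + V$3$4) / 2, (V$2$4 - V$3$1) / 2, (V$2$3 + V$4$1) / 2]) +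
                 rmat (vector [(V$3$4 - V$2$1) / 2, (V$2$4 + V$3$1) / 2, (V$2$3 - V$4$1) / 2])"
    by (simp add: lmat_def rmat_expand vec_eq_iff forall_4 field_simps diag
        skew[of 1 2] skew[of 1 3] skew[of 1 4] skew[of 2 3] skew[of 2 4] skew[of 3 4])
qed

lemma lmat_rmat_eq_iff: "lmat a + rmat b = lmat c + rmat d \<longleftrightarrow> a = c \<and> b = d"
proof
  assume eq: "lmat a + rmat b = lmat c + rmat d"
  then have "lmat (a - c) = rmat (d - b)"
    by (simp add: lmat_linear rmat_linear algebra_simps)
  then have "lmat (a - c) \<bullet> lmat (a - c) = 0" "rmat (d - b) \<bullet> rmat (d - b) = 0"
    by (metis inner_lmat_rmat)+
  then show "a = c \<and> b = d"
    by (simp add: inner_lmat inner_rmat)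
qed simp

text \<open>In a commutator the scalar parts of the quaternion products cancel and the cross product
  is counted twice, whence the factor \<open>2\<close>; mixed terms vanish because the two copies
  commute.\<close>

lemma ad_lmat_rmat:
  "ad (lmat a + rmat b) (lmat c + rmat d) = lmat (2 *\<^sub>R cross3 a c) + rmat (2 *\<^sub>R cross3 b d)"
proof -
  have "cross3 c a = - cross3 a c" "cross3 d b = - cross3 b d" by (rule cross_skew)+
  then have "ad (lmat a + rmat b) (lmat c + rmat d) = (lmat (cross3 a c) + lmat (cross3 a c)) +
      (rmat (cross3 b d) + rmat (cross3 b d))"
    by (simp add: ad_def mm_simps lmat_mult rmat_mult lmat_rmat_commute lmat_linear rmat_linear
        inner_commute
      algebra_simps)
  then show ?thesis
    by (simp only: lmat_linear rmat_linear scaleR_2)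
qed

lemma ad_lmat_rmat_zero: "ad (lmat a) (rmat d) = 0"
  using ad_lmat_rmat[of a 0 0 d] by (simp add: lmat_linear rmat_linear)

lemma ad_so4: "\<lbrakk>U \<in> so4; V \<in> so4\<rbrakk> \<Longrightarrow> ad U V \<in> so4"
  by (auto simp: so4_def ad_def transpose_simps mm_simps)

text \<open>Invariance of the inner product under the adjoint action. Together with the skewness of
  \<open>ad\<close> it makes \<open>ad U V \<bullet> W\<close> totally skew.\<close>

lemma inner_ad_cyclic:
  assumes "U \<in> so4" "V \<in> so4" "W \<in> so4"
  shows "ad U V \<bullet> W = ad V W \<bullet> U"
proof -
  have "(U ** V) \<bullet> W = - ((W ** V) \<bullet> U)" "(V ** U) \<bullet> W = - ((V ** W) \<bullet> U)"
    using assms by (simp_all add: so4_def inner_matrix_mult_right[of U V W]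
        inner_matrix_mult_left[of V U W]
        inner_commute[of U] mm_simps)
  then show ?thesis by (simp add: ad_def inner_diff_left)
qed

definition lpart :: "real^4^4 \<Rightarrow> real^3" where "lpart V = (\<chi> i. V \<bullet> lmat (axis i 1) / 4)"
definition rpart :: "real^4^4 \<Rightarrow> real^3" where "rpart V = (\<chi> i. V \<bullet> rmat (axis i 1) / 4)"

lemma linear_lpart: "linear lpart" and linear_rpart: "linear rpart"
  by (auto intro!: linearI simp: lpart_def rpart_def vec_eq_iff inner_add_left add_divide_distrib)

lemma lpart_eq [simp]: "lpart (lmat u + rmat v) = u"
    and rpart_eq [simp]: "rpart (lmat u + rmat v) = v"
  by (simp_all add: lpart_def rpart_def vec_eq_iff inner_add_left inner_lmat inner_rmat
      inner_lmat_rmat inner_axis)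

lemma so4_parts: "V \<in> so4 \<Longrightarrow> V = lmat (lpart V) + rmat (rpart V)"
  by (metis so4_decompose lpart_eq rpart_eq)

text \<open>Preservation of the inner product gives injectivity on \<open>so4\<close>, and a
  subspace of \<open>so4\<close> with the same dimension is everything.\<close>

lemma so4_image_eq:
  assumes "linear g" "\<And>V. V \<in> so4 \<Longrightarrow> g V \<in> so4" "\<And>U V. \<lbrakk>U \<in> so4; V \<in> so4\<rbrakk> \<Longrightarrow> g U \<bullet> g V = U \<bullet> V"
  shows "g ` so4 = so4"
proof (rule subspace_dim_equal)
  show "subspace (g ` so4)" by (rule linear_subspace_image[OF assms(1) subspace_so4])
  have "inj_on g (span so4)"
  proof (rule inj_onI)
    fix U V assume "U \<in> span so4" "V \<in> span so4" "g U = g V"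
    then have "U - V \<in> so4" "g (U - V) = 0"
      using subspace_so4 by (auto simp: span_eq_iff[THEN iffD2] subspace_diff
          linear_diff[OF assms(1)])
    then show "U = V" using assms(3)[of "U - V" "U - V"] by simp
  qed
  then show "dim so4 \<le> dim (g ` so4)"
    using dim_image_eq[OF assms(1)] by simp
qed (use assms subspace_so4 in auto)

section \<open>Unit quaternions\<close>

text \<open>The unit quaternions acting by left multiplication; \<open>decomplexify_SU2\<close>
  identifies them with the image of SU(2). Conjugation by \<open>J4\<close> turns them into right
  multiplications, the set \<open>runits\<close>.\<close>

definition lunits :: "(real^4^4) set" where
  "lunits = {s *\<^sub>R mat 1 + lmat u | s u. s\<^sup>2 + u \<bullet> u = 1}"

definition runits :: "(real^4^4) set" where
  "runits = {J4 ** P ** J4 | P. P \<in> lunits}"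

lemma lunits_mult:
  assumes "P \<in> lunits" "Q \<in> lunits"
  shows "P ** Q \<in> lunits"
proof -
  obtain s u t v where P: "P = s *\<^sub>R mat 1 + lmat u" "s\<^sup>2 + u \<bullet> u = 1"
    and Q: "Q = t *\<^sub>R mat 1 + lmat v" "t\<^sup>2 + v \<bullet> v = 1"
    using assms by (auto simp: lunits_def)
  let ?w = "s *\<^sub>R v + t *\<^sub>R u + cross3 u v"
  have "P ** Q = (s * t - u \<bullet> v) *\<^sub>R mat 1 + lmat ?w"
    by (simp add: P Q mm_simps lmat_mult lmat_linear algebra_simps)
  \<comment> \<open>Multiplicativity of the quaternion norm, that is, Euler's four-square
    identity.\<close>
  moreover have "(s * t - u \<bullet> v)\<^sup>2 + ?w \<bullet> ?w = (s\<^sup>2 + u \<bullet> u) * (t\<^sup>2 + v \<bullet> v)"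
    by (simp add: cross3_simps power2_eq_square)
  ultimately show ?thesis
    unfolding lunits_def P(2) Q(2) by auto
qed

text \<open>Transposition is quaternion conjugation here: it negates the skew part
  \<open>lmat u\<close>.\<close>

lemma lunits_transpose:
  assumes "P \<in> lunits" shows "transpose P \<in> lunits" "transpose P ** P = mat 1"
      "P ** transpose P = mat 1"
proof -
  obtain s u where P: "P = s *\<^sub>R mat 1 + lmat u" "s\<^sup>2 + u \<bullet> u = 1"
    using assms by (auto simp: lunits_def)
  have t: "transpose P = s *\<^sub>R mat 1 + lmat (- u)"
    by (simp add: P transpose_simps transpose_lmat lmat_linear)
  have "s\<^sup>2 + (- u) \<bullet> (- u) = 1" using P(2) by simp
  with t show "transpose P \<in> lunits" unfolding lunits_def by blast
  have "s *\<^sub>R s *\<^sub>R mat 1 + (u \<bullet> u) *\<^sub>R mat 1 = (mat 1 :: real^4^4)"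
    using P(2) by (simp add: power2_eq_square flip: scaleR_add_left)
  then show "transpose P ** P = mat 1" "P ** transpose P = mat 1"
    unfolding t unfolding P by (simp_all add: mm_simps lmat_mult lmat_linear algebra_simps)
qed

lemma lunits_uminus: "P \<in> lunits \<Longrightarrow> - P \<in> lunits"
proof -
  assume "P \<in> lunits"
  then obtain s u where "P = s *\<^sub>R mat 1 + lmat u" "s\<^sup>2 + u \<bullet> u = 1" by (auto simp: lunits_def)
  then have "- P = (- s) *\<^sub>R mat 1 + lmat (- u) \<and> (- s)\<^sup>2 + (- u) \<bullet> (- u) = 1"
      by (simp add: lmat_linear)
  then show "- P \<in> lunits" unfolding lunits_def by blast
qed

lemma lmat_in_lunits: "u \<bullet> u = 1 \<Longrightarrow> lmat u \<in> lunits"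
proof -
  assume "u \<bullet> u = 1"
  then have "lmat u = 0 *\<^sub>R mat 1 + lmat u \<and> 0\<^sup>2 + u \<bullet> u = 1" by simp
  then show ?thesis unfolding lunits_def by blast
qed

lemma mat_1_in_lunits: "mat 1 \<in> lunits"
proof -
  have "mat 1 = 1 *\<^sub>R mat 1 + lmat 0 \<and> 1\<^sup>2 + 0 \<bullet> (0 :: real^3) = 1" by (simp add: lmat_linear)
  then show ?thesis unfolding lunits_def by blast
qed

lemma lunits_rmat_commute: "P \<in> lunits \<Longrightarrow> P ** rmat v = rmat v ** P"
  by (auto simp: lunits_def mm_simps lmat_rmat_commute)

lemma lunits_conj_rmat: "P \<in> lunits \<Longrightarrow> P ** rmat v ** transpose P = rmat v"
  by (simp add: lunits_rmat_commute lunits_transpose flip: matrix_mul_assoc)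

lemma runits_transpose:
  assumes "Q \<in> runits" shows "transpose Q \<in> runits" "transpose Q ** Q = mat 1"
      "Q ** transpose Q = mat 1"
proof -
  obtain P where P: "P \<in> lunits" "Q = J4 ** P ** J4" using assms by (auto simp: runits_def)
  have t: "transpose Q = J4 ** transpose P ** J4"
    by (simp add: P(2) transpose_simps transpose_J4 matrix_mul_assoc)
  then show "transpose Q \<in> runits" unfolding runits_def using lunits_transpose(1)[OF P(1)] by blast
  have "transpose Q ** Q = J4 ** (transpose P ** P) ** J4"
      "Q ** transpose Q = J4 ** (P ** transpose P) ** J4"
    unfolding t unfolding P(2) by (simp_all add: J4_J4_left flip: matrix_mul_assoc)
  then show "transpose Q ** Q = mat 1" "Q ** transpose Q = mat 1"
    by (simp_all add: lunits_transpose[OF P(1)] J4_J4)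
qed

lemma lunits_runits_commute:
  assumes "P \<in> lunits" "Q \<in> runits" shows "P ** Q = Q ** P"
proof -
  obtain s u where "Q = J4 ** (s *\<^sub>R mat 1 + lmat u) ** J4"
    using assms(2) by (auto simp: runits_def lunits_def)
  then have "Q = s *\<^sub>R mat 1 + rmat u"
    by (simp add: mm_simps J4_J4 rmat_def)
  then show ?thesis using lunits_rmat_commute[OF assms(1)] by (simp add: mm_simps)
qed

lemma runits_conj_lmat:
  assumes "Q \<in> runits" shows "Q ** lmat v ** transpose Q = lmat v"
proof -
  obtain P where P: "P \<in> lunits" "Q = J4 ** P ** J4" using assms by (auto simp: runits_def)
  have "Q ** lmat v ** transpose Q = J4 ** (P ** rmat v ** transpose P) ** J4"
    unfolding P(2) rmat_def matrix_transpose_mul transpose_J4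
        by (simp add: J4_J4_left flip: matrix_mul_assoc)
  also have "\<dots> = lmat v"
    unfolding lunits_conj_rmat[OF P(1)]
        by (simp add: rmat_def J4_J4 J4_J4_left flip: matrix_mul_assoc)
  finally show ?thesis .
qed

section \<open>Orthogonal maps of three-space\<close>

text \<open>A unit imaginary quaternion \<open>n\<close> has square -1 and anticommutes with the
  vectors orthogonal to it. The product n v n therefore negates \<open>n\<close> and fixes its
  orthogonal complement: it is a reflection.\<close>

lemma cross3_reflect:
  assumes "n \<bullet> n = 1"
  shows "lmat n ** lmat v ** lmat n = lmat (v - (2 * (n \<bullet> v)) *\<^sub>R n)"
proof -
  have triple: "cross3 (cross3 n v) n = (n \<bullet> n) *\<^sub>R v - (n \<bullet> v) *\<^sub>R n" "cross3 n v \<bullet> n = 0"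
    using cross_skew[of "cross3 n v" n] by (simp_all add: Lagrange dot_cross_self)
  have "lmat n ** lmat v ** lmat n =
      lmat (cross3 (cross3 n v) n) - (cross3 n v \<bullet> n) *\<^sub>R mat 1 - (n \<bullet> v) *\<^sub>R lmat n"
    by (simp add: lmat_mult mm.diff_left mm.scaleR_left)
  also have "\<dots> = lmat v - (n \<bullet> v) *\<^sub>R lmat n - (n \<bullet> v) *\<^sub>R lmat n"
    unfolding triple assms by (simp add: lmat_linear)
  also have "\<dots> = lmat (v - (2 * (n \<bullet> v)) *\<^sub>R n)"
    unfolding lmat_linear mult_2 scaleR_add_left by (simp only: diff_diff_eq)
  finally show ?thesis .
qed

text \<open>Conjugation by a unit quaternion yields only rotations. In odd dimension an improper
  orthogonal map is minus a rotation, so one sign \<sigma> accounts for the rest.\<close>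

definition lunit_conj :: "(real^3 \<Rightarrow> real^3) \<Rightarrow> bool" where
  "lunit_conj T \<longleftrightarrow> (\<exists>\<sigma>\<in>{1, -1}. \<exists>P\<in>lunits. \<forall>v. lmat (T v) = \<sigma> *\<^sub>R (P ** lmat v ** transpose P))"

lemma lunit_conj_comp:
  assumes "lunit_conj S" "lunit_conj T" shows "lunit_conj (\<lambda>v. S (T v))"
proof -
  obtain \<sigma> P where S: "\<sigma> \<in> {1, -1}" "P \<in> lunits"
      "\<And>v. lmat (S v) = \<sigma> *\<^sub>R (P ** lmat v ** transpose P)"
    using assms(1) unfolding lunit_conj_def by blast
  obtain \<upsilon> Q where T: "\<upsilon> \<in> {1, -1}" "Q \<in> lunits"
      "\<And>v. lmat (T v) = \<upsilon> *\<^sub>R (Q ** lmat v ** transpose Q)"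
    using assms(2) unfolding lunit_conj_def by blast
  have "lmat (S (T v)) = (\<sigma> * \<upsilon>) *\<^sub>R ((P ** Q) ** lmat v ** transpose (P ** Q))" for v
    by (simp add: S(3) T(3) mm_simps transpose_simps)
  moreover have "\<sigma> * \<upsilon> \<in> {1, -1}" using S(1) T(1) by auto
  ultimately show ?thesis
    unfolding lunit_conj_def using lunits_mult[OF S(2) T(2)] by blast
qed

lemma lunit_conj_id: "lunit_conj (\<lambda>v. v)"
  unfolding lunit_conj_def using mat_1_in_lunits by (force intro!: bexI[of _ 1] bexI[of _ "mat 1"])

text \<open>Since \<open>lmat n\<close> is skew, the product in \<open>cross3_reflect\<close> is
  minus the conjugation by \<open>lmat n\<close>; hence the sign \<open>-1\<close>.\<close>

lemma lunit_conj_reflect: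
  assumes "n \<bullet> n = 1" shows "lunit_conj (\<lambda>v. v - (2 * (n \<bullet> v)) *\<^sub>R n)"
  unfolding lunit_conj_def
  by (rule bexI[of _ "-1"], rule bexI[of _ "lmat n"])
     (use assms in \<open>simp_all add: cross3_reflect lmat_in_lunits transpose_lmat mm_simps\<close>)

text \<open>\<open>R\<close> is the reflection exchanging \<open>T b\<close> and \<open>b\<close>; it fixes the fixed points of \<open>T\<close>, because
  they are orthogonal to \<open>T b - b\<close>.\<close>

lemma reflect_to_fixed:
  assumes "orthogonal_transformation T"
  obtains R where "lunit_conj R" "orthogonal_transformation (R \<circ> T)" "\<And>v. R (R v) = v" "R (T b) = b"
    "\<And>c. T c = c \<Longrightarrow> R (T c) = c"
proof (cases "T b = b")
  case True
  then show ?thesis using that[of "\<lambda>v. v"] assms lunit_conj_id by (simp add: comp_def)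
next
  case False
  have T: "linear T" "\<And>v w. T v \<bullet> T w = v \<bullet> w"
    using assms by (auto simp: orthogonal_transformation_def)
  define d where "d = T b - b"
  define n where "n = d /\<^sub>R norm d"
  have "d \<noteq> 0" using False by (simp add: d_def)
  then have n: "n \<bullet> n = 1" by (simp add: n_def dot_square_norm power2_eq_square)
  define R where "R v = v - (2 * (n \<bullet> v)) *\<^sub>R n" for v
  have R: "R v = v - (2 * (d \<bullet> v) / (d \<bullet> d)) *\<^sub>R d" for v
    by (simp add: R_def n_def dot_square_norm power2_eq_square divide_inverse)
  show ?thesis
  proof (rule that[of R])
    show "lunit_conj R" unfolding R_def by (rule lunit_conj_reflect[OF n])
    show "R (R v) = v" for v
      using n by (simp add: R_def inner_diff_right algebra_simps)
    have "linear R"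
      by (rule linearI) (simp_all add: R_def vec_eq_iff inner_add_right algebra_simps)
    moreover have "R v \<bullet> R w = v \<bullet> w" for v w
      using n by (simp add: R_def inner_diff_right inner_diff_left inner_commute[of v n])
    ultimately show "orthogonal_transformation (R \<circ> T)"
      using T by (simp add: orthogonal_transformation_def linear_compose)
    have "2 * (d \<bullet> T b) = d \<bullet> d"
      using T(2)[of b b] by (simp add: d_def inner_diff_left inner_diff_right inner_commute)
    then show "R (T b) = b" using \<open>d \<noteq> 0\<close> by (simp add: R) (simp add: d_def)
    show "R (T c) = c" if "T c = c" for c
    proof -
      have "d \<bullet> c = 0" using T(2)[of b c] that by (simp add: d_def inner_diff_left)
      then show ?thesis by (simp add: R that)
    qed
  qed
qed

text \<open>The Cartan-Dieudonne argument: each of three maps makes one more coordinate axis fixed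
  without disturbing the earlier ones, so their composition with \<open>T\<close> is the identity.
  As the three maps are involutions, \<open>T\<close> is their product in reverse order.\<close>

lemma orthogonal_transformation_lunit_conj:
  fixes T :: "real^3 \<Rightarrow> real^3"
  assumes "orthogonal_transformation T"
  shows "lunit_conj T"
proof -
  obtain R1 where R1: "lunit_conj R1" "orthogonal_transformation (R1 \<circ> T)" "\<And>v. R1 (R1 v) = v"
      "R1 (T (axis 1 1)) = axis 1 1" "\<And>c. T c = c \<Longrightarrow> R1 (T c) = c"
    by (rule reflect_to_fixed[OF assms, of "axis 1 1"], rule that)
  obtain R2 where R2: "lunit_conj R2" "orthogonal_transformation (R2 \<circ> (R1 \<circ> T))"
      "\<And>v. R2 (R2 v) = v"
      "R2 ((R1 \<circ> T) (axis 2 1)) = axis 2 1" "\<And>c. (R1 \<circ> T) c = c \<Longrightarrow> R2 ((R1 \<circ> T) c) = c"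
    by (rule reflect_to_fixed[OF R1(2), of "axis 2 1"], rule that)
  obtain R3 where R3: "lunit_conj R3" "orthogonal_transformation (R3 \<circ> (R2 \<circ> (R1 \<circ> T)))"
      "\<And>v. R3 (R3 v) = v"
      "R3 ((R2 \<circ> (R1 \<circ> T)) (axis 3 1)) = axis 3 1"
      "\<And>c. (R2 \<circ> (R1 \<circ> T)) c = c \<Longrightarrow> R3 ((R2 \<circ> (R1 \<circ> T)) c) = c"
    by (rule reflect_to_fixed[OF R2(2), of "axis 3 1"], rule that)
  define F where "F = R3 \<circ> (R2 \<circ> (R1 \<circ> T))"
  have "linear F" using R3(2) by (simp add: F_def orthogonal_transformation_def)
  have fixed: "F (axis 1 1) = axis 1 1" "F (axis 2 1) = axis 2 1" "F (axis 3 1) = axis 3 1"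
    unfolding F_def using R1(4) R2(4,5) R3(4,5) by simp_all
  have "F v = v" for v
  proof -
    have v: "v = v$1 *\<^sub>R axis 1 1 + v$2 *\<^sub>R axis 2 1 + v$3 *\<^sub>R axis 3 1"
      by (simp add: vec_eq_iff forall_3 axis_def)
    have "F v = F (v$1 *\<^sub>R axis 1 1 + v$2 *\<^sub>R axis 2 1 + v$3 *\<^sub>R axis 3 1)"
      using v by (rule arg_cong)
    also have "\<dots> = v$1 *\<^sub>R axis 1 1 + v$2 *\<^sub>R axis 2 1 + v$3 *\<^sub>R axis 3 1"
      by (simp add: linear_add[OF \<open>linear F\<close>] linear_scale[OF \<open>linear F\<close>] fixed)
    finally show ?thesis using v by (rule trans[OF _ sym])
  qed
  then have "T v = R1 (R2 (R3 v))" for v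
    using R1(3)[of "T v"] R2(3)[of "R1 (T v)"] R3(3)[of "R2 (R1 (T v))"] by (simp add: F_def)
  moreover have "lunit_conj (\<lambda>v. R1 (R2 (R3 v)))"
    by (intro lunit_conj_comp[OF R1(1)] lunit_conj_comp[OF R2(1)] R3(1))
  ultimately show ?thesis by presburger
qed

section \<open>Lie triple automorphisms of the skew matrices\<close>

lemma cross3_zero_parallel:
  assumes "cross3 x y = 0" "x \<noteq> 0"
  shows "y = ((x \<bullet> y) / (x \<bullet> x)) *\<^sub>R x"
proof -
  have "(x \<bullet> x) *\<^sub>R y = (x \<bullet> y) *\<^sub>R x"
    using Lagrange[of x x y] assms(1) by simp
  then have "(1 / (x \<bullet> x)) *\<^sub>R ((x \<bullet> x) *\<^sub>R y) = (1 / (x \<bullet> x)) *\<^sub>R ((x \<bullet> y) *\<^sub>R x)"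
    by (rule arg_cong)
  then show ?thesis using assms(2) by simp
qed

lemma cross3_left_zero:
  assumes "\<And>y. cross3 x y = 0" shows "x = 0"
  using assms cross_basis_nonzero by blast

lemma inner_preserving_zero:
  fixes P :: "real^3 \<Rightarrow> real^3"
  assumes "linear P" "\<And>u v. P u \<bullet> P v = u \<bullet> v" "\<And>u. P u \<bullet> y = 0"
  shows "y = 0"
proof -
  have "orthogonal_transformation P"
    using assms by (simp add: orthogonal_transformation_def)
  then obtain x where "y = P x" using orthogonal_transformation_surj by (metis surjD)
  with assms(3)[of x] show ?thesis by simp
qed

text \<open>\<open>P\<close> and \<open>Q\<close> stand for the two components of the map on the
  left ideal, \<open>P'\<close> and \<open>Q'\<close> for those on the right ideal. All values of
  \<open>P'\<close> are parallel to \<open>P a\<close>, so \<open>P'\<close> has rank at most one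
  and \<open>Q'\<close> is isometric on two orthogonal vectors of its kernel. Every
  \<open>Q u\<close> is parallel to both of their images, which are orthogonal and nonzero, so
  \<open>Q\<close> vanishes. Then \<open>P\<close> is an isometry, and \<open>P'\<close>, being
  orthogonal to its range, vanishes as well.\<close>

lemma commuting_blocks_nonzero:
  fixes P Q P' Q' :: "real^3 \<Rightarrow> real^3"
  assumes lin: "linear P" "linear P'"
    and comm: "\<And>u v. cross3 (P u) (P' v) = 0" "\<And>u v. cross3 (Q u) (Q' v) = 0"
    and orth: "\<And>u v. P u \<bullet> P v + Q u \<bullet> Q v = u \<bullet> v"
      "\<And>u v. P' u \<bullet> P' v + Q' u \<bullet> Q' v = u \<bullet> v" "\<And>u v. P u \<bullet> P' v + Q u \<bullet> Q' v = 0"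
    and "P a \<noteq> 0"
  shows "Q u = 0" "P' v = 0"
proof -
  \<comment> \<open>\<open>P' v\<close> is a multiple of \<open>P a\<close> whose coefficient is
    proportional to \<open>m \<bullet> v\<close>, so the orthogonal complement of \<open>m\<close>
    lies in the kernel of \<open>P'\<close>.\<close>
  define m where "m = adjoint P' (P a)"
  have m: "P' v = 0" if "m \<bullet> v = 0" for v
  proof -
    have "P a \<bullet> P' v = 0"
      using that by (simp add: m_def adjoint_works[OF lin(2)] inner_commute)
    then show ?thesis
      using cross3_zero_parallel[OF comm(1)[of a v] \<open>P a \<noteq> 0\<close>] by simp
  qed
  obtain v1 where v1: "v1 \<noteq> 0" "m \<bullet> v1 = 0"
    using orthogonal_to_vector_exists[of m] by (auto simp: orthogonal_def)
  have "dim {m, v1} \<le> card {m, v1}"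
    by (rule dim_le_card') simp
  also have "\<dots> \<le> 2" by (simp add: card_insert_if)
  finally have "dim {m, v1} < DIM(real^3)" by simp
  then obtain v2 where "v2 \<noteq> 0" "\<And>y. y \<in> span {m, v1} \<Longrightarrow> orthogonal v2 y"
    using orthogonal_to_subspace_exists by blast
  then have v2: "v2 \<noteq> 0" "m \<bullet> v2 = 0" "v1 \<bullet> v2 = 0"
    by (simp_all add: span_base orthogonal_def inner_commute)
  note kill = m[OF v1(2)] m[OF v2(2)]
  have q: "Q' v1 \<bullet> Q' v1 = v1 \<bullet> v1" "Q' v2 \<bullet> Q' v2 = v2 \<bullet> v2" "Q' v1 \<bullet> Q' v2 = 0"
    using orth(2)[of v1 v1] orth(2)[of v2 v2] orth(2)[of v1 v2] v2(3) by (simp_all add: kill)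
  have Q0: "Q u = 0" for u
  proof -
    have c: "cross3 (Q' v) (Q u) = 0" for v using comm(2)[of u v] cross_skew[of "Q' v" "Q u"]
        by simp
    have nz: "Q' v1 \<noteq> 0" "Q' v2 \<noteq> 0" using q(1,2) v1(1) v2(1) by auto
    obtain k where k: "Q u = k *\<^sub>R Q' v1" using cross3_zero_parallel[OF c nz(1)] by blast
    obtain l where l: "Q u = l *\<^sub>R Q' v2" using cross3_zero_parallel[OF c nz(2)] by blast
    have "k * (Q' v1 \<bullet> Q' v1) = 0"
      using q(3) k l by (metis inner_commute inner_scaleR_left mult_zero_right)
    then show "Q u = 0" using k nz by simp
  qed
  then show "Q u = 0" .
  show "P' v = 0"
    by (rule inner_preserving_zero[OF lin(1)]) (use orth(1,3) Q0 in simp_all)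
qed

text \<open>With respect to the two ideals \<open>g\<close> is a block matrix with entries
  \<open>P\<close>, \<open>Q\<close>, \<open>P'\<close>, \<open>Q'\<close>, of which only the
  diagonal or only the antidiagonal survives. The surviving blocks are orthogonal maps of
  three-space, each a sign times a conjugation by a unit quaternion. The quaternion for one ideal
  acts trivially on the other, so the two conjugations merge into a single one.\<close>

lemma lie_triple_classification:
  assumes lin: "linear g" and so4: "\<And>V. V \<in> so4 \<Longrightarrow> g V \<in> so4"
    and orth: "\<And>U V. \<lbrakk>U \<in> so4; V \<in> so4\<rbrakk> \<Longrightarrow> g U \<bullet> g V = U \<bullet> V"
    and triple: "\<And>U V W. \<lbrakk>U \<in> so4; V \<in> so4; W \<in> so4\<rbrakk> \<Longrightarrow> ad (ad (g U) (g V)) (g W) =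
        g (ad (ad U V) W)"
  obtains A B C \<sigma> \<upsilon> where "A \<in> lunits" "B \<in> runits" "C = A ** B \<or> C = A ** B ** J4"
    "\<sigma> \<in> {1, -1}" "\<upsilon> \<in> {1, -1}"
    "\<And>u v. g (lmat u + rmat v) = C ** (\<sigma> *\<^sub>R lmat u + \<upsilon> *\<^sub>R rmat v) ** transpose C"
proof -
  define P where "P u = lpart (g (lmat u))" for u
  define Q where "Q u = rpart (g (lmat u))" for u
  define P' where "P' v = lpart (g (rmat v))" for v
  define Q' where "Q' v = rpart (g (rmat v))" for v
  have gl: "g (lmat u) = lmat (P u) + rmat (Q u)" and gr: "g (rmat u) = lmat (P' u) + rmat (Q' u)"
      for u
    unfolding P_def Q_def P'_def Q'_def by (intro so4_parts so4 so4_lmat so4_rmat)+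
  have plin: "linear P" "linear Q" "linear P'" "linear Q'"
    using linear_compose[OF linear_compose[OF linear_lmat lin] linear_lpart]
      linear_compose[OF linear_compose[OF linear_lmat lin] linear_rpart]
      linear_compose[OF linear_compose[OF linear_rmat lin] linear_lpart]
      linear_compose[OF linear_compose[OF linear_rmat lin] linear_rpart]
    by (simp_all add: P_def[abs_def] Q_def[abs_def] P'_def[abs_def] Q'_def[abs_def] comp_def)
  have porth: "P u \<bullet> P v + Q u \<bullet> Q v = u \<bullet> v" "P' u \<bullet> P' v + Q' u \<bullet> Q' v = u \<bullet> v"
      "P u \<bullet> P' v + Q u \<bullet> Q' v = 0" for u v
    using orth[OF so4_lmat[of u] so4_lmat[of v]] orth[OF so4_rmat[of u] so4_rmat[of v]]
        orth[OF so4_lmat[of u] so4_rmat[of v]]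
    by (simp_all add: gl gr inner_add_left inner_add_right inner_lmat inner_rmat inner_lmat_rmat)
  \<comment> \<open>The two ideals commute, so by the triple identity the bracket of their images
    centralizes \<open>g\<close> applied to \<open>so4\<close>, which is all of \<open>so4\<close>.
    The centre is zero because a vector with vanishing cross products is zero.\<close>
  have comm: "cross3 (P u) (P' v) = 0 \<and> cross3 (Q u) (Q' v) = 0" for u v
  proof -
    let ?z = "ad (g (lmat u)) (g (rmat v))"
    have z: "?z = lmat (2 *\<^sub>R cross3 (P u) (P' v)) + rmat (2 *\<^sub>R cross3 (Q u) (Q' v))"
      by (simp add: gl gr ad_lmat_rmat)
    have "ad ?z (g W) = 0" if "W \<in> so4" for W
    proof -
      have "ad 0 W = 0" by (simp add: ad_def)
      then show ?thesis
        using triple[OF so4_lmat so4_rmat that, of u v]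
            by (simp add: ad_lmat_rmat_zero linear_0[OF lin])
    qed
    then have central: "ad ?z Y = 0" if "Y \<in> so4" for Y
      using so4_image_eq[OF lin so4 orth] that by (metis imageE)
    have "lmat (4 *\<^sub>R cross3 (cross3 (P u) (P' v)) y) + rmat (4 *\<^sub>R cross3 (cross3 (Q u) (Q' v)) y)
        = lmat 0 + rmat 0" for y
      using central[of "lmat y + rmat y"] subspace_add[OF subspace_so4 so4_lmat so4_rmat]
      unfolding z ad_lmat_rmat by (simp add: cross_mult_left lmat_linear rmat_linear)
    then have "cross3 (cross3 (P u) (P' v)) y = 0 \<and> cross3 (cross3 (Q u) (Q' v)) y = 0" for y
      unfolding lmat_rmat_eq_iff by simp
    then show ?thesis using cross3_left_zero by blast
  qed
  \<comment> \<open>Conjugation by \<open>J4\<close> carries the statement for \<open>lmat\<close>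
    over to \<open>rmat\<close>.\<close>
  have rconj: "\<exists>\<sigma>\<in>{1, -1}. \<exists>B\<in>runits. \<forall>v. rmat (T v) = \<sigma> *\<^sub>R (B ** rmat v ** transpose B)"
    if T: "lunit_conj T" for T
  proof -
    obtain \<sigma> A where A: "\<sigma> \<in> {1, -1}" "A \<in> lunits"
        "\<And>v. lmat (T v) = \<sigma> *\<^sub>R (A ** lmat v ** transpose A)"
      using T unfolding lunit_conj_def by blast
    have "rmat (T v) = \<sigma> *\<^sub>R ((J4 ** A ** J4) ** rmat v ** transpose (J4 ** A ** J4))" for v
      unfolding rmat_def A(3) matrix_transpose_mul transpose_J4
      by (simp add: mm.scaleR_left mm.scaleR_right J4_J4_left flip: matrix_mul_assoc)
    then show ?thesis using A(1,2) unfolding runits_def by blast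
  qed
  have ot: "orthogonal_transformation T" if "linear T" "\<And>u v. T u \<bullet> T v = u \<bullet> v"
      for T :: "real^3 \<Rightarrow> real^3"
    using that by (simp add: orthogonal_transformation_def)
  show ?thesis
  proof (cases "\<exists>a. P a \<noteq> 0")
    case True
    then obtain a where "P a \<noteq> 0" by blast
    have zero: "Q u = 0" "P' u = 0" for u
      by (rule commuting_blocks_nonzero[OF plin(1,3) _ _ porth \<open>P a \<noteq> 0\<close>]; use comm in blast)+
    have ip: "P u \<bullet> P v = u \<bullet> v" "Q' u \<bullet> Q' v = u \<bullet> v" for u v
      using porth(1,2)[of u v] by (simp_all add: zero)
    obtain \<sigma> A where A: "\<sigma> \<in> {1, -1}" "A \<in> lunits"
        "\<And>v. lmat (P v) = \<sigma> *\<^sub>R (A ** lmat v ** transpose A)"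
      using orthogonal_transformation_lunit_conj[OF ot[OF plin(1) ip(1)]] unfolding lunit_conj_def
          by blast
    obtain \<upsilon> B where B: "\<upsilon> \<in> {1, -1}" "B \<in> runits"
        "\<And>v. rmat (Q' v) = \<upsilon> *\<^sub>R (B ** rmat v ** transpose B)"
      using rconj[OF orthogonal_transformation_lunit_conj[OF ot[OF plin(4) ip(2)]]] by blast
    show ?thesis
    proof (rule that[OF A(2) B(2) _ A(1) B(1)])
      show "A ** B = A ** B \<or> A ** B = A ** B ** J4" by simp
      have l: "A ** B ** lmat u ** transpose (A ** B) = A ** lmat u ** transpose A" for u
        using runits_conj_lmat[OF B(2), of u] unfolding matrix_transpose_mul
            by (metis matrix_mul_assoc)
      have r: "A ** B ** rmat v ** transpose (A ** B) = B ** rmat v ** transpose B" for v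
        unfolding lunits_runits_commute[OF A(2) B(2)] matrix_transpose_mul
        using lunits_conj_rmat[OF A(2), of v] by (metis matrix_mul_assoc)
      show "g (lmat u + rmat v) = A ** B ** (\<sigma> *\<^sub>R lmat u + \<upsilon> *\<^sub>R rmat v) ** transpose (A ** B)"
          for u v
        by (simp only: linear_add[OF lin] gl gr zero mm.add_right mm.add_left mm.scaleR_right
            mm.scaleR_left l r A(3) B(3)
            lmat_linear rmat_linear add_0_left add_0_right)
    qed
  next
    case False
    then have "P u = 0" for u by blast
    then have q: "Q u \<bullet> Q v = u \<bullet> v" "Q u \<bullet> Q' v = 0" for u v using porth(1,3)[of u v] by simp_all
    have zero: "P u = 0" "Q' u = 0" for u
      using \<open>\<And>u. P u = 0\<close> inner_preserving_zero[OF plin(2) q(1,2)] by blast+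
    have ip: "P' u \<bullet> P' v = u \<bullet> v" for u v
      using porth(2)[of u v] by (simp add: zero)
    obtain \<upsilon> A where A: "\<upsilon> \<in> {1, -1}" "A \<in> lunits"
        "\<And>v. lmat (P' v) = \<upsilon> *\<^sub>R (A ** lmat v ** transpose A)"
      using orthogonal_transformation_lunit_conj[OF ot[OF plin(3) ip]] unfolding lunit_conj_def
          by blast
    obtain \<sigma> B where B: "\<sigma> \<in> {1, -1}" "B \<in> runits"
        "\<And>v. rmat (Q v) = \<sigma> *\<^sub>R (B ** rmat v ** transpose B)"
      using rconj[OF orthogonal_transformation_lunit_conj[OF ot[OF plin(2) q(1)]]] by blast
    show ?thesis
    \<comment> \<open>The ideals are exchanged, so \<open>J4\<close> acts first. The signs are
      passed crosswise: \<sigma> belongs to the left vectors, whose images lie in the right ideal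
      and are described by \<open>B\<close>.\<close>
    proof (rule that[OF A(2) B(2) _ B(1) A(1)])
      show "A ** B ** J4 = A ** B \<or> A ** B ** J4 = A ** B ** J4" by simp
      have j: "J4 ** lmat u ** J4 = rmat u" "J4 ** rmat u ** J4 = lmat u" for u
        by (simp_all add: rmat_def J4_J4 J4_J4_left flip: matrix_mul_assoc)
      have jj: "A ** B ** J4 ** Y ** transpose (A ** B ** J4) = A ** B ** (J4 ** Y ** J4) **
          transpose (A ** B)" for Y
        by (simp add: matrix_transpose_mul transpose_J4 matrix_mul_assoc)
      have l: "A ** B ** J4 ** lmat u ** transpose (A ** B ** J4) = B ** rmat u ** transpose B"
          for u
        unfolding jj j unfolding lunits_runits_commute[OF A(2) B(2)] matrix_transpose_mul
        using lunits_conj_rmat[OF A(2), of u] by (metis matrix_mul_assoc)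
      have r: "A ** B ** J4 ** rmat v ** transpose (A ** B ** J4) = A ** lmat v ** transpose A"
          for v
        unfolding jj j unfolding matrix_transpose_mul
        using runits_conj_lmat[OF B(2), of v] by (metis matrix_mul_assoc)
      show "g (lmat u + rmat v) = A ** B ** J4 ** (\<sigma> *\<^sub>R lmat u + \<upsilon> *\<^sub>R rmat v) ** transpose
          (A ** B ** J4)" for u v
        by (simp only: linear_add[OF lin] gl gr zero mm.add_right mm.add_left mm.scaleR_right
            mm.scaleR_left l r A(3) B(3)
            lmat_linear rmat_linear add_0_left add_0_right add.commute)
    qed
  qed
qed

section \<open>Cayley factorization\<close>

text \<open>Schur's lemma by entries. Conjugation of quaternions by i or by j is a diagonal matrix
  with two entries 1 and two entries -1; commuting with both kills everything off the diagonal. The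
  diagonal entries agree because the \<open>lmat\<close> matrices move the first basis vector to
  each of the others up to sign.\<close>

lemma commutes_so4_imp_scalar:
  fixes D :: "real^4^4"
  assumes "\<And>u. D ** lmat u = lmat u ** D" "\<And>u. D ** rmat u = rmat u ** D"
  shows "\<exists>k. D = k *\<^sub>R mat 1"
proof -
  let ?e = "\<lambda>k. axis k 1 :: real^3"
  have comp: "(M ** N)$i$j = M$i$1 * N$1$j + M$i$2 * N$2$j + M$i$3 * N$3$j + M$i$4 * N$4$j"
      for M N :: "real^4^4" and i j
    by (simp add: matrix_matrix_mult_def sum_4)
  have G: "D ** (lmat (?e k) ** rmat (?e k)) = lmat (?e k) ** rmat (?e k) ** D" for k
    by (metis assms matrix_mul_assoc)
  have o1: "D$1$3 = 0" "D$1$4 = 0" "D$2$3 = 0" "D$2$4 = 0" "D$3$1 = 0" "D$3$2 = 0" "D$4$1 = 0"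
      "D$4$2 = 0"
    using arg_cong[OF G[of 1], of "\<lambda>M. M$1$3"] arg_cong[OF G[of 1], of "\<lambda>M. M$1$4"]
        arg_cong[OF G[of 1], of "\<lambda>M. M$2$3"] arg_cong[OF G[of 1], of "\<lambda>M. M$2$4"]
        arg_cong[OF G[of 1], of "\<lambda>M. M$3$1"] arg_cong[OF G[of 1], of "\<lambda>M. M$3$2"]
        arg_cong[OF G[of 1], of "\<lambda>M. M$4$1"] arg_cong[OF G[of 1], of "\<lambda>M. M$4$2"]
    by (simp_all add: comp lmat_def rmat_expand axis_def)
  have o2: "D$1$2 = 0" "D$2$1 = 0" "D$3$4 = 0" "D$4$3 = 0"
    using arg_cong[OF G[of 2], of "\<lambda>M. M$1$2"] arg_cong[OF G[of 2], of "\<lambda>M. M$2$1"]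
        arg_cong[OF G[of 2], of "\<lambda>M. M$3$4"] arg_cong[OF G[of 2], of "\<lambda>M. M$4$3"]
    by (simp_all add: comp lmat_def rmat_expand axis_def)
  have "D$2$2 = D$1$1" "D$3$3 = D$1$1" "D$4$4 = D$1$1"
    using arg_cong[OF assms(1)[of "?e 1"], of "\<lambda>M. M$2$1"] arg_cong[OF assms(1)[of "?e 2"], of
        "\<lambda>M. M$3$1"]
      arg_cong[OF assms(1)[of "?e 3"], of "\<lambda>M. M$4$1"]
    by (simp_all add: comp lmat_def axis_def)
  then have "D = (D$1$1) *\<^sub>R mat 1"
    using o1 o2 by (simp add: vec_eq_iff forall_4 mat_def)
  then show ?thesis by blast
qed

lemma O4_iff: "X \<in> O4 \<longleftrightarrow> transpose X ** X = mat 1"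
  by (simp add: O4_def orthogonal_matrix)

lemma O4_cancel:
  assumes "X \<in> O4"
  shows "transpose X ** X = mat 1" "X ** transpose X = mat 1"
    "transpose X ** (X ** Y) = Y" "X ** (transpose X ** Y) = Y"
proof -
  show *: "transpose X ** X = mat 1" "X ** transpose X = mat 1"
    using assms by (auto simp: O4_def orthogonal_matrix_def)
  show "transpose X ** (X ** Y) = Y" "X ** (transpose X ** Y) = Y"
    by (simp_all add: matrix_mul_assoc *)
qed

lemma O4_mult: "\<lbrakk>X \<in> O4; Y \<in> O4\<rbrakk> \<Longrightarrow> X ** Y \<in> O4"
  by (simp add: O4_def orthogonal_matrix_mul)

lemma O4_transpose: "X \<in> O4 \<Longrightarrow> transpose X \<in> O4"
  by (simp add: O4_def)

lemma O4_J4: "J4 \<in> O4"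
  by (simp add: O4_iff transpose_J4 J4_J4)

lemma O4_lunits: "P \<in> lunits \<Longrightarrow> P \<in> O4" and O4_runits: "Q \<in> runits \<Longrightarrow> Q \<in> O4"
  by (simp_all add: O4_iff lunits_transpose runits_transpose)

lemma SO4_iff: "X \<in> SO4 \<longleftrightarrow> X \<in> O4 \<and> det X = 1"
  by (simp add: SO4_def O4_def rotation_matrix_def)

lemma SO4_mult: "\<lbrakk>X \<in> SO4; Y \<in> SO4\<rbrakk> \<Longrightarrow> X ** Y \<in> SO4"
  by (simp add: SO4_iff O4_mult det_mul)

lemma SO4_transpose: "X \<in> SO4 \<Longrightarrow> transpose X \<in> SO4"
  by (simp add: SO4_iff O4_transpose)

lemma SO4_mat_1: "mat 1 \<in> SO4"
  by (simp add: SO4_iff O4_iff)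

lemma so4_conj: "V \<in> so4 \<Longrightarrow> X ** V ** transpose X \<in> so4"
  by (simp add: so4_def transpose_simps mm_simps)

lemma O4_inner:
  fixes U V :: "real^4^4"
  assumes "X \<in> O4" shows "(X ** U) \<bullet> (X ** V) = U \<bullet> V" "(U ** X) \<bullet> (V ** X) = U \<bullet> V"
proof -
  show "(X ** U) \<bullet> (X ** V) = U \<bullet> V"
    by (simp only: inner_matrix_mult_left O4_cancel[OF assms])
  show "(U ** X) \<bullet> (V ** X) = U \<bullet> V"
    by (simp only: inner_matrix_mult_right O4_cancel(2)[OF assms] matrix_mul_rid flip:
        matrix_mul_assoc)
qed

text \<open>Conjugation by \<open>X\<close> is an orthogonal Lie algebra automorphism of
  \<open>so4\<close>, so the classification supplies \<open>C\<close> with the same action up to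
  signs. The discrepancy \<open>D\<close> between \<open>X\<close> and \<open>C\<close> turns out to
  be plus or minus the identity, and that sign is absorbed by the unit quaternion
  \<open>A\<close>.\<close>

lemma O4_factorization:
  assumes "X \<in> O4"
  obtains A B where "A \<in> lunits" "B \<in> runits" "X = A ** B \<or> X = A ** B ** J4"
proof -
  define g where "g V = X ** V ** transpose X" for V
  note cancel = O4_cancel[OF assms]
  have ad: "ad (g U) (g V) = g (ad U V)" for U V
    by (simp add: ad_def g_def mm.diff_left mm.diff_right cancel flip: matrix_mul_assoc)
  obtain A B C \<sigma> \<upsilon> where AB: "A \<in> lunits" "B \<in> runits" and C: "C = A ** B \<or> C = A ** B ** J4"
    and \<sigma>: "\<sigma> \<in> {1, -1}" "\<upsilon> \<in> {1, -1}"
    and g: "\<And>u v. g (lmat u + rmat v) = C ** (\<sigma> *\<^sub>R lmat u + \<upsilon> *\<^sub>R rmat v) ** transpose C"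
  proof (rule lie_triple_classification[of g])
    show "linear g"
      by (rule linearI) (simp_all add: g_def mm_simps)
    show "g V \<in> so4" if "V \<in> so4" for V
      using that by (simp add: g_def so4_conj)
    show "g U \<bullet> g V = U \<bullet> V" for U V
      by (simp add: g_def O4_inner[OF assms] O4_inner[OF O4_transpose[OF assms]])
  qed (simp add: ad, rule that)
  have "C \<in> O4" using AB C by (auto intro: O4_mult O4_lunits O4_runits O4_J4)
  note cancel' = O4_cancel[OF this]
  define D where "D = transpose C ** X"
  have D: "D \<in> O4" "X = C ** D"
    using assms \<open>C \<in> O4\<close> by (auto simp: D_def O4_mult O4_transpose cancel')
  have conj: "D ** (lmat u + rmat v) ** transpose D = \<sigma> *\<^sub>R lmat u + \<upsilon> *\<^sub>R rmat v" for u v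
  proof -
    have "D ** (lmat u + rmat v) ** transpose D = transpose C ** g (lmat u + rmat v) ** C"
      by (simp add: D_def g_def matrix_transpose_mul matrix_mul_assoc)
    also have "\<dots> = \<sigma> *\<^sub>R lmat u + \<upsilon> *\<^sub>R rmat v"
      by (simp add: g cancel' flip: matrix_mul_assoc)
    finally show ?thesis .
  qed
  have conj_l: "D ** lmat u ** transpose D = \<sigma> *\<^sub>R lmat u"
      and conj_r: "D ** rmat u ** transpose D = \<upsilon> *\<^sub>R rmat u" for u
    using conj[of u 0] conj[of 0 u] by (simp_all add: lmat_linear rmat_linear)
  have mult: "D ** (U ** V) ** transpose D = (D ** U ** transpose D) ** (D ** V ** transpose D)"
      for U V
    by (simp add: O4_cancel[OF D(1)] flip: matrix_mul_assoc)
  have e: "axis 1 1 \<bullet> (axis 2 1 :: real^3) = 0" by (simp add: inner_axis_axis)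
  \<comment> \<open>Conjugation by \<open>D\<close> respects associative products, not just
    brackets. The relation i j = k then forces each sign to equal its own square.\<close>
  have "lmat (axis 3 1) = lmat (axis 1 1) ** lmat (axis 2 1)"
      "rmat (axis 3 1) = rmat (axis 1 1) ** rmat (axis 2 1)"
    by (simp_all add: lmat_mult rmat_mult cross_basis e)
  then have "\<sigma> *\<^sub>R lmat (axis 3 1) = (\<sigma> * \<sigma>) *\<^sub>R lmat (axis 3 1)"
      "\<upsilon> *\<^sub>R rmat (axis 3 1) = (\<upsilon> * \<upsilon>) *\<^sub>R rmat (axis 3 1)"
    using mult[of "lmat (axis 1 1)" "lmat (axis 2 1)"] mult[of "rmat (axis 1 1)" "rmat (axis 2 1)"]
      conj_l[of "axis 3 1"] conj_r[of "axis 3 1"]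
    by (simp_all add: conj_l conj_r mm.scaleR_left mm.scaleR_right)
  moreover have "lmat (axis 3 1) \<noteq> 0" "rmat (axis 3 1) \<noteq> 0"
    using lmat_eq_iff[of "axis 3 1" 0] rmat_eq_iff[of "axis 3 1" 0]
        by (simp_all add: lmat_linear rmat_linear)
  ultimately have "\<sigma> = 1" "\<upsilon> = 1" using \<sigma> by auto
  have "D ** V = V ** D" if "D ** V ** transpose D = V" for V
    using arg_cong[OF that, of "\<lambda>Y. Y ** D"]
        by (simp add: O4_cancel[OF D(1)] flip: matrix_mul_assoc)
  then obtain k where k: "D = k *\<^sub>R mat 1"
    using commutes_so4_imp_scalar[of D] conj_l conj_r \<open>\<sigma> = 1\<close> \<open>\<upsilon> = 1\<close> by auto
  have "(k * k) *\<^sub>R mat 1 = (1 *\<^sub>R mat 1 :: real^4^4)"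
    using O4_cancel(1)[OF D(1)] by (simp add: k transpose_scalar mm.scaleR_left mm.scaleR_right)
  from arg_cong[OF this, of "\<lambda>M. M$1$1"] have "k * k = 1"
    by (simp add: mat_def)
  then have "k = 1 \<or> k = -1" by (simp add: square_eq_1_iff)
  then have X: "X = C \<or> X = - C" by (auto simp: D(2) k mm.minus_right mm.scaleR_right)
  show ?thesis
  proof (cases "X = C")
    case True
    then show ?thesis using that[OF AB] C by blast
  next
    case False
    then have "X = - A ** B \<or> X = - A ** B ** J4" using X C by (auto simp: mm.minus_left)
    then show ?thesis by (rule that[OF lunits_uminus[OF AB(1)] AB(2)])
  qed
qed

section \<open>Polar form of unit quaternions and determinants\<close>

text \<open>Euler's formula for exp of t times \<open>lmat u\<close>, whose square is a nonpositive
  multiple of the identity. For \<open>u = 0\<close> the sine and \<open>sgn u\<close> are both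
  zero, so the value is the identity.\<close>

definition lexp :: "real^3 \<Rightarrow> real \<Rightarrow> real^4^4" where
  "lexp u t = cos (t * norm u) *\<^sub>R mat 1 + sin (t * norm u) *\<^sub>R lmat (sgn u)"

definition rexp :: "real^3 \<Rightarrow> real \<Rightarrow> real^4^4" where
  "rexp u t = J4 ** lexp u t ** J4"

lemma lexp_in_lunits: "lexp u t \<in> lunits"
proof -
  have "(cos (t * norm u))\<^sup>2 + (sin (t * norm u) *\<^sub>R sgn u) \<bullet> (sin (t * norm u) *\<^sub>R sgn u) = 1"
    by (cases "u = 0") (simp_all add: dot_square_norm norm_sgn flip: power2_eq_square)
  then show ?thesis
    unfolding lexp_def lunits_def lmat_linear(2)[symmetric] by blast
qed

lemma lunits_lexp:
  assumes "P \<in> lunits" obtains u where "P = lexp u 1"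
proof -
  obtain s u where P: "P = s *\<^sub>R mat 1 + lmat u" "s\<^sup>2 + u \<bullet> u = 1"
    using assms by (auto simp: lunits_def)
  show ?thesis
  proof (cases "u = 0")
    case True
    then have "s = 1 \<or> s = -1" using P(2) by (simp add: power2_eq_1_iff)
    moreover have "1 *\<^sub>R mat 1 + lmat 0 = lexp 0 1" by (simp add: lexp_def lmat_linear)
    \<comment> \<open>The quaternion -1 has no preferred axis; half a turn about an arbitrary one is
      taken.\<close>
    moreover have "(- 1) *\<^sub>R mat 1 + lmat 0 = lexp (pi *\<^sub>R axis 1 1) 1"
        by (simp add: lexp_def lmat_linear)
    ultimately show ?thesis using that P(1) True by metis
  next
    case False
    have s: "-1 \<le> s" "s \<le> 1" using P(2) abs_square_le_1[of s]
        by (simp_all add: abs_le_iff) (metis add.commute inner_ge_zero le_add_same_cancel2)+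
    have "0 < arccos s"
    proof -
      have "s \<noteq> 1" using P(2) False by auto
      then show ?thesis using arccos_lt_bounded[of s] arccos_lbound[OF s] s
          by (metis arccos_1 cos_arccos cos_zero less_eq_real_def)
    qed
    have "sin (arccos s) = sqrt (1 - s\<^sup>2)" using s by (rule sin_arccos)
    also have "1 - s\<^sup>2 = (norm u)\<^sup>2" using P(2) by (simp add: dot_square_norm)
    finally have sin: "sin (arccos s) = norm u" by simp
    define w where "w = arccos s *\<^sub>R sgn u"
    have "norm w = arccos s" using \<open>0 < arccos s\<close> False by (simp add: w_def norm_sgn)
    moreover have "sgn w = sgn u" using \<open>0 < arccos s\<close> False
        by (simp add: w_def sgn_div_norm divide_simps)
    moreover have "norm u *\<^sub>R sgn u = u" using False by (simp add: sgn_div_norm)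
    ultimately have "lexp w 1 = P"
      using s sin by (simp add: lexp_def P(1) sgn_div_norm flip: lmat_linear(2))
    then show ?thesis using that by metis
  qed
qed

lemma lexp_double: "lexp u (2 * t) = lexp u t ** lexp u t"
proof (cases "u = 0")
  case False
  have "sgn u \<bullet> sgn u = 1"
    using False by (simp add: dot_square_norm norm_sgn)
  then have sq: "lmat (sgn u) ** lmat (sgn u) = - mat 1"
    by (simp add: lmat_mult lmat_linear(5))
  have "(c *\<^sub>R mat 1 + s *\<^sub>R lmat (sgn u)) ** (c *\<^sub>R mat 1 + s *\<^sub>R lmat (sgn u)) =
      (c\<^sup>2 - s\<^sup>2) *\<^sub>R mat 1 + (2 * s * c) *\<^sub>R lmat (sgn u)" for c s
  proof -
    have "(2 * s * c) *\<^sub>R lmat (sgn u) = (c * s) *\<^sub>R lmat (sgn u) + (s * c) *\<^sub>R lmat (sgn u)"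
      unfolding scaleR_add_left[symmetric] by (rule arg_cong[of _ _ "\<lambda>r. r *\<^sub>R _"]) simp
    then show ?thesis
      by (simp add: mm.add_left mm.add_right mm.scaleR_left mm.scaleR_right sq power2_eq_square
          scaleR_left_diff_distrib scaleR_add_right scaleR_diff_right)
  qed
  then show ?thesis
    using cos_double[of "t * norm u"] sin_double[of "t * norm u"] by (simp add: lexp_def mult.assoc)
qed (simp add: lexp_def lmat_linear)

text \<open>By the polar form and \<open>lexp_double\<close> a unit quaternion is the square of an
  orthogonal matrix, so its determinant is the square of plus or minus one. This replaces a
  connectedness argument.\<close>

lemma det_lunits: "P \<in> lunits \<Longrightarrow> det P = 1"
proof -
  assume "P \<in> lunits"
  then obtain u where P: "P = lexp u (2 * (1/2))" using lunits_lexp by auto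
  have "det (lexp u (1/2)) = 1 \<or> det (lexp u (1/2)) = -1"
    using O4_lunits[OF lexp_in_lunits[of u "1/2"]] by (simp add: O4_def det_orthogonal_matrix)
  then show ?thesis unfolding P lexp_double det_mul by auto
qed

lemma SO4_lunits: "P \<in> lunits \<Longrightarrow> P \<in> SO4"
  by (simp add: SO4_iff O4_lunits det_lunits)

lemma SO4_runits: "Q \<in> runits \<Longrightarrow> Q \<in> SO4"
  unfolding SO4_iff by (auto simp: O4_runits) (auto simp: runits_def det_mul det_J4 det_lunits)

lemma SO4_factorization:
  assumes "X \<in> SO4"
  obtains A B where "A \<in> lunits" "B \<in> runits" "X = A ** B"
proof -
  obtain A B where AB: "A \<in> lunits" "B \<in> runits" "X = A ** B \<or> X = A ** B ** J4"
    using O4_factorization assms SO4_iff by metis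
  moreover have "det (A ** B ** J4) = -1"
    using AB(1,2) SO4_lunits SO4_runits by (simp add: det_mul det_J4 SO4_iff)
  ultimately show ?thesis using that assms by (auto simp: SO4_iff)
qed

lemma SO4_exp:
  assumes "X \<in> SO4" obtains u v where "X = lexp u 1 ** rexp v 1"
  using SO4_factorization[OF assms] lunits_lexp unfolding runits_def rexp_def
  by (smt (verit, del_insts) mem_Collect_eq)

section \<open>SU(2) as the group of unit quaternions\<close>

text \<open>The inverse of a matrix of determinant one is its adjugate; for a unitary matrix it is
  also the conjugate transpose. Comparing the two expresses the second row through the
  first.\<close>

lemma SU2_entries:
  "Z \<in> SU2 \<longleftrightarrow> Z$2$2 = cnj (Z$1$1) \<and> Z$2$1 = - cnj (Z$1$2) \<and> (cmod (Z$1$1))\<^sup>2 + (cmod (Z$1$2))\<^sup>2 = 1"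
proof -
  define a b c d where "a = Z$1$1" and "b = Z$1$2" and "c = Z$2$1" and "d = Z$2$2"
  have iff: "Z \<in> SU2 \<longleftrightarrow>
     cnj a * a + cnj c * c = 1 \<and> cnj a * b + cnj c * d = 0 \<and> cnj b * a + cnj d * c = 0 \<and> cnj b * b +
         cnj d * d = 1 \<and>
     a * cnj a + b * cnj b = 1 \<and> a * cnj c + b * cnj d = 0 \<and> c * cnj a + d * cnj b = 0 \<and> c * cnj c +
         d * cnj d = 1 \<and>
     a * d - b * c = 1"
    by (auto simp: SU2_def conj_transpose_def matrix_matrix_mult_def vec_eq_iff forall_2 sum_2
        mat_def det_2
        a_def b_def c_def d_def)
  have norm: "(cmod a)\<^sup>2 + (cmod b)\<^sup>2 = 1 \<longleftrightarrow> a * cnj a + b * cnj b = 1"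
    unfolding complex_norm_square[symmetric] by (metis of_real_1 of_real_add of_real_eq_iff)
  have "Z \<in> SU2 \<longleftrightarrow> d = cnj a \<and> c = - cnj b \<and> a * cnj a + b * cnj b = 1"
  proof
    assume "Z \<in> SU2"
    then have h: "cnj a * a + cnj c * c = 1" "cnj a * b + cnj c * d = 0" "a * d - b * c = 1"
        "a * cnj a + b * cnj b = 1"
      unfolding iff by blast+
    have "d = cnj a" using h(1-3) by algebra
    moreover have "cnj c = - b" using h(1-3) by algebra
    ultimately show "d = cnj a \<and> c = - cnj b \<and> a * cnj a + b * cnj b = 1"
      using h(4) by (metis complex_cnj_cnj complex_cnj_minus)
  next
    assume "d = cnj a \<and> c = - cnj b \<and> a * cnj a + b * cnj b = 1"
    then show "Z \<in> SU2"
      unfolding iff by (auto simp: mult.commute add.commute)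
  qed
  then show ?thesis unfolding norm[symmetric] unfolding a_def b_def c_def d_def .
qed

lemma decomplexify_SU2: "\<rho> ` SU2 = lunits"
proof (intro equalityI subsetI)
  fix P assume "P \<in> \<rho> ` SU2"
  then obtain Z where Z: "P = \<rho> Z" "Z \<in> SU2" by blast
  let ?u = "vector [Im (Z$1$1), Re (Z$1$2), Im (Z$1$2)] :: real^3"
  have "P = Re (Z$1$1) *\<^sub>R mat 1 + lmat ?u"
    using Z by (simp add: decomplexify_def SU2_entries lmat_def vec_eq_iff forall_4 mat_def)
  moreover have "(Re (Z$1$1))\<^sup>2 + ?u \<bullet> ?u = 1"
    using Z(2) by (simp add: SU2_entries cmod_def inner_vec_def sum_3 power2_eq_square)
  ultimately show "P \<in> lunits" unfolding lunits_def by blast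
next
  fix P assume "P \<in> lunits"
  then obtain s u where P: "P = s *\<^sub>R mat 1 + lmat u" "s\<^sup>2 + u \<bullet> u = 1"
    by (auto simp: lunits_def)
  let ?Z = "vector [vector [Complex s (u$1), Complex (u$2) (u$3)],
                    vector [- cnj (Complex (u$2) (u$3)), cnj (Complex s (u$1))]] :: complex^2^2"
  have "?Z \<in> SU2" using P(2)
      by (simp add: SU2_entries cmod_def inner_vec_def sum_3 power2_eq_square)
  moreover have "P = \<rho> ?Z"
    by (simp add: P(1) decomplexify_def lmat_def vec_eq_iff forall_4 mat_def)
  ultimately show "P \<in> \<rho> ` SU2" by blast
qed

section \<open>The linear extension of \<open>\<tau>\<close>\<close>

text \<open>Averaging over the quaternion units on the right factor: for a quaternion \<open>q\<close>,
  \<open>q + i q i + j q j + k q k = - 2 cnj q\<close>.\<close>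

definition tau_lin :: "real^4^4 \<Rightarrow> real^4^4" where
  "tau_lin X = (- 1 / 2) *\<^sub>R (X + (\<Sum>i\<in>UNIV. rmat (axis i 1) ** X ** rmat (axis i 1)))"

lemma linear_tau_lin: "linear tau_lin"
proof (rule linearI)
  show "tau_lin (X + Y) = tau_lin X + tau_lin Y" for X Y
    by (simp add: tau_lin_def mm.add_left mm.add_right sum.distrib scaleR_add_right)
  show "tau_lin (r *\<^sub>R X) = r *\<^sub>R tau_lin X" for r X
    by (simp add: tau_lin_def mm.scaleR_left mm.scaleR_right sum_3 scaleR_add_right
        scaleR_diff_right)
qed

text \<open>The averaging uses \<open>rmat\<close> only and so passes through any \<open>P\<close>
  commuting with \<open>rmat\<close>. \<open>P\<close> is not assumed to be a unit, so that
  \<open>P = lmat u\<close> is covered as well.\<close>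

lemma tau_lin_runits:
  assumes "\<And>v. P ** rmat v = rmat v ** P" "Q \<in> runits"
  shows "tau_lin (P ** Q) = P ** transpose Q"
proof -
  obtain s v where Q: "Q = J4 ** (s *\<^sub>R mat 1 + lmat v) ** J4"
    using assms(2) by (auto simp: runits_def lunits_def)
  then have Q: "Q = s *\<^sub>R mat 1 + rmat v"
    by (simp add: mm.add_left mm.add_right mm.scaleR_left mm.scaleR_right J4_J4 rmat_def)
  have refl: "rmat n ** rmat v ** rmat n = rmat (v - (2 * (n \<bullet> v)) *\<^sub>R n)" if "n \<bullet> n = 1" for n
  proof -
    have "rmat n ** rmat v ** rmat n = J4 ** (lmat n ** lmat v ** lmat n) ** J4"
      by (simp add: rmat_def J4_J4_left flip: matrix_mul_assoc)
    then show ?thesis by (simp only: cross3_reflect[OF that] rmat_def)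
  qed
  have v: "v = (\<Sum>i\<in>UNIV. v $ i *\<^sub>R axis i 1)"
    using basis_expansion[of v] by (simp add: scalar_mult_eq_scaleR)
  have "rmat (axis i 1) ** Q ** rmat (axis i 1) = rmat (v - (2 * v $ i) *\<^sub>R axis i 1) - s *\<^sub>R mat 1"
      for i
    using refl[of "axis i 1"]
    by (simp add: Q mm.add_left mm.add_right mm.scaleR_left mm.scaleR_right inner_axis_axis
        inner_axis' rmat_mult rmat_linear(5))
  moreover have "rmat (axis i 1) ** (P ** Q) ** rmat (axis i 1) = P ** (rmat (axis i 1) ** Q ** rmat
      (axis i 1))" for i
    by (simp add: assms(1) matrix_mul_assoc)
  ultimately have "tau_lin (P ** Q) = P ** ((- 1 / 2) *\<^sub>R (Q +
      (\<Sum>i\<in>UNIV. rmat (v - (2 * v $ i) *\<^sub>R axis i 1) - s *\<^sub>R mat 1)))"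
    by (simp add: tau_lin_def mm.add_right mm.scaleR_right mm.minus_right mm.sum_right)
  also have "(\<Sum>i\<in>UNIV. rmat (v - (2 * v $ i) *\<^sub>R axis i 1) - s *\<^sub>R mat 1) =
      rmat (\<Sum>i\<in>UNIV. v - 2 *\<^sub>R (v $ i *\<^sub>R axis i 1)) - (\<Sum>i\<in>(UNIV :: 3 set). s *\<^sub>R mat 1)"
    by (subst sum_subtractf) (simp only: linear_sum[OF linear_rmat] scaleR_scaleR)
  \<comment> \<open>The three coordinate reflections of \<open>v\<close> add up to 3v - 2v.\<close>
  also have "(\<Sum>i\<in>UNIV. v - 2 *\<^sub>R (v $ i *\<^sub>R axis i 1)) = v"
    unfolding sum_subtractf scaleR_sum_right[symmetric] v[symmetric]
    by (simp add: scaleR_left_diff_distrib[symmetric] scaleR_conv_of_real vec_eq_iff)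
  also have "(\<Sum>i\<in>(UNIV :: 3 set). s *\<^sub>R mat 1) = 3 *\<^sub>R (s *\<^sub>R mat 1)"
    by (simp only: sum_constant_scaleR) simp
  finally have "tau_lin (P ** Q) = P ** ((- 1 / 2) *\<^sub>R (s *\<^sub>R mat 1 + rmat v +
      (rmat v - 3 *\<^sub>R (s *\<^sub>R mat 1))))"
    by (simp only: Q)
  \<comment> \<open>The scalar part is s - 3s = -2s and the vector part 2v; the factor -1/2 keeps
    the former and negates the latter, which is transposition.\<close>
  also have "(- 1 / 2) *\<^sub>R (s *\<^sub>R mat 1 + rmat v + (rmat v - 3 *\<^sub>R (s *\<^sub>R mat 1))) = transpose Q"
    by (simp add: Q transpose_add transpose_scalar transpose_rmat vec_eq_iff algebra_simps)
  finally show ?thesis .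
qed

lemma runits_mat_1: "mat 1 \<in> runits"
  unfolding runits_def using mat_1_in_lunits J4_J4 by force

lemma tau_lin_lmat: "tau_lin (lmat u) = lmat u"
  using tau_lin_runits[of "lmat u" "mat 1"] by (simp add: lmat_rmat_commute runits_mat_1)

text \<open>Only unit vectors give elements of \<open>runits\<close>; linearity restores the length
  of \<open>v\<close>.\<close>

lemma tau_lin_rmat: "tau_lin (rmat v) = - rmat v"
proof (cases "v = 0")
  case False
  have "rmat (sgn v) = J4 ** lmat (sgn v) ** J4" "sgn v \<bullet> sgn v = 1"
    using False by (simp_all add: rmat_def dot_square_norm norm_sgn)
  then have "rmat (sgn v) \<in> runits"
    unfolding runits_def using lmat_in_lunits by blast
  then have "tau_lin (rmat (sgn v)) = - rmat (sgn v)"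
    using tau_lin_runits[of "mat 1" "rmat (sgn v)"] by (simp add: transpose_rmat)
  then have "norm v *\<^sub>R tau_lin (rmat (sgn v)) = norm v *\<^sub>R - rmat (sgn v)"
    by (rule arg_cong)
  moreover have "norm v *\<^sub>R rmat (sgn v) = rmat v" using False
      by (simp add: sgn_div_norm flip: rmat_linear(2))
  ultimately show ?thesis
    by (simp flip: linear_scale[OF linear_tau_lin])
qed (simp add: rmat_linear(5) linear_0[OF linear_tau_lin])

lemma tau_lin_mat_1: "tau_lin (mat 1) = mat 1"
  using tau_lin_runits[of "mat 1" "mat 1"] by (simp add: runits_mat_1)

text \<open>Moving the two skew factors across the inner product produces two signs, which cancel. A
  self-adjoint involution is an isometry, which is \<open>tau_lin_inner\<close>.\<close>

lemma tau_lin_self_adjoint: "tau_lin X \<bullet> Y = X \<bullet> tau_lin Y"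
proof -
  have "(rmat n ** X ** rmat n) \<bullet> Y = X \<bullet> (rmat n ** Y ** rmat n)" for n
    by (simp add: inner_matrix_mult_right[of _ "rmat n" Y] inner_matrix_mult_left[of "rmat n" X]
        transpose_rmat
        mm.minus_left mm.minus_right matrix_mul_assoc)
  then show ?thesis
    by (simp add: tau_lin_def inner_add_left inner_add_right inner_sum_left inner_sum_right)
qed

lemma tau_lin_involution: "tau_lin (tau_lin X) = X"
proof -
  let ?R = "\<lambda>i. rmat (axis i 1)"
  have self: "?R i ** ?R i = - mat 1" for i :: 3
    by (simp add: rmat_mult rmat_linear(5) inner_axis_axis)
  have cross: "?R 1 ** ?R 2 = ?R 3" "?R 2 ** ?R 3 = ?R 1" "?R 3 ** ?R 1 = ?R 2"
    "?R 2 ** ?R 1 = - ?R 3" "?R 3 ** ?R 2 = - ?R 1" "?R 1 ** ?R 3 = - ?R 2"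
    by (simp_all add: rmat_mult cross_basis inner_axis_axis rmat_linear(3))
  note left = self[THEN arg_cong[where f = "\<lambda>M. M ** _"], folded matrix_mul_assoc]
    cross[THEN arg_cong[where f = "\<lambda>M. M ** _"], folded matrix_mul_assoc]
  define S where "S = (\<Sum>i\<in>UNIV. ?R i ** X ** ?R i)"
  \<comment> \<open>The three terms with equal indices give \<open>X\<close> each. For distinct
    indices i, j the products are \<plusminus>\<open>?R k\<close> with opposite signs on the two
    sides, and each k occurs twice.\<close>
  have "(\<Sum>i\<in>UNIV. ?R i ** S ** ?R i) = 3 *\<^sub>R X - 2 *\<^sub>R S"
    by (simp add: S_def sum_3 mm.add_left mm.add_right self cross left mm.minus_left mm.minus_right
        vec_eq_iff flip: matrix_mul_assoc)
  then have "(\<Sum>i\<in>UNIV. ?R i ** (X + S) ** ?R i) = S + (3 *\<^sub>R X - 2 *\<^sub>R S)"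
    by (simp only: mm.add_left mm.add_right sum.distrib flip: S_def)
  then have "tau_lin (X + S) = (- 1 / 2) *\<^sub>R (X + S + (S + (3 *\<^sub>R X - 2 *\<^sub>R S)))"
    by (simp only: tau_lin_def)
  moreover have "tau_lin X = (- 1 / 2) *\<^sub>R (X + S)"
    by (simp only: tau_lin_def S_def)
  ultimately have "tau_lin (tau_lin X) = (- 1 / 2) *\<^sub>R (- 1 / 2) *\<^sub>R (X + S +
      (S + (3 *\<^sub>R X - 2 *\<^sub>R S)))"
    by (simp only: linear_scale[OF linear_tau_lin])
  also have "\<dots> = X" by (simp add: vec_eq_iff)
  finally show ?thesis .
qed

lemma tau_lin_inner: "tau_lin U \<bullet> tau_lin V = U \<bullet> V"
  by (simp add: tau_lin_self_adjoint tau_lin_involution)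

lemma tau_lin_SO4:
  assumes "X \<in> SO4" shows "tau_lin X \<in> SO4"
proof -
  obtain P Q where X: "P \<in> lunits" "Q \<in> runits" "X = P ** Q" by (rule SO4_factorization[OF assms])
  then have "tau_lin X = P ** transpose Q" by (simp add: tau_lin_runits lunits_rmat_commute)
  then show ?thesis using X by (simp add: SO4_mult SO4_lunits SO4_runits SO4_transpose)
qed

text \<open>Every factorization of \<open>X\<close> leads to the same value, because
  \<open>tau_lin X\<close> is a formula in \<open>X\<close>. This yields the uniqueness required by
  the definite description; existence is \<open>SO4_factorization\<close>.\<close>

lemma cayley_tau_eq:
  assumes "X \<in> SO4" shows "\<tau> X = tau_lin X"
proof -
  have *: "Y = tau_lin X" if "Z1 \<in> SU2" "Z2 \<in> SU2" "X = \<rho> Z1 ** (J4 ** \<rho> Z2 ** J4)"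
     "Y = \<rho> Z1 ** transpose (J4 ** \<rho> Z2 ** J4)" for Y Z1 Z2
  proof -
    have "\<rho> Z1 \<in> lunits" "J4 ** \<rho> Z2 ** J4 \<in> runits"
      using that(1,2) decomplexify_SU2 by (auto simp: runits_def)
    then show ?thesis unfolding that(3,4) by (simp add: tau_lin_runits lunits_rmat_commute)
  qed
  obtain P Q' where "P \<in> lunits" "Q' \<in> runits" "X = P ** Q'" by (rule SO4_factorization[OF assms])
  then obtain Q where "P \<in> lunits" "Q \<in> lunits" "X = P ** (J4 ** Q ** J4)"
      by (auto simp: runits_def)
  then obtain Z1 Z2 where "Z1 \<in> SU2" "Z2 \<in> SU2" "X = \<rho> Z1 ** (J4 ** \<rho> Z2 ** J4)"
    unfolding decomplexify_SU2[symmetric] by blast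
  then have "\<exists>Y. \<exists>X1\<in>SU2. \<exists>X2\<in>SU2. X = \<rho> X1 ** (J4 ** \<rho> X2 ** J4) \<and> Y =
      \<rho> X1 ** transpose (J4 ** \<rho> X2 ** J4)"
    by blast
  then show ?thesis
    unfolding cayley_tau_def by (intro the_equality) (use * in \<open>metis+\<close>)
qed

section \<open>The Killing form\<close>

text \<open>\<open>trace_on\<close> refers to an unspecified basis. Expanding each basis in the
  other and interchanging the sums shows that any basis may be used, in particular the orthogonal
  one of \<open>trace_on_ad\<close>.\<close>

lemma trace_on_basis:
  fixes T :: "'a::euclidean_space \<Rightarrow> 'a"
  assumes B: "independent B" "span B = V" and T: "linear T" "\<And>v. v \<in> V \<Longrightarrow> T v \<in> V"
  shows "trace_on V T = (\<Sum>b\<in>B. representation B (T b) b)"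
proof -
  define C where "C = (SOME C. independent C \<and> span C = V)"
  have C: "independent C" "span C = V"
    unfolding C_def using someI[of "\<lambda>C. independent C \<and> span C = V" B] B by auto
  have fin: "finite B" "finite C" using B(1) C(1) by (auto intro: independent_imp_finite)
  have inV: "b \<in> V" if "b \<in> B \<or> b \<in> C" for b using that B(2) C(2) span_base by metis
  have expand: "x = (\<Sum>d\<in>D. representation D x d *\<^sub>R d)"
      if "independent D" "span D = V" "finite D" "x \<in> V" for D x
    using sum_representation_eq[of D x D] that by simp
  have rep_sum: "representation D (\<Sum>e\<in>E. f e *\<^sub>R x e) d = (\<Sum>e\<in>E. f e * representation D (x e) d)"
    if "independent D" "span D = V" "\<And>e. e \<in> E \<Longrightarrow> x e \<in> V" for D E d and f :: "'a \<Rightarrow> real" and x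
  proof -
    have "representation D (\<Sum>e\<in>E. f e *\<^sub>R x e) = (\<lambda>d. \<Sum>e\<in>E. representation D (f e *\<^sub>R x e) d)"
      by (rule representation_sum[OF that(1)]) (use that(2,3) in \<open>auto intro: span_scale\<close>)
    moreover have "representation D (f e *\<^sub>R x e) d = f e * representation D (x e) d" if "e \<in> E"
        for e
      using representation_scale[of D "x e" "f e"] \<open>independent D\<close> \<open>span D = V\<close> \<open>\<And>e. e \<in> E \<Longrightarrow> x e \<in>
          V\<close> that by simp
    ultimately show ?thesis by simp
  qed
  have "(\<Sum>c\<in>C. representation C (T c) c) = (\<Sum>c\<in>C. \<Sum>b\<in>B. representation B (T c) b * representation C
      b c)"
  proof (rule sum.cong[OF refl])
    fix c assume "c \<in> C"
    then show "representation C (T c) c = (\<Sum>b\<in>B. representation B (T c) b * representation C b c)"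
      using expand[OF B fin(1) T(2)[OF inV]] rep_sum[OF C, of B "\<lambda>b. b" "representation B (T c)" c]
          inV by metis
  qed
  also have "\<dots> = (\<Sum>b\<in>B. \<Sum>c\<in>C. representation C b c * representation B (T c) b)"
    by (subst sum.swap) (simp add: mult.commute)
  also have "\<dots> = (\<Sum>b\<in>B. representation B (T b) b)"
  proof (rule sum.cong[OF refl])
    fix b assume "b \<in> B"
    have "T b = T (\<Sum>c\<in>C. representation C b c *\<^sub>R c)"
      using expand[OF C fin(2) inV] \<open>b \<in> B\<close> by (auto intro: arg_cong)
    also have "\<dots> = (\<Sum>c\<in>C. representation C b c *\<^sub>R T c)"
      by (simp add: linear_sum[OF T(1)] linear_scale[OF T(1)])
    finally show "(\<Sum>c\<in>C. representation C b c * representation B (T c) b) = representation B (T b)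
        b"
      using rep_sum[OF B, of C T "representation C b" b] inV T(2) by metis
  qed
  finally show ?thesis by (simp add: trace_on_def C_def Let_def)
qed

lemma representation_orthogonal:
  fixes B :: "'a::euclidean_space set"
  assumes "independent B" "pairwise orthogonal B" "x \<in> span B" "b \<in> B"
  shows "representation B x b = (x \<bullet> b) / (b \<bullet> b)"
proof -
  have fin: "finite B" using assms(1) by (rule independent_imp_finite)
  have "x \<bullet> b = (\<Sum>c\<in>B. representation B x c *\<^sub>R c) \<bullet> b"
    using sum_representation_eq[OF assms(1,3) fin order_refl] by simp
  also have "\<dots> = (\<Sum>c\<in>B. representation B x c * (c \<bullet> b))" by (simp add: inner_sum_left)
  also have "\<dots> = (\<Sum>c\<in>B. if c = b then representation B x b * (b \<bullet> b) else 0)"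
    using assms(2,4) by (intro sum.cong refl) (auto simp: pairwise_def orthogonal_def)
  also have "\<dots> = representation B x b * (b \<bullet> b)" using fin assms(4) by simp
  finally have "x \<bullet> b = representation B x b * (b \<bullet> b)" .
  moreover have "b \<bullet> b \<noteq> 0" using assms(1,4) dependent_zero by auto
  ultimately show ?thesis by simp
qed

lemma trace_on_ad:
  assumes "V \<in> so4" "W \<in> so4"
  shows "trace_on so4 (ad V \<circ> ad W) = - 2 * (V \<bullet> W)"
proof -
  obtain a b where V: "V = lmat a + rmat b" by (rule so4_decompose[OF assms(1)])
  obtain c d where W: "W = lmat c + rmat d" by (rule so4_decompose[OF assms(2)])
  define L where "L = range (\<lambda>i::3. lmat (axis i 1))"
  define R where "R = range (\<lambda>i::3. rmat (axis i 1))"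
  have orth: "pairwise orthogonal (L \<union> R)"
    by (auto simp: pairwise_def orthogonal_def L_def R_def inner_lmat inner_rmat inner_lmat_rmat
        inner_axis_axis)
  have nz: "lmat (axis i 1) \<noteq> 0" "rmat (axis i 1) \<noteq> 0" for i
    using lmat_eq_iff[of "axis i 1" 0] rmat_eq_iff[of "axis i 1" 0]
        by (simp_all add: lmat_linear(5) rmat_linear(5))
  then have "0 \<notin> L \<union> R" by (auto simp: L_def R_def image_iff)
  with orth have ind: "independent (L \<union> R)" by (rule pairwise_orthogonal_independent)
  have span: "span (L \<union> R) = so4"
  proof (rule antisym)
    show "span (L \<union> R) \<subseteq> so4"
      by (rule span_minimal) (auto simp: L_def R_def so4_lmat so4_rmat subspace_so4)
    have sum: "u = (\<Sum>i\<in>UNIV. u $ i *\<^sub>R axis i 1)" for u :: "real^3"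
      using basis_expansion[of u] by (simp add: scalar_mult_eq_scaleR)
    have "lmat u = (\<Sum>i\<in>UNIV. u $ i *\<^sub>R lmat (axis i 1))"
        "rmat u = (\<Sum>i\<in>UNIV. u $ i *\<^sub>R rmat (axis i 1))" for u
      using arg_cong[OF sum[of u], of lmat] arg_cong[OF sum[of u], of rmat]
      by (simp_all only: linear_sum[OF linear_lmat] linear_scale[OF linear_lmat]
          linear_sum[OF linear_rmat] linear_scale[OF linear_rmat])
    moreover have "(\<Sum>i\<in>UNIV. u $ i *\<^sub>R lmat (axis i 1)) \<in> span (L \<union> R)"
        "(\<Sum>i\<in>UNIV. u $ i *\<^sub>R rmat (axis i 1)) \<in> span (L \<union> R)" for u :: "real^3"
      by (intro span_sum span_scale span_base; simp add: L_def R_def)+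
    ultimately have "lmat u + rmat v \<in> span (L \<union> R)" for u v by (metis span_add)
    then show "so4 \<subseteq> span (L \<union> R)" by (metis so4_decompose subsetI)
  qed
  let ?T = "ad V \<circ> ad W"
  have lin: "linear (ad U)" for U :: "real^4^4"
    by (rule linearI) (simp_all add: ad_def mm.add_left mm.add_right mm.scaleR_left mm.scaleR_right
        scaleR_diff_right)
  have T: "?T U \<in> so4" if "U \<in> so4" for U using that assms by (simp add: ad_so4)
  have "trace_on so4 ?T = (\<Sum>e\<in>L \<union> R. representation (L \<union> R) (?T e) e)"
    by (rule trace_on_basis[OF ind span linear_compose[OF lin lin] T])
  also have "\<dots> = (\<Sum>e\<in>L \<union> R. (?T e \<bullet> e) / (e \<bullet> e))"
  proof (rule sum.cong[OF refl])
    fix e assume e: "e \<in> L \<union> R"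
    then have "?T e \<in> span (L \<union> R)" unfolding span
        by (intro T) (auto simp: L_def R_def so4_lmat so4_rmat)
    then show "representation (L \<union> R) (?T e) e = (?T e \<bullet> e) / (e \<bullet> e)"
      using representation_orthogonal[OF ind orth _ e] by blast
  qed
  also have "\<dots> = (\<Sum>e\<in>L. (?T e \<bullet> e) / (e \<bullet> e)) + (\<Sum>e\<in>R. (?T e \<bullet> e) / (e \<bullet> e))"
  proof (rule sum.union_disjoint)
    have "lmat (axis i 1) \<noteq> rmat (axis j 1)" for i j
      using nz inner_lmat_rmat by (metis inner_eq_zero_iff)
    then show "L \<inter> R = {}" by (auto simp: L_def R_def)
  qed (simp_all add: L_def R_def)
  \<comment> \<open>Two brackets contribute a factor 2 each and \<open>inner_lmat\<close> a factor
    4, whence 16; the denominator is 4. Summing Lagrange's identity over three axes gives 4 times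
    the difference of one and three copies of \<open>a \<bullet> c\<close>.\<close>
  also have "(\<Sum>e\<in>L. (?T e \<bullet> e) / (e \<bullet> e)) = - 8 * (a \<bullet> c)"
  proof -
    have "(?T (lmat e) \<bullet> lmat e) = 16 * ((a \<bullet> e) * (c \<bullet> e) - (a \<bullet> c) * (e \<bullet> e))" for e
      using ad_lmat_rmat[of c d e 0] ad_lmat_rmat[of a b "2 *\<^sub>R cross3 c e" 0]
      by (simp add: V W rmat_linear(5) lmat_linear(2) cross_mult_right inner_lmat Lagrange
          inner_diff_left)
    then have "(\<Sum>e\<in>L. (?T e \<bullet> e) / (e \<bullet> e)) = (\<Sum>i\<in>UNIV. 4 * (a $ i * c $ i - (a \<bullet> c)))"
      unfolding L_def by (subst sum.reindex) (auto simp: inj_on_def lmat_eq_iff axis_eq_axis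
          inner_lmat inner_axis inner_axis_axis diff_divide_distrib)
    then show ?thesis by (simp add: sum_3 inner_vec_def)
  qed
  also have "(\<Sum>e\<in>R. (?T e \<bullet> e) / (e \<bullet> e)) = - 8 * (b \<bullet> d)"
  proof -
    have "(?T (rmat e) \<bullet> rmat e) = 16 * ((b \<bullet> e) * (d \<bullet> e) - (b \<bullet> d) * (e \<bullet> e))" for e
      using ad_lmat_rmat[of c d 0 e] ad_lmat_rmat[of a b 0 "2 *\<^sub>R cross3 d e"]
      by (simp add: V W lmat_linear(5) rmat_linear(2) cross_mult_right inner_rmat Lagrange
          inner_diff_left)
    then have "(\<Sum>e\<in>R. (?T e \<bullet> e) / (e \<bullet> e)) = (\<Sum>i\<in>UNIV. 4 * (b $ i * d $ i - (b \<bullet> d)))"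
      unfolding R_def by (subst sum.reindex) (auto simp: inj_on_def rmat_eq_iff axis_eq_axis
          inner_rmat inner_axis inner_axis_axis diff_divide_distrib)
    then show ?thesis by (simp add: sum_3 inner_vec_def)
  qed
  finally show ?thesis
    by (simp add: V W comp_def inner_add_left inner_add_right inner_lmat inner_rmat inner_lmat_rmat)
qed

section \<open>One-parameter subgroups and tangent spaces\<close>

text \<open>The one-parameter subgroup generated by \<open>lmat u + rmat v\<close>; it is a product
  because the two summands commute.\<close>

definition gexp :: "real^3 \<Rightarrow> real^3 \<Rightarrow> real \<Rightarrow> real^4^4" where
  "gexp u v t = lexp u t ** rexp v t"

lemma lexp_0: "lexp u 0 = mat 1" and rexp_0: "rexp u 0 = mat 1"
  by (simp_all add: lexp_def rexp_def J4_J4)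

lemma gexp_0: "gexp u v 0 = mat 1"
  by (simp add: gexp_def lexp_0 rexp_0)

lemma rexp_in_runits: "rexp v t \<in> runits"
  unfolding rexp_def runits_def using lexp_in_lunits by blast

lemma gexp_in_SO4: "gexp u v t \<in> SO4"
  by (simp add: gexp_def SO4_mult SO4_lunits SO4_runits lexp_in_lunits rexp_in_runits)

lemma lexp_has_vector_derivative: "(lexp u has_vector_derivative (lexp u t ** lmat u)) (at t)"
proof -
  let ?n = "norm u" and ?L = "lmat (sgn u)"
  have "((\<lambda>t. cos (t * ?n) *\<^sub>R mat 1 + sin (t * ?n) *\<^sub>R ?L) has_vector_derivative
      (- (?n * sin (t * ?n))) *\<^sub>R mat 1 + (?n * cos (t * ?n)) *\<^sub>R ?L) (at t)"
    by (auto intro!: derivative_eq_intros simp: has_vector_derivative_def scaleR_add_right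
        scaleR_diff_right mult.assoc)
  moreover have "lexp u t ** lmat u = (- (?n * sin (t * ?n))) *\<^sub>R mat 1 + (?n * cos (t * ?n)) *\<^sub>R
      ?L"
  proof (cases "u = 0")
    case False
    have u: "lmat u = ?n *\<^sub>R ?L" using False by (simp add: sgn_div_norm flip: lmat_linear(2))
    have "sgn u \<bullet> sgn u = 1" using False by (simp add: dot_square_norm norm_sgn)
    then have "?L ** ?L = - mat 1" by (simp add: lmat_mult lmat_linear(5))
    then show ?thesis
      by (simp add: u lexp_def mm.add_left mm.scaleR_left mm.scaleR_right scaleR_add_right
          scaleR_diff_right)
  qed (simp add: lmat_linear(5))
  ultimately show ?thesis by (simp add: lexp_def[abs_def])
qed

lemma rexp_has_vector_derivative: "(rexp v has_vector_derivative (rexp v t ** rmat v)) (at t)"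
proof -
  have "bounded_linear (\<lambda>M. J4 ** M ** J4)"
    by (intro bounded_linear_compose[OF mm.bounded_linear_left mm.bounded_linear_right])
  from bounded_linear.has_vector_derivative[OF this lexp_has_vector_derivative[of v t]] show ?thesis
    by (simp add: rexp_def[abs_def] rmat_def J4_J4_left flip: matrix_mul_assoc)
qed

lemma gexp_has_vector_derivative:
  "(gexp u v has_vector_derivative (gexp u v t ** (lmat u + rmat v))) (at t)"
proof -
  have "lmat u ** rexp v t = rexp v t ** lmat u"
    using runits_conj_lmat[OF rexp_in_runits, of v t u] runits_transpose(2)[OF rexp_in_runits, of v
        t]
    by (metis matrix_mul_assoc matrix_mul_rid)
  then have "gexp u v t ** (lmat u + rmat v) = lexp u t ** (rexp v t ** rmat v) +
      (lexp u t ** lmat u) ** rexp v t"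
    by (simp add: gexp_def mm.add_right flip: matrix_mul_assoc)
  then show ?thesis
    using mm.has_vector_derivative[OF lexp_has_vector_derivative[of u t]
        rexp_has_vector_derivative[of v t]]
    by (simp add: gexp_def[abs_def])
qed

text \<open>The coefficients are arbitrary because differentiation reproduces this shape with other
  coefficients, as the induction demands.\<close>

lemma Ck_on_trig:
  fixes A B :: "'a::real_normed_vector"
  assumes "open U"
  shows "Ck_on k U (\<lambda>t. cos (t * n) *\<^sub>R A + sin (t * n) *\<^sub>R B)"
proof (induction k arbitrary: A B)
  case 0
  then show ?case by (auto intro!: continuous_intros)
next
  case (Suc k)
  show ?case
  proof (rule Ck_on_Suc_I[OF assms])
    show "((\<lambda>t. cos (t * n) *\<^sub>R A + sin (t * n) *\<^sub>R B) has_derivative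
        (\<lambda>h. cos (t * n) *\<^sub>R ((h * n) *\<^sub>R B) + sin (t * n) *\<^sub>R (- (h * n) *\<^sub>R A))) (at t)" for t
      by (auto intro!: derivative_eq_intros simp: algebra_simps)
    show "Ck_on k U (\<lambda>t. cos (t * n) *\<^sub>R ((h * n) *\<^sub>R B) + sin (t * n) *\<^sub>R (- (h * n) *\<^sub>R A))" for h
      by (rule Suc.IH)
  qed
qed

lemma smooth_on_gexp: "open U \<Longrightarrow> smooth_on U (\<lambda>t. X ** gexp u v t)"
  unfolding smooth_on_def gexp_def rexp_def lexp_def
  by (intro allI Ck_on_bilinear[OF bounded_bilinear_matrix_mult] Ck_on_trig Ck_on_const)

lemma curve_through_gexp:
  assumes "X \<in> SO4" shows "curve_through SO4 X (X ** (lmat u + rmat v)) (\<lambda>t. X ** gexp u v t)"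
  unfolding curve_through_def
proof (intro conjI exI[of _ 1])
  show "((\<lambda>t. X ** gexp u v t) has_vector_derivative X ** (lmat u + rmat v)) (at 0)"
    using bounded_linear.has_vector_derivative[OF mm.bounded_linear_right
        gexp_has_vector_derivative[of u v 0], of X]
    by (simp add: gexp_0)
qed (use assms in \<open>auto simp: gexp_0 smooth_on_gexp SO4_mult gexp_in_SO4\<close>)

text \<open>The derivative of the constant product of the transposed curve with the curve vanishes
  at time 0.\<close>

lemma curve_through_SO4_skew:
  assumes "curve_through SO4 X v c" shows "transpose X ** v \<in> so4"
proof -
  obtain e where e: "e > 0" "c ` {-e<..<e} \<subseteq> SO4"
      and c: "c 0 = X" "(c has_vector_derivative v) (at 0)"
    using assms by (auto simp: curve_through_def)
  have "((\<lambda>t. transpose (c t) ** c t) has_vector_derivative (transpose X ** v + transpose v ** X))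
      (at 0)"
    using mm.has_vector_derivative[OF bounded_linear.has_vector_derivative[OF
        bounded_linear_transpose c(2)] c(2)]
    by (simp add: c(1))
  moreover have "((\<lambda>t. transpose (c t) ** c t) has_vector_derivative 0) (at 0)"
  proof (rule has_vector_derivative_transform_within_open)
    show "((\<lambda>t. mat 1) has_vector_derivative 0) (at 0)" by simp
    show "mat 1 = transpose (c t) ** c t" if "t \<in> {-e<..<e}" for t
      using that e(2) O4_cancel(1)[of "c t"] by (simp add: image_subset_iff SO4_iff)
  qed (use e in auto)
  ultimately have "transpose X ** v + transpose v ** X = 0"
    by (rule vector_derivative_unique_at)
  then show ?thesis
    by (simp add: so4_def matrix_transpose_mul eq_neg_iff_add_eq_0 add.commute)
qed

lemma tangent_space_SO4:
  assumes "X \<in> SO4" shows "tangent_space SO4 X = (**) X ` so4"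
proof (intro equalityI subsetI)
  fix v assume "v \<in> tangent_space SO4 X"
  then have "transpose X ** v \<in> so4" using curve_through_SO4_skew by (auto simp: tangent_space_def)
  then have "X ** (transpose X ** v) \<in> (**) X ` so4" by (rule imageI)
  then show "v \<in> (**) X ` so4" using assms by (simp add: O4_cancel SO4_iff)
next
  fix v assume "v \<in> (**) X ` so4"
  then obtain V where V: "V \<in> so4" "v = X ** V" by blast
  then obtain u w where "V = lmat u + rmat w" by (metis so4_decompose)
  then show "v \<in> tangent_space SO4 X"
    using curve_through_gexp[OF assms] V by (auto simp: tangent_space_def)
qed

lemma lie_algebra_SO4: "lie_algebra SO4 = so4"
  by (simp add: lie_algebra_def tangent_space_SO4 SO4_mat_1)

lemma killing_metric_SO4:
  assumes "X \<in> SO4" "V \<in> so4" "W \<in> so4"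
  shows "killing_metric SO4 X (X ** V) (X ** W) = 2 * (V \<bullet> W)"
proof -
  have X: "transpose X ** X = mat 1" "X ** transpose X = mat 1"
    using assms(1) by (simp_all add: SO4_iff O4_cancel)
  have "matrix_inv X = transpose X"
  proof -
    \<comment> \<open>\<open>matrix_inv\<close> is defined by choice; the transpose witnesses that a
      two-sided inverse exists.\<close>
    have "X ** matrix_inv X = mat 1"
      unfolding matrix_inv_def using X by (metis (mono_tags, lifting) someI_ex)
    then have "transpose X ** (X ** matrix_inv X) = transpose X" by simp
    then show ?thesis by (simp add: matrix_mul_assoc X)
  qed
  then show ?thesis
    using assms(2,3) by (simp add: killing_metric_def killing_tensor_def killing_form_def
        lie_algebra_SO4
        trace_on_ad matrix_mul_assoc X)
qed

section \<open>Left-invariant differentiation\<close>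

lemma smooth_on_differentiable:
  assumes "smooth_on U F" "x \<in> U"
  shows "(F has_derivative frechet_derivative F (at x)) (at x)"
  using assms Ck_on_has_derivative[of 0 U F x] by (auto simp: smooth_on_def)

lemma smooth_on_frechet: "smooth_on U F \<Longrightarrow> smooth_on U (\<lambda>x. frechet_derivative F (at x) v)"
  unfolding smooth_on_def by (metis Ck_on.simps(2))

lemma smooth_on_subset: "\<lbrakk>smooth_on U F; V \<subseteq> U\<rbrakk> \<Longrightarrow> smooth_on V F"
  by (auto simp: smooth_on_def intro: Ck_on_subset)

lemma smooth_on_bilinear:
  "\<lbrakk>bounded_bilinear B; open U; smooth_on U F; smooth_on U G\<rbrakk> \<Longrightarrow> smooth_on U (\<lambda>x. B (F x) (G x))"
  by (simp add: smooth_on_def Ck_on_bilinear)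

lemma smooth_on_bounded_linear_compose:
  "\<lbrakk>bounded_linear L; open U; smooth_on U F\<rbrakk> \<Longrightarrow> smooth_on U (\<lambda>x. L (F x))"
  by (simp add: smooth_on_def Ck_on_bounded_linear_compose)

text \<open>Along a curve in \<open>M\<close> the maps \<open>f\<close> and \<open>F\<close> agree
  near time 0, so the chain rule for \<open>F\<close> gives the velocity of the image. Tangency of
  \<open>v\<close> provides at least one curve, and this makes the described vector unique.\<close>

lemma differential_eq_frechet:
  fixes f :: "'a::euclidean_space \<Rightarrow> 'b::euclidean_space"
  assumes U: "open U" "x \<in> U" "smooth_on U F" "\<forall>y\<in>U \<inter> M. F y = f y"
    and v: "v \<in> tangent_space M x"
  shows "differential M f x v = frechet_derivative F (at x) v"
proof -
  have along: "(f \<circ> c has_vector_derivative frechet_derivative F (at x) v) (at 0)"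
    if c: "curve_through M x v c" for c
  proof -
    obtain e where e: "e > 0" "c ` {-e<..<e} \<subseteq> M"
        and c: "c 0 = x" "(c has_vector_derivative v) (at 0)"
      using c by (auto simp: curve_through_def)
    have "(F has_derivative frechet_derivative F (at x)) (at (c 0))"
      using smooth_on_differentiable[OF U(3,2)] c(1) by simp
    from has_derivative_compose[OF c(2)[unfolded has_vector_derivative_def] this]
    have Fc: "((\<lambda>t. F (c t)) has_vector_derivative frechet_derivative F (at x) v) (at 0)"
      using smooth_on_differentiable[OF U(3,2)]
      by (simp add: has_vector_derivative_def linear_scale[OF has_derivative_linear])
    have "isCont c 0" using c(2) has_vector_derivative_continuous by blast
    then have "\<forall>\<^sub>F t in nhds 0. c t \<in> U"
      using U(1,2) c(1) by (auto simp: eventually_nhds_conv_at isCont_def intro: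
          topological_tendstoD)
    moreover have "\<forall>\<^sub>F t in nhds 0. t \<in> {-e<..<e}"
      using e(1) by (intro eventually_nhds_in_open) auto
    ultimately have "\<forall>\<^sub>F t in nhds 0. F (c t) = (f \<circ> c) t"
    proof eventually_elim
      case (elim t)
      then have "c t \<in> U \<inter> M" using e(2) by blast
      then show ?case by (simp add: U(4))
    qed
    then obtain S where "open S" "0 \<in> S" "\<And>t. t \<in> S \<Longrightarrow> F (c t) = (f \<circ> c) t"
      by (auto simp: eventually_nhds)
    then show ?thesis by (rule has_vector_derivative_transform_within_open[OF Fc])
  qed
  obtain c where c: "curve_through M x v c" using v by (auto simp: tangent_space_def)
  show ?thesis
    unfolding differential_def
  proof (rule the_equality)
    fix w assume "\<forall>c. curve_through M x v c \<longrightarrow> (f \<circ> c has_vector_derivative w) (at 0)"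
    then show "w = frechet_derivative F (at x) v"
      using along[OF c] c vector_derivative_unique_at by blast
  qed (use along in blast)
qed

definition lie_deriv :: "real^4^4 \<Rightarrow> (real^4^4 \<Rightarrow> 'b::euclidean_space) \<Rightarrow> real^4^4 \<Rightarrow> 'b" where
  "lie_deriv V f X = differential SO4 f X (X ** V)"

lemma lie_deriv_eq:
  assumes "open U" "X \<in> U" "smooth_on U F" "\<forall>Y\<in>U \<inter> SO4. F Y = f Y" "X \<in> SO4" "V \<in> so4"
  shows "lie_deriv V f X = frechet_derivative F (at X) (X ** V)"
proof -
  have "X ** V \<in> tangent_space SO4 X"
    unfolding tangent_space_SO4[OF assms(5)] using assms(6) by (rule imageI)
  then show ?thesis
    unfolding lie_deriv_def by (rule differential_eq_frechet[OF assms(1-4)])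
qed

text \<open>The last conclusion holds at all points of \<open>SO4\<close> near \<open>X\<close>, not
  just at \<open>X\<close>. It exhibits a local extension of \<open>lie_deriv V f\<close>, which can
  then be differentiated again.\<close>

lemma smooth_extension:
  assumes "smooth_map SO4 f" "X \<in> SO4"
  obtains U F where "open U" "X \<in> U" "smooth_on U F" "\<forall>Y\<in>U \<inter> SO4. F Y = f Y"
    "\<forall>Y\<in>U \<inter> SO4. \<forall>V\<in>so4. lie_deriv V f Y = frechet_derivative F (at Y) (Y ** V)"
proof -
  obtain U F where U: "open U" "X \<in> U" "smooth_on U F" "\<forall>Y\<in>U \<inter> SO4. F Y = f Y"
    using assms unfolding smooth_map_def by blast
  show thesis
  proof (rule that[OF U])
    show "\<forall>Y\<in>U \<inter> SO4. \<forall>V\<in>so4. lie_deriv V f Y = frechet_derivative F (at Y) (Y ** V)"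
      using lie_deriv_eq[OF U(1) _ U(3,4)] by blast
  qed
qed

lemma smooth_mapI:
  assumes "\<And>X. X \<in> M \<Longrightarrow> \<exists>U F. open U \<and> X \<in> U \<and> smooth_on U F \<and> (\<forall>Y\<in>U \<inter> M. F Y = f Y)"
  shows "smooth_map M f"
  using assms by (auto simp: smooth_map_def)

lemma smooth_map_cong:
  assumes "\<And>X. X \<in> M \<Longrightarrow> f X = g X" "smooth_map M f" shows "smooth_map M g"
  using assms unfolding smooth_map_def by (metis IntD2)

lemma lie_deriv_cong:
  assumes "\<And>X. X \<in> SO4 \<Longrightarrow> f X = g X" "smooth_map SO4 f" "X \<in> SO4" "V \<in> so4"
  shows "lie_deriv V f X = lie_deriv V g X"
proof -
  obtain U F where U: "open U" "X \<in> U" "smooth_on U F" "\<forall>Y\<in>U \<inter> SO4. F Y = f Y"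
    using assms(2,3) unfolding smooth_map_def by blast
  then show ?thesis
    using lie_deriv_eq[OF U assms(3,4)] lie_deriv_eq[OF U(1-3) _ assms(3,4), of g] assms(1) by simp
qed

lemma lie_deriv_bilinear:
  assumes B: "bounded_bilinear B" and fg: "smooth_map SO4 f" "smooth_map SO4 g"
      and X: "X \<in> SO4" "V \<in> so4"
  shows "lie_deriv V (\<lambda>X. B (f X) (g X)) X = B (f X) (lie_deriv V g X) + B (lie_deriv V f X) (g X)"
proof -
  obtain U1 F where F: "open U1" "X \<in> U1" "smooth_on U1 F" "\<forall>Y\<in>U1 \<inter> SO4. F Y = f Y"
    "\<forall>Y\<in>U1 \<inter> SO4. \<forall>V\<in>so4. lie_deriv V f Y = frechet_derivative F (at Y) (Y ** V)"
    by (rule smooth_extension[OF fg(1) X(1)], rule that)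
  obtain U2 G where G: "open U2" "X \<in> U2" "smooth_on U2 G" "\<forall>Y\<in>U2 \<inter> SO4. G Y = g Y"
    "\<forall>Y\<in>U2 \<inter> SO4. \<forall>V\<in>so4. lie_deriv V g Y = frechet_derivative G (at Y) (Y ** V)"
    by (rule smooth_extension[OF fg(2) X(1)], rule that)
  have "smooth_on (U1 \<inter> U2) (\<lambda>Y. B (F Y) (G Y))"
    using F(1,3) G(1,3) by (intro smooth_on_bilinear[OF B]) (auto intro: smooth_on_subset)
  then have "lie_deriv V (\<lambda>X. B (f X) (g X)) X = frechet_derivative (\<lambda>Y. B (F Y) (G Y)) (at X)
      (X ** V)"
    using F G X by (intro lie_deriv_eq[where U = "U1 \<inter> U2"]) auto
  also have "\<dots> = B (F X) (frechet_derivative G (at X) (X ** V)) + B (frechet_derivative F (at X)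
      (X ** V)) (G X)"
    using bounded_bilinear.FDERIV[OF B smooth_on_differentiable[OF F(3,2)]
        smooth_on_differentiable[OF G(3,2)]]
    by (simp add: frechet_derivative_at[symmetric])
  finally show ?thesis using F G X by simp
qed

lemma smooth_map_bilinear:
  assumes B: "bounded_bilinear B" and fg: "smooth_map M f" "smooth_map M g"
  shows "smooth_map M (\<lambda>X. B (f X) (g X))"
proof (rule smooth_mapI)
  fix X assume "X \<in> M"
  then obtain U1 F U2 G where "open U1" "X \<in> U1" "smooth_on U1 F" "\<forall>Y\<in>U1 \<inter> M. F Y = f Y"
    "open U2" "X \<in> U2" "smooth_on U2 G" "\<forall>Y\<in>U2 \<inter> M. G Y = g Y"
    using fg unfolding smooth_map_def by meson
  then show "\<exists>U H. open U \<and> X \<in> U \<and> smooth_on U H \<and> (\<forall>Y\<in>U \<inter> M. H Y = B (f Y) (g Y))"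
    by (intro exI[of _ "U1 \<inter> U2"] exI[of _ "\<lambda>Y. B (F Y) (G Y)"])
       (auto intro!: smooth_on_bilinear[OF B] intro: smooth_on_subset)
qed

lemma lie_deriv_bounded_linear:
  assumes L: "bounded_linear L" and f: "smooth_map SO4 f" and X: "X \<in> SO4" "V \<in> so4"
  shows "lie_deriv V (\<lambda>X. L (f X)) X = L (lie_deriv V f X)"
proof -
  obtain U F where F: "open U" "X \<in> U" "smooth_on U F" "\<forall>Y\<in>U \<inter> SO4. F Y = f Y"
    "\<forall>Y\<in>U \<inter> SO4. \<forall>V\<in>so4. lie_deriv V f Y = frechet_derivative F (at Y) (Y ** V)"
    by (rule smooth_extension[OF f X(1)], rule that)
  have "lie_deriv V (\<lambda>X. L (f X)) X = frechet_derivative (\<lambda>Y. L (F Y)) (at X) (X ** V)"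
    using F X by (intro lie_deriv_eq[where U = U] smooth_on_bounded_linear_compose[OF L]) auto
  also have "\<dots> = L (frechet_derivative F (at X) (X ** V))"
    using bounded_linear.has_derivative[OF L smooth_on_differentiable[OF F(3,2)]]
    by (simp add: frechet_derivative_at[symmetric])
  finally show ?thesis using F X by simp
qed

lemma smooth_map_bounded_linear:
  assumes L: "bounded_linear L" and f: "smooth_map M f"
  shows "smooth_map M (\<lambda>X. L (f X))"
  using f unfolding smooth_map_def by (metis smooth_on_bounded_linear_compose[OF L])

lemma smooth_map_linear:
  assumes "linear T" shows "smooth_map M T"
proof -
  have "smooth_on UNIV T"
    using assms by (simp add: smooth_on_def Ck_on_bounded_linear linear_conv_bounded_linear)
  then show ?thesis unfolding smooth_map_def by (intro ballI exI[of _ UNIV] exI[of _ T]) auto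
qed

lemma lie_deriv_const:
  assumes "X \<in> SO4" "V \<in> so4" shows "lie_deriv V (\<lambda>_. c) X = 0"
proof -
  have "lie_deriv V (\<lambda>_. c) X = frechet_derivative (\<lambda>_. c) (at X) (X ** V)"
    by (rule lie_deriv_eq[where U = UNIV]) (use assms in \<open>simp_all add: smooth_on_def Ck_on_const\<close>)
  then show ?thesis by simp
qed

text \<open>\<open>lie_deriv\<close> is meaningful only for directions in \<open>so4\<close>; a
  linear map on all matrices is supplied so that results on total linear maps apply.\<close>

lemma lie_deriv_linear_direction:
  assumes "smooth_map SO4 f" "X \<in> SO4"
  obtains L where "linear L" "\<And>V. V \<in> so4 \<Longrightarrow> lie_deriv V f X = L V"
proof -
  obtain U F where F: "open U" "X \<in> U" "smooth_on U F" "\<forall>Y\<in>U \<inter> SO4. F Y = f Y"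
    "\<forall>Y\<in>U \<inter> SO4. \<forall>V\<in>so4. lie_deriv V f Y = frechet_derivative F (at Y) (Y ** V)"
    by (rule smooth_extension[OF assms], rule that)
  have "linear (frechet_derivative F (at X))"
    using smooth_on_differentiable[OF F(3,2)] by (rule has_derivative_linear)
  from linear_compose[OF bounded_linear.linear[OF mm.bounded_linear_right] this, of X]
  have "linear (\<lambda>V. frechet_derivative F (at X) (X ** V))" by (simp add: comp_def)
  with that show thesis using F(2,5) assms(2) by blast
qed

lemma lie_deriv_along_gexp:
  assumes "smooth_map SO4 f"
  shows "((\<lambda>t. f (gexp u v t)) has_vector_derivative lie_deriv (lmat u + rmat v) f (gexp u v t))
      (at t)"
proof -
  let ?X = "gexp u v t" and ?V = "lmat u + rmat v"
  obtain U F where F: "open U" "?X \<in> U" "smooth_on U F" "\<forall>Y\<in>U \<inter> SO4. F Y = f Y"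
    "\<forall>Y\<in>U \<inter> SO4. \<forall>V\<in>so4. lie_deriv V f Y = frechet_derivative F (at Y) (Y ** V)"
    by (rule smooth_extension[OF assms gexp_in_SO4], rule that)
  note dF = smooth_on_differentiable[OF F(3,2)]
  have "((\<lambda>t. F (gexp u v t)) has_vector_derivative frechet_derivative F (at ?X) (?X ** ?V)) (at t)"
    using has_derivative_compose[OF gexp_has_vector_derivative[of u v t, unfolded
        has_vector_derivative_def] dF]
    by (simp add: has_vector_derivative_def linear_scale[OF has_derivative_linear[OF dF]])
  moreover have "?V \<in> so4" using subspace_add[OF subspace_so4 so4_lmat so4_rmat] .
  ultimately have "((\<lambda>t. F (gexp u v t)) has_vector_derivative lie_deriv ?V f ?X) (at t)"
    using F(2,5) gexp_in_SO4 by (metis IntI)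
  moreover have "open (gexp u v -` U)"
    by (rule open_vimage[OF F(1)])
      (meson continuous_at_imp_continuous_on gexp_has_vector_derivative
          has_vector_derivative_continuous)
  ultimately show ?thesis
    by (rule has_vector_derivative_transform_within_open) (use F(2,4) gexp_in_SO4 in auto)
qed

lemma linear_expand_Basis:
  "linear L \<Longrightarrow> L w = (\<Sum>b\<in>Basis. (w \<bullet> b) *\<^sub>R L b)" for w :: "'a::euclidean_space"
proof -
  assume L: "linear L"
  have "L w = L (\<Sum>b\<in>Basis. (w \<bullet> b) *\<^sub>R b)" by (simp add: euclidean_representation)
  also have "\<dots> = (\<Sum>b\<in>Basis. (w \<bullet> b) *\<^sub>R L b)"
    by (simp add: linear_sum[OF L] linear_scale[OF L])
  finally show ?thesis .
qed

text \<open>The direction of differentiation moves with the point. Expanding it in a fixed basis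
  reduces the claim to products of linear functions with derivatives in constant directions.\<close>

lemma smooth_on_invariant_derivative:
  fixes F :: "real^4^4 \<Rightarrow> 'b::euclidean_space"
  assumes "open U" "smooth_on U F"
  shows "smooth_on U (\<lambda>Y. frechet_derivative F (at Y) (Y ** V))"
proof -
  have inner: "bounded_linear (\<lambda>Y. (Y ** V) \<bullet> b)" for b
    by (rule bounded_linear_compose[OF bounded_linear_inner_left mm.bounded_linear_left])
  have "Ck_on k U (\<lambda>Y. \<Sum>b\<in>Basis. ((Y ** V) \<bullet> b) *\<^sub>R frechet_derivative F (at Y) b)" for k
  proof (rule Ck_on_sum[OF assms(1) finite_Basis])
    fix b :: "real^4^4"
    have "Ck_on k U (\<lambda>Y. frechet_derivative F (at Y) b)"
      using smooth_on_frechet[OF assms(2)] by (simp add: smooth_on_def)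
    then show "Ck_on k U (\<lambda>Y. ((Y ** V) \<bullet> b) *\<^sub>R frechet_derivative F (at Y) b)"
      by (rule Ck_on_bilinear[OF bounded_bilinear_scaleR assms(1) Ck_on_bounded_linear[OF inner
          assms(1)]])
  qed
  moreover have "(\<Sum>b\<in>Basis. ((Y ** V) \<bullet> b) *\<^sub>R frechet_derivative F (at Y) b) = frechet_derivative F
      (at Y) (Y ** V)"
    if "Y \<in> U" for Y
    by (rule linear_expand_Basis[symmetric, OF
        has_derivative_linear[OF smooth_on_differentiable[OF assms(2) that]]])
  ultimately show ?thesis
    unfolding smooth_on_def by (intro allI) (rule Ck_on_cong[OF assms(1)])
qed

lemma smooth_map_lie_deriv:
  assumes "smooth_map SO4 f" "V \<in> so4"
  shows "smooth_map SO4 (lie_deriv V f)"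
proof (rule smooth_mapI)
  fix X assume "X \<in> SO4"
  obtain U F where F: "open U" "X \<in> U" "smooth_on U F" "\<forall>Y\<in>U \<inter> SO4. F Y = f Y"
    "\<forall>Y\<in>U \<inter> SO4. \<forall>V\<in>so4. lie_deriv V f Y = frechet_derivative F (at Y) (Y ** V)"
    by (rule smooth_extension[OF assms(1) \<open>X \<in> SO4\<close>], rule that)
  show "\<exists>U F. open U \<and> X \<in> U \<and> smooth_on U F \<and> (\<forall>Y\<in>U \<inter> SO4. F Y = lie_deriv V f Y)"
  proof (intro exI conjI)
    show "smooth_on U (\<lambda>Y. frechet_derivative F (at Y) (Y ** V))"
      by (rule smooth_on_invariant_derivative[OF F(1,3)])
  qed (use F(1,2,5) assms(2) in simp_all)
qed

lemma frechet_invariant_derivative: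
  fixes F :: "real^4^4 \<Rightarrow> 'b::euclidean_space"
  assumes U: "open U" "X \<in> U" "smooth_on U F"
  shows "frechet_derivative (\<lambda>Y. frechet_derivative F (at Y) (Y ** V)) (at X) W =
    frechet_derivative F (at X) (W ** V) +
    frechet_derivative (\<lambda>Y. frechet_derivative F (at Y) (X ** V)) (at X) W"
proof -
  define H where "H b Y = frechet_derivative F (at Y) b" for b Y
  define H' where "H' b = frechet_derivative (H b) (at X)" for b
  have H: "smooth_on U (H b)" for b
    unfolding H_def by (rule smooth_on_frechet[OF U(3)])
  have dH: "(H b has_derivative H' b) (at X)" for b
    unfolding H'_def by (rule smooth_on_differentiable[OF H U(2)])
  have dF: "linear (frechet_derivative F (at Y))" if "Y \<in> U" for Y
    using smooth_on_differentiable[OF U(3) that] by (rule has_derivative_linear)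
  \<comment> \<open>\<open>H'\<close> is a derivative, hence linear in its second argument; symmetry
    carries linearity over to the first, where the basis expansion has to be summed up.\<close>
  have sym: "H' b w = H' w b" for b w
    unfolding H'_def H_def using U by (intro second_derivative_symmetric[where U = U]) (simp_all
        add: smooth_on_def)
  have "((\<lambda>Y. \<Sum>b\<in>Basis. ((Y ** V) \<bullet> b) *\<^sub>R H b Y) has_derivative
      (\<lambda>W. \<Sum>b\<in>Basis. ((X ** V) \<bullet> b) *\<^sub>R H' b W + ((W ** V) \<bullet> b) *\<^sub>R H b X)) (at X)"
    by (intro has_derivative_sum has_derivative_scaleR dH bounded_linear_imp_has_derivative
      bounded_linear_compose[OF bounded_linear_inner_left mm.bounded_linear_left])
  then have "((\<lambda>Y. frechet_derivative F (at Y) (Y ** V)) has_derivative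
      (\<lambda>W. \<Sum>b\<in>Basis. ((X ** V) \<bullet> b) *\<^sub>R H' b W + ((W ** V) \<bullet> b) *\<^sub>R H b X)) (at X)"
    by (rule has_derivative_transform_within_open[OF _ U(1,2)]) (simp add: H_def flip:
        linear_expand_Basis[OF dF])
  then have "frechet_derivative (\<lambda>Y. frechet_derivative F (at Y) (Y ** V)) (at X) W =
      (\<Sum>b\<in>Basis. ((X ** V) \<bullet> b) *\<^sub>R H' b W + ((W ** V) \<bullet> b) *\<^sub>R H b X)"
    by (simp add: frechet_derivative_at[symmetric])
  also have "\<dots> = (\<Sum>b\<in>Basis. ((X ** V) \<bullet> b) *\<^sub>R H' W b) + (\<Sum>b\<in>Basis. ((W ** V) \<bullet> b) *\<^sub>R H b X)"
    by (simp add: sum.distrib sym[of _ W])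
  also have "(\<Sum>b\<in>Basis. ((X ** V) \<bullet> b) *\<^sub>R H' W b) = H' W (X ** V)"
    by (rule linear_expand_Basis[symmetric, OF has_derivative_linear[OF dH]])
  also have "(\<Sum>b\<in>Basis. ((W ** V) \<bullet> b) *\<^sub>R H b X) = H (W ** V) X"
    unfolding H_def by (rule linear_expand_Basis[symmetric, OF dF[OF U(2)]])
  also have "H' W (X ** V) = H' (X ** V) W" by (rule sym)
  finally show ?thesis by (simp add: H_def[abs_def] H'_def add.commute)
qed

text \<open>The second-order terms cancel by symmetry of the Hessian. What remains is the derivative
  of the fields themselves, \<open>X ** V ** W\<close> minus \<open>X ** W ** V\<close>.\<close>

lemma lie_deriv_commutator:
  fixes f :: "real^4^4 \<Rightarrow> 'b::euclidean_space"
  assumes f: "smooth_map SO4 f" and X: "X \<in> SO4" "V \<in> so4" "W \<in> so4"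
  shows "lie_deriv V (lie_deriv W f) X - lie_deriv W (lie_deriv V f) X = lie_deriv (ad V W) f X"
proof -
  obtain U F where F: "open U" "X \<in> U" "smooth_on U F" "\<forall>Y\<in>U \<inter> SO4. F Y = f Y"
    "\<forall>Y\<in>U \<inter> SO4. \<forall>V\<in>so4. lie_deriv V f Y = frechet_derivative F (at Y) (Y ** V)"
    by (rule smooth_extension[OF f X(1)], rule that)
  have second: "lie_deriv V (lie_deriv W f) X = frechet_derivative F (at X) (X ** V ** W) +
      frechet_derivative (\<lambda>Y. frechet_derivative F (at Y) (X ** W)) (at X) (X ** V)"
    if "V \<in> so4" "W \<in> so4" for V W
  proof -
    have "lie_deriv V (lie_deriv W f) X = frechet_derivative (\<lambda>Y. frechet_derivative F (at Y)
        (Y ** W)) (at X) (X ** V)"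
      by (rule lie_deriv_eq[OF F(1,2) smooth_on_invariant_derivative[OF F(1,3)] _ X(1) that(1)])
         (use F(5) that(2) in simp)
    then show ?thesis by (simp add: frechet_invariant_derivative[OF F(1-3)])
  qed
  have sym: "frechet_derivative (\<lambda>Y. frechet_derivative F (at Y) (X ** W)) (at X) (X ** V) =
      frechet_derivative (\<lambda>Y. frechet_derivative F (at Y) (X ** V)) (at X) (X ** W)"
    using F(1-3) by (intro second_derivative_symmetric[where U = U]) (simp_all add: smooth_on_def)
  have lin: "linear (frechet_derivative F (at X))"
    using smooth_on_differentiable[OF F(3,2)] by (rule has_derivative_linear)
  have "lie_deriv (ad V W) f X = frechet_derivative F (at X) (X ** ad V W)"
    using F(2,5) X ad_so4 by blast
  also have "\<dots> = frechet_derivative F (at X) (X ** V ** W) - frechet_derivative F (at X) (X ** W **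
      V)"
    by (simp add: ad_def mm.diff_right matrix_mul_assoc flip: linear_diff[OF lin])
  finally show ?thesis
    using second[OF X(2,3)] second[OF X(3,2)] sym by simp
qed

lemma lie_deriv_diff:
  assumes fg: "smooth_map SO4 f" "smooth_map SO4 g" and X: "X \<in> SO4" "V \<in> so4"
  shows "lie_deriv V (\<lambda>X. f X - g X) X = lie_deriv V f X - lie_deriv V g X"
proof -
  obtain U1 F where F: "open U1" "X \<in> U1" "smooth_on U1 F" "\<forall>Y\<in>U1 \<inter> SO4. F Y = f Y"
    "\<forall>Y\<in>U1 \<inter> SO4. \<forall>V\<in>so4. lie_deriv V f Y = frechet_derivative F (at Y) (Y ** V)"
    by (rule smooth_extension[OF fg(1) X(1)], rule that)
  obtain U2 G where G: "open U2" "X \<in> U2" "smooth_on U2 G" "\<forall>Y\<in>U2 \<inter> SO4. G Y = g Y"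
    "\<forall>Y\<in>U2 \<inter> SO4. \<forall>V\<in>so4. lie_deriv V g Y = frechet_derivative G (at Y) (Y ** V)"
    by (rule smooth_extension[OF fg(2) X(1)], rule that)
  have "smooth_on (U1 \<inter> U2) (\<lambda>Y. F Y + - G Y)"
    using F(1,3) G(1,3) unfolding smooth_on_def
    by (intro allI Ck_on_add Ck_on_bounded_linear_compose[OF
        bounded_linear_minus[OF bounded_linear_ident]])
       (auto intro: Ck_on_subset)
  then have "lie_deriv V (\<lambda>X. f X - g X) X = frechet_derivative (\<lambda>Y. F Y - G Y) (at X) (X ** V)"
    using F G X by (intro lie_deriv_eq[where U = "U1 \<inter> U2"]) auto
  also have "\<dots> = frechet_derivative F (at X) (X ** V) - frechet_derivative G (at X) (X ** V)"
    using has_derivative_diff[OF smooth_on_differentiable[OF F(3,2)]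
        smooth_on_differentiable[OF G(3,2)]]
    by (simp add: frechet_derivative_at[symmetric])
  finally show ?thesis using F G X by simp
qed

section \<open>The pulled back Maurer-Cartan form\<close>

text \<open>The left-trivialized differential written \<open>a V\<close> in the overview; on
  \<open>SO4\<close> the transpose is the inverse.\<close>

definition mc_form :: "(real^4^4 \<Rightarrow> real^4^4) \<Rightarrow> real^4^4 \<Rightarrow> real^4^4 \<Rightarrow> real^4^4" where
  "mc_form f V X = transpose (f X) ** lie_deriv V f X"

lemma bounded_bilinear_ad: "bounded_bilinear (ad :: real^'n^'n \<Rightarrow> real^'n^'n \<Rightarrow> real^'n^'n)"
  unfolding bilinear_conv_bounded_bilinear[symmetric] bilinear_def linear_iff
  by (simp add: ad_def mm.add_left mm.add_right mm.scaleR_left mm.scaleR_right scaleR_diff_right)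

interpretation ad: bounded_bilinear "ad :: real^'n^'n \<Rightarrow> real^'n^'n \<Rightarrow> real^'n^'n"
  by (rule bounded_bilinear_ad)

lemma ad_antisym: "ad V U = - ad U V"
  by (simp add: ad_def)

lemma ad_jacobi: "ad (ad U V) W = ad U (ad V W) - ad V (ad U W)"
  by (simp add: ad_def mm.diff_left mm.diff_right matrix_mul_assoc)

context
  fixes f :: "real^4^4 \<Rightarrow> real^4^4"
  assumes smooth: "smooth_map SO4 f" and maps: "\<And>X. X \<in> SO4 \<Longrightarrow> f X \<in> SO4"
begin

lemma image_cancel: "X \<in> SO4 \<Longrightarrow> transpose (f X) ** f X = mat 1"
    "X \<in> SO4 \<Longrightarrow> f X ** transpose (f X) = mat 1"
  "X \<in> SO4 \<Longrightarrow> f X ** (transpose (f X) ** Y) = Y"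
  using maps[of X] by (simp_all add: SO4_iff O4_cancel)

lemma lie_deriv_mc_form: "X \<in> SO4 \<Longrightarrow> lie_deriv V f X = f X ** mc_form f V X"
  by (simp add: mc_form_def image_cancel)

lemma smooth_mc_form: "V \<in> so4 \<Longrightarrow> smooth_map SO4 (mc_form f V)"
  unfolding mc_form_def[abs_def]
  by (intro smooth_map_bilinear[OF bounded_bilinear_matrix_mult]
      smooth_map_bounded_linear[OF bounded_linear_transpose]
      smooth smooth_map_lie_deriv)

lemma mc_form_so4:
  assumes "X \<in> SO4" "V \<in> so4" shows "mc_form f V X \<in> so4"
proof -
  have "lie_deriv V (\<lambda>X. transpose (f X) ** f X) X =
     transpose (f X) ** lie_deriv V f X + transpose (lie_deriv V f X) ** f X"
    by (simp add: lie_deriv_bilinear[OF bounded_bilinear_matrix_mult]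
        lie_deriv_bounded_linear[OF bounded_linear_transpose]
        smooth_map_bounded_linear[OF bounded_linear_transpose] smooth assms)
  moreover have "lie_deriv V (\<lambda>X. transpose (f X) ** f X) X = lie_deriv V (\<lambda>_. mat 1) X"
    by (rule lie_deriv_cong)
       (simp_all add: image_cancel smooth assms
           smooth_map_bounded_linear[OF bounded_linear_transpose]
          smooth_map_bilinear[OF bounded_bilinear_matrix_mult])
  ultimately have "transpose (f X) ** lie_deriv V f X + transpose (lie_deriv V f X) ** f X = 0"
    by (simp add: lie_deriv_const assms)
  then show ?thesis
    by (simp add: so4_def mc_form_def matrix_transpose_mul eq_neg_iff_add_eq_0 add.commute)
qed

lemma mc_form_linear:
  assumes "X \<in> SO4"
  obtains L where "linear L" "\<And>V. V \<in> so4 \<Longrightarrow> mc_form f V X = L V"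
proof -
  obtain L where L: "linear L" "\<And>V. V \<in> so4 \<Longrightarrow> lie_deriv V f X = L V"
    by (rule lie_deriv_linear_direction[OF smooth assms], rule that)
  have "linear (\<lambda>V. transpose (f X) ** L V)"
    using linear_compose[OF L(1) bounded_linear.linear[OF mm.bounded_linear_right]]
        by (simp add: comp_def)
  with that show thesis using L(2) by (simp add: mc_form_def)
qed

lemma lie_deriv_mc_form_so4:
  assumes "X \<in> SO4" "U \<in> so4" "V \<in> so4"
  shows "lie_deriv U (mc_form f V) X \<in> so4"
proof -
  have "lie_deriv U (\<lambda>Y. transpose (mc_form f V Y)) X = lie_deriv U (\<lambda>Y. - mc_form f V Y) X"
    by (rule lie_deriv_cong)
       (use mc_form_so4 assms in \<open>simp_all add: so4_def
           smooth_map_bounded_linear[OF bounded_linear_transpose] smooth_mc_form\<close>)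
  moreover have "lie_deriv U (\<lambda>Y. - mc_form f V Y) X = - lie_deriv U (mc_form f V) X"
    by (rule lie_deriv_bounded_linear[OF bounded_linear_minus[OF bounded_linear_ident]])
       (use assms smooth_mc_form in auto)
  moreover have "lie_deriv U (\<lambda>Y. transpose (mc_form f V Y)) X =
      transpose (lie_deriv U (mc_form f V) X)"
    by (rule lie_deriv_bounded_linear[OF bounded_linear_transpose smooth_mc_form]) (use assms in
        auto)
  ultimately show ?thesis by (simp add: so4_def)
qed

text \<open>The Maurer-Cartan equation pulled back by \<open>f\<close>. The product rule gives a
  second derivative of \<open>f\<close> and, by skewness of \<open>mc_form\<close>, minus a product
  of two forms. Alternation turns the former into the derivative along the bracket and the latter
  into a bracket.\<close>

lemma mc_structure_equation:
  assumes "X \<in> SO4" "U \<in> so4" "V \<in> so4"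
  shows "lie_deriv U (mc_form f V) X - lie_deriv V (mc_form f U) X =
    mc_form f (ad U V) X - ad (mc_form f U X) (mc_form f V X)"
proof -
  have D: "lie_deriv U (mc_form f V) X = transpose (f X) ** lie_deriv U (lie_deriv V f) X - mc_form
      f U X ** mc_form f V X"
    if "U \<in> so4" "V \<in> so4" for U V
  proof -
    have "lie_deriv U (mc_form f V) X =
        transpose (f X) ** lie_deriv U (lie_deriv V f) X + transpose (lie_deriv U f X) ** lie_deriv
            V f X"
      unfolding mc_form_def[abs_def]
      by (simp add: lie_deriv_bilinear[OF bounded_bilinear_matrix_mult]
          lie_deriv_bounded_linear[OF bounded_linear_transpose]
        smooth_map_bounded_linear[OF bounded_linear_transpose] smooth_map_lie_deriv smooth assms
            that)
    also have "transpose (lie_deriv U f X) ** lie_deriv V f X = transpose (mc_form f U X) ** mc_form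
        f V X"
      by (simp add: lie_deriv_mc_form[OF assms(1)] matrix_transpose_mul image_cancel[OF assms(1)]
          flip: matrix_mul_assoc)
         (simp add: matrix_mul_assoc image_cancel[OF assms(1)])
    also have "transpose (mc_form f U X) = - mc_form f U X"
      using mc_form_so4[OF assms(1) that(1)] by (simp add: so4_def)
    finally show ?thesis by (simp add: mm.minus_left)
  qed
  have "mc_form f (ad U V) X = transpose (f X) ** lie_deriv U (lie_deriv V f) X - transpose (f X) **
      lie_deriv V (lie_deriv U f) X"
    unfolding mc_form_def lie_deriv_commutator[OF smooth assms, symmetric] by (rule mm.diff_right)
  then show ?thesis
    unfolding D[OF assms(2,3)] D[OF assms(3,2)] by (simp add: ad_def)
qed

context
  assumes metric: "\<And>X U V. \<lbrakk>X \<in> SO4; U \<in> so4; V \<in> so4\<rbrakk> \<Longrightarrow> mc_form f U X \<bullet> mc_form f V X = U \<bullet> V"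
begin

lemma mc_form_surj:
  assumes "X \<in> SO4" "Z \<in> so4" obtains W where "W \<in> so4" "Z = mc_form f W X"
proof -
  obtain L where L: "linear L" "\<And>V. V \<in> so4 \<Longrightarrow> mc_form f V X = L V"
    by (rule mc_form_linear[OF assms(1)], rule that)
  have "L ` so4 = so4"
    using L(2) mc_form_so4[OF assms(1)] metric[OF assms(1)] by (intro so4_image_eq[OF L(1)]) metis+
  then show thesis using that L(2) assms(2) by (metis imageE)
qed

text \<open>The Koszul formula: skewness of \<open>b U V W\<close> in the last two arguments and its alternation in the
  first two, which is totally skew because the metric is bi-invariant, determine it.\<close>

lemma lie_deriv_mc_form_metric:
  assumes X: "X \<in> SO4" and UV: "U \<in> so4" "V \<in> so4"
  shows "2 *\<^sub>R lie_deriv U (mc_form f V) X = mc_form f (ad U V) X - ad (mc_form f U X) (mc_form f V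
      X)"
proof -
  define b where "b U V W = lie_deriv U (mc_form f V) X \<bullet> mc_form f W X" for U V W
  define t where "t U V W = ad U V \<bullet> W - ad (mc_form f U X) (mc_form f V X) \<bullet> mc_form f W X"
      for U V W
  note so4 = mc_form_so4[OF X]
  have skew: "b U V W = - b U W V" if "U \<in> so4" "V \<in> so4" "W \<in> so4" for U V W
  proof -
    have "lie_deriv U (\<lambda>Y. mc_form f V Y \<bullet> mc_form f W Y) X = mc_form f V X \<bullet> lie_deriv U (mc_form f
        W) X + b U V W"
      unfolding b_def by (rule lie_deriv_bilinear[OF bounded_bilinear_inner smooth_mc_form
          smooth_mc_form X]) (rule that)+
    moreover have "lie_deriv U (\<lambda>Y. mc_form f V Y \<bullet> mc_form f W Y) X = lie_deriv U (\<lambda>_. V \<bullet> W) X"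
      by (rule lie_deriv_cong[OF _ smooth_map_bilinear[OF bounded_bilinear_inner smooth_mc_form
          smooth_mc_form] X])
         (simp_all add: metric that)
    ultimately show ?thesis
      by (simp add: lie_deriv_const X that b_def inner_commute)
  qed
  have alt: "b U V W - b V U W = t U V W" if "U \<in> so4" "V \<in> so4" "W \<in> so4" for U V W
    using arg_cong[OF mc_structure_equation[OF X that(1,2)], of "\<lambda>Z. Z \<bullet> mc_form f W X"]
    by (simp add: b_def t_def inner_diff_left metric[OF X] ad_so4 that)
  have cyclic: "t U V W = t V W U" if "U \<in> so4" "V \<in> so4" "W \<in> so4" for U V W
    unfolding t_def using inner_ad_cyclic[OF that] inner_ad_cyclic[of "mc_form f U X"
        "mc_form f V X" "mc_form f W X"]
      so4 that by simp
  \<comment> \<open>By cyclicity the three alternations have the same right-hand side. Adding those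
    for U, V, W and for W, U, V and subtracting the one for V, W, U leaves
    \<open>2 * b U V W\<close> after the skewness is used.\<close>
  have b: "2 * b U V W = t U V W" if "W \<in> so4" for W
    using alt[OF UV that] alt[OF UV(2) that UV(1)] alt[OF that UV]
      skew[OF UV that] skew[OF UV(2) that UV(1)] skew[OF that UV]
      cyclic[OF UV that] cyclic[OF UV(2) that UV(1)] by linarith
  define Z where "Z = 2 *\<^sub>R lie_deriv U (mc_form f V) X - (mc_form f (ad U V) X - ad (mc_form f U X)
      (mc_form f V X))"
  have "Z \<in> so4"
    unfolding Z_def using subspace_so4 X UV
    by (intro subspace_diff subspace_scale lie_deriv_mc_form_so4 so4 ad_so4)
  \<comment> \<open>Surjectivity lets \<open>Z\<close> be tested against itself, so that its norm
    vanishes.\<close>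
  then obtain W where W: "W \<in> so4" "Z = mc_form f W X" by (rule mc_form_surj[OF X])
  have "Z \<bullet> mc_form f W X = 2 * b U V W - t U V W"
    by (simp add: Z_def b_def t_def inner_diff_left metric[OF X] ad_so4 UV W(1))
  then have "Z = 0" using b[OF W(1)] W(2) by simp
  then show ?thesis by (simp add: Z_def)
qed

text \<open>Applying the Koszul formula twice expresses \<open>4\<close> times a second derivative
  of \<open>mc_form f W\<close> by brackets. Its alternation in \<open>U\<close> and
  \<open>V\<close> is also the derivative along \<open>ad U V\<close>, given by a single
  application. Equating the two, the mixed terms cancel and the Jacobi identity leaves the
  claim.\<close>

lemma mc_form_lie_triple:
  assumes X: "X \<in> SO4" and UVW: "U \<in> so4" "V \<in> so4" "W \<in> so4"
  shows "ad (ad (mc_form f U X) (mc_form f V X)) (mc_form f W X) = mc_form f (ad (ad U V) W) X"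
proof -
  let ?a = "\<lambda>V. mc_form f V X"
  have second: "4 *\<^sub>R lie_deriv U (lie_deriv V (mc_form f W)) X =
      ?a (ad U (ad V W)) - ad (?a U) (?a (ad V W)) -
      ad (?a (ad U V) - ad (?a U) (?a V)) (?a W) - ad (?a V) (?a (ad U W) - ad (?a U) (?a W))"
    if UV: "U \<in> so4" "V \<in> so4" for U V
  proof -
    have sm: "smooth_map SO4 (\<lambda>Y. ad (mc_form f V Y) (mc_form f W Y))"
      by (intro smooth_map_bilinear[OF bounded_bilinear_ad] smooth_mc_form UV UVW)
    have "2 *\<^sub>R lie_deriv U (lie_deriv V (mc_form f W)) X = lie_deriv U (\<lambda>Y. 2 *\<^sub>R lie_deriv V
        (mc_form f W) Y) X"
      by (rule lie_deriv_bounded_linear[symmetric, OF bounded_linear_scaleR_right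
          smooth_map_lie_deriv])
         (intro smooth_mc_form UV UVW X)+
    also have "\<dots> = lie_deriv U (\<lambda>Y. mc_form f (ad V W) Y - ad (mc_form f V Y) (mc_form f W Y)) X"
      by (rule lie_deriv_cong)
         (simp_all add: lie_deriv_mc_form_metric UV UVW X
             smooth_map_bounded_linear[OF bounded_linear_scaleR_right]
            smooth_map_lie_deriv smooth_mc_form)
    also have "\<dots> = lie_deriv U (mc_form f (ad V W)) X - lie_deriv U (\<lambda>Y. ad (mc_form f V Y)
        (mc_form f W Y)) X"
      by (rule lie_deriv_diff[OF smooth_mc_form sm X UV(1)]) (intro ad_so4 UV UVW)
    also have "lie_deriv U (\<lambda>Y. ad (mc_form f V Y) (mc_form f W Y)) X =
        ad (?a V) (lie_deriv U (mc_form f W) X) + ad (lie_deriv U (mc_form f V) X) (?a W)"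
      by (intro lie_deriv_bilinear[OF bounded_bilinear_ad] smooth_mc_form UV UVW X)
    finally have "2 *\<^sub>R 2 *\<^sub>R lie_deriv U (lie_deriv V (mc_form f W)) X =
      2 *\<^sub>R lie_deriv U (mc_form f (ad V W)) X -
      (ad (?a V) (2 *\<^sub>R lie_deriv U (mc_form f W) X) + ad (2 *\<^sub>R lie_deriv U (mc_form f V) X) (?a
          W))"
      by (simp only: scaleR_diff_right scaleR_add_right ad.scaleR_left ad.scaleR_right)
    then show ?thesis
      by (simp add: lie_deriv_mc_form_metric UV UVW X ad_so4 algebra_simps)
  qed
  obtain L where L: "linear L" "\<And>V. V \<in> so4 \<Longrightarrow> ?a V = L V"
    by (rule mc_form_linear[OF X], rule that)
  have "?a (ad U (ad V W)) - ?a (ad V (ad U W)) = ?a (ad (ad U V) W)"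
    by (simp only: L(2) UVW ad_so4) (simp only: ad_jacobi[of U V W] linear_diff[OF L(1)])
  moreover have "?a (ad V U) = - ?a (ad U V)"
    by (simp only: L(2) UVW ad_so4) (simp only: ad_antisym[of V U] linear_neg[OF L(1)])
  \<comment> \<open>One application of the Koszul formula accounts for a factor 2; the other 2
    matches the scaling of \<open>second\<close>.\<close>
  moreover have "4 *\<^sub>R lie_deriv (ad U V) (mc_form f W) X = 2 *\<^sub>R (?a (ad (ad U V) W) - ad
      (?a (ad U V)) (?a W))"
    using lie_deriv_mc_form_metric[OF X ad_so4[OF UVW(1,2)] UVW(3)]
        by (metis mult_2 numeral_Bit0 numeral_One scaleR_scaleR mult_1 distrib_right one_add_one)
  moreover have "4 *\<^sub>R lie_deriv (ad U V) (mc_form f W) X =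
      4 *\<^sub>R lie_deriv U (lie_deriv V (mc_form f W)) X - 4 *\<^sub>R lie_deriv V (lie_deriv U (mc_form f
          W)) X"
    using lie_deriv_commutator[OF smooth_mc_form[OF UVW(3)] X UVW(1,2)]
        by (simp flip: scaleR_diff_right)
  ultimately show ?thesis
    unfolding second[OF UVW(1,2)] second[OF UVW(2,1)]
    using ad_jacobi[of "?a U" "?a V" "?a W"] ad_antisym[of "?a V" "?a U"]
    by (simp add: ad.diff_left ad.diff_right ad.minus_left scaleR_2 algebra_simps)
qed

end

end

section \<open>Isometries\<close>

definition preserves_metric :: "(real^4^4 \<Rightarrow> real^4^4) \<Rightarrow> bool" where
  "preserves_metric f \<longleftrightarrow> smooth_map SO4 f \<and> (\<forall>X\<in>SO4. f X \<in> SO4) \<and>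
     (\<forall>X\<in>SO4. \<forall>U\<in>so4. \<forall>V\<in>so4. mc_form f U X \<bullet> mc_form f V X = U \<bullet> V)"

lemma isometry_of_SO4_iff:
  "isometry_of SO4 (killing_metric SO4) f \<longleftrightarrow> diffeomorphism_of SO4 f \<and> preserves_metric f"
proof (cases "diffeomorphism_of SO4 f")
  case True
  then have f: "smooth_map SO4 f" "X \<in> SO4 \<Longrightarrow> f X \<in> SO4" for X
    by (auto simp: diffeomorphism_of_def bij_betw_def)
  have "killing_metric SO4 (f X) (differential SO4 f X (X ** U)) (differential SO4 f X (X ** V)) =
      2 * (mc_form f U X \<bullet> mc_form f V X)" if "X \<in> SO4" "U \<in> so4" "V \<in> so4" for X U V
    using killing_metric_SO4[OF f(2)[OF that(1)] mc_form_so4[OF f that(1,2)]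
        mc_form_so4[OF f that(1,3)]]
    by (simp add: lie_deriv_mc_form[OF f that(1), symmetric] lie_deriv_def)
  then show ?thesis
    using True f by (simp add: isometry_of_def preserves_metric_def tangent_space_SO4
        killing_metric_SO4)
qed (simp add: isometry_of_def)

lemma mc_form_along_gexp:
  assumes f: "preserves_metric f"
  shows "mc_form f (lmat u + rmat v) (gexp u v t) = mc_form f (lmat u + rmat v) (mat 1)"
proof -
  let ?V = "lmat u + rmat v"
  have f: "smooth_map SO4 f" "\<And>X. X \<in> SO4 \<Longrightarrow> f X \<in> SO4"
    "\<And>X U V. \<lbrakk>X \<in> SO4; U \<in> so4; V \<in> so4\<rbrakk> \<Longrightarrow> mc_form f U X \<bullet> mc_form f V X = U \<bullet> V"
    using assms by (auto simp: preserves_metric_def)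
  have V: "?V \<in> so4" by (intro subspace_add[OF subspace_so4] so4_lmat so4_rmat)
  \<comment> \<open>Its norm is that of the zero vector. This disposes of the term with
    \<open>ad ?V ?V\<close> in the Koszul formula.\<close>
  have "mc_form f 0 X = 0" if "X \<in> SO4" for X
    using f(3)[OF that, of 0 0] subspace_0[OF subspace_so4] by simp
  then have "2 *\<^sub>R lie_deriv ?V (mc_form f ?V) X = 0" if "X \<in> SO4" for X
    using that by (simp add: lie_deriv_mc_form_metric[OF f that V V] ad_def)
  then have "((\<lambda>t. mc_form f ?V (gexp u v t)) has_vector_derivative 0) (at t)" for t
    using lie_deriv_along_gexp[OF smooth_mc_form[OF f(1,2) V], of u v t] gexp_in_SO4 by simp
  then obtain c where "\<And>t. mc_form f ?V (gexp u v t) = c"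
    using has_vector_derivative_zero_constant[of UNIV "\<lambda>t. mc_form f ?V (gexp u v t)"] by auto
  then show ?thesis by (metis gexp_0)
qed

text \<open>Along a one-parameter subgroup both maps solve the linear equation Y' = Y K with the
  same constant skew \<open>K\<close>. Skewness makes the product of \<open>f\<close> with the
  transpose of \<open>h\<close> constant, so no uniqueness theorem for differential equations is
  invoked.\<close>

lemma preserves_metric_unique:
  assumes f: "preserves_metric f" and h: "preserves_metric h"
    and init: "f (mat 1) = h (mat 1)" "\<And>V. V \<in> so4 \<Longrightarrow> mc_form f V (mat 1) = mc_form h V (mat 1)"
    and X: "X \<in> SO4"
  shows "f X = h X"
proof -
  have f': "smooth_map SO4 f" "\<And>X. X \<in> SO4 \<Longrightarrow> f X \<in> SO4"
      and h': "smooth_map SO4 h" "\<And>X. X \<in> SO4 \<Longrightarrow> h X \<in> SO4"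
    using f h by (auto simp: preserves_metric_def)
  obtain u v where X: "X = gexp u v 1" unfolding gexp_def by (rule SO4_exp[OF X])
  let ?V = "lmat u + rmat v"
  have V: "?V \<in> so4" by (intro subspace_add[OF subspace_so4] so4_lmat so4_rmat)
  define K where "K = mc_form f ?V (mat 1)"
  have K: "transpose K = - K" using mc_form_so4[OF f' SO4_mat_1 V] by (simp add: K_def so4_def)
  have df: "((\<lambda>t. f (gexp u v t)) has_vector_derivative f (gexp u v t) ** K) (at t)" for t
    using lie_deriv_along_gexp[OF f'(1), of u v t]
    by (simp add: lie_deriv_mc_form[OF f' gexp_in_SO4] mc_form_along_gexp[OF f] K_def)
  have dh: "((\<lambda>t. h (gexp u v t)) has_vector_derivative h (gexp u v t) ** K) (at t)" for t
    using lie_deriv_along_gexp[OF h'(1), of u v t]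
    by (simp add: lie_deriv_mc_form[OF h' gexp_in_SO4] mc_form_along_gexp[OF h] K_def init(2)[OF V])
  have "((\<lambda>t. f (gexp u v t) ** transpose (h (gexp u v t))) has_vector_derivative 0) (at t)" for t
    using mm.has_vector_derivative[OF df bounded_linear.has_vector_derivative[OF
        bounded_linear_transpose dh], of t]
    by (simp add: matrix_transpose_mul K mm.minus_left mm.minus_right matrix_mul_assoc)
  then obtain c where c: "\<And>t. f (gexp u v t) ** transpose (h (gexp u v t)) = c"
    using has_vector_derivative_zero_constant[of UNIV
        "\<lambda>t. f (gexp u v t) ** transpose (h (gexp u v t))"] by auto
  have hh: "h Y ** transpose (h Y) = mat 1" "transpose (h Y) ** h Y = mat 1" if "Y \<in> SO4" for Y
    using h'(2)[OF that] by (simp_all add: SO4_iff O4_cancel)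
  have "f X ** transpose (h X) = mat 1"
    using c[of 0] c[of 1] hh(1)[OF SO4_mat_1] by (simp add: X gexp_0 init(1))
  then have "f X ** transpose (h X) ** h X = h X" by simp
  then show ?thesis
    using hh(2)[of X] X gexp_in_SO4 by (simp flip: matrix_mul_assoc)
qed

section \<open>Isometries induced by linear maps of the matrix space\<close>

text \<open>The inverse on \<open>SO4\<close> is asked to be the restriction of a linear map too,
  because a diffeomorphism has to have a smooth inverse.\<close>

definition linear_isometry :: "(real^4^4 \<Rightarrow> real^4^4) \<Rightarrow> bool" where
  "linear_isometry T \<longleftrightarrow> linear T \<and> (\<forall>U V. T U \<bullet> T V = U \<bullet> V) \<and> (\<forall>X\<in>SO4. T X \<in> SO4) \<and>
     (\<exists>T'. linear T' \<and> (\<forall>X\<in>SO4. T' X \<in> SO4 \<and> T' (T X) = X \<and> T (T' X) = X))"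

lemma linear_isometry_comp:
  assumes "linear_isometry S" "linear_isometry T" shows "linear_isometry (\<lambda>X. S (T X))"
proof -
  obtain S' T' where S': "linear S'" "\<forall>X\<in>SO4. S' X \<in> SO4 \<and> S' (S X) = X \<and> S (S' X) = X"
    and T': "linear T'" "\<forall>X\<in>SO4. T' X \<in> SO4 \<and> T' (T X) = X \<and> T (T' X) = X"
    using assms unfolding linear_isometry_def by blast
  have "linear (\<lambda>X. S (T X))" "linear (\<lambda>X. T' (S' X))"
    using assms linear_compose[of T S] linear_compose[OF S'(1) T'(1)]
    by (simp_all add: linear_isometry_def comp_def)
  moreover have "\<forall>X\<in>SO4. T' (S' X) \<in> SO4 \<and> T' (S' (S (T X))) = X \<and> S (T (T' (S' X))) = X"
    using S'(2) T'(2) assms by (simp add: linear_isometry_def)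
  ultimately show ?thesis
    using assms unfolding linear_isometry_def by auto
qed

lemma linear_isometry_id: "linear_isometry (\<lambda>X. X)"
  unfolding linear_isometry_def using linear_id by (auto simp: id_def)

lemma linear_isometry_transpose: "linear_isometry transpose"
  unfolding linear_isometry_def
  by (auto simp: bounded_linear.linear[OF bounded_linear_transpose] inner_transpose SO4_transpose
      intro!: exI[of _ transpose])

lemma linear_isometry_tau_lin: "linear_isometry tau_lin"
  unfolding linear_isometry_def
  by (auto simp: linear_tau_lin tau_lin_inner tau_lin_SO4 tau_lin_involution intro!:
      exI[of _ tau_lin])

lemma linear_isometry_mult:
  assumes "A \<in> O4" "B \<in> O4" "det A * det B = 1" shows "linear_isometry (\<lambda>X. A ** X ** B)"
  unfolding linear_isometry_def
proof (intro conjI exI[of _ "\<lambda>Y. transpose A ** Y ** transpose B"])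
  have lin: "linear (\<lambda>X. C ** X ** D)" for C D :: "real^4^4"
    by (rule linearI) (simp_all add: mm.add_left mm.add_right mm.scaleR_left mm.scaleR_right)
  show "linear (\<lambda>X. A ** X ** B)" "linear (\<lambda>Y. transpose A ** Y ** transpose B)" by (rule lin)+
  have "A ** X ** B \<in> SO4" if "A \<in> O4" "B \<in> O4" "det A * det B = 1" "X \<in> SO4" for A B X
    using that by (simp add: SO4_iff O4_mult det_mul)
  from this[OF assms] this[OF O4_transpose[OF assms(1)] O4_transpose[OF assms(2)]]
  show "\<forall>X\<in>SO4. A ** X ** B \<in> SO4" "\<forall>X\<in>SO4. transpose A ** X ** transpose B \<in> SO4 \<and>
      transpose A ** (A ** X ** B) ** transpose B = X \<and> A ** (transpose A ** X ** transpose B) ** B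
          = X"
    using assms(3) by (simp_all add: O4_cancel[OF assms(1)] O4_cancel[OF assms(2)] flip:
        matrix_mul_assoc)
qed (simp add: O4_inner assms)

lemma linear_isometry_deriv:
  assumes T: "linear_isometry T" and f: "\<And>X. X \<in> SO4 \<Longrightarrow> f X = T X" and X: "X \<in> SO4" "V \<in> so4"
  shows "lie_deriv V f X = T (X ** V)"
proof -
  have lin: "bounded_linear T" using T by (simp add: linear_isometry_def linear_conv_bounded_linear)
  have "lie_deriv V f X = frechet_derivative T (at X) (X ** V)"
    by (rule lie_deriv_eq[where U = UNIV])
       (use f X Ck_on_bounded_linear[OF lin open_UNIV] in \<open>simp_all add: smooth_on_def\<close>)
  also have "frechet_derivative T (at X) = T"
    using bounded_linear_imp_has_derivative[OF lin] by (simp add: frechet_derivative_at[symmetric])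
  finally show ?thesis .
qed

text \<open>\<open>T\<close> is its own smooth extension and its own derivative, so its
  orthogonality is the metric condition. Agreement is assumed on \<open>SO4\<close> only, as the
  values of \<open>f\<close> elsewhere are arbitrary.\<close>

lemma linear_isometry_isometry:
  assumes T: "linear_isometry T" and f: "\<And>X. X \<in> SO4 \<Longrightarrow> f X = T X"
  shows "diffeomorphism_of SO4 f" "preserves_metric f"
proof -
  obtain T' where lin: "linear T" "linear T'"
      and T': "\<And>X. X \<in> SO4 \<Longrightarrow> T' X \<in> SO4 \<and> T' (T X) = X \<and> T (T' X) = X"
    and inner: "\<And>U V. T U \<bullet> T V = U \<bullet> V" and maps: "\<And>X. X \<in> SO4 \<Longrightarrow> T X \<in> SO4"
    using T unfolding linear_isometry_def by blast
  have bij: "bij_betw f SO4 SO4"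
    by (rule bij_betw_byWitness[where f' = T']) (use f T' maps in auto)
  have inv: "T' X = inv_into SO4 f X" if "X \<in> SO4" for X
    using that T' f by (intro inv_into_f_eq[symmetric] bij_betw_imp_inj_on[OF bij]) auto
  have smooth: "smooth_map SO4 f"
    by (rule smooth_map_cong[OF _ smooth_map_linear[OF lin(1)]]) (simp add: f)
  show "diffeomorphism_of SO4 f"
    unfolding diffeomorphism_of_def
    using bij smooth smooth_map_cong[OF inv smooth_map_linear[OF lin(2)]] by blast
  have "mc_form f U X \<bullet> mc_form f V X = U \<bullet> V" if "X \<in> SO4" "U \<in> so4" "V \<in> so4" for X U V
  proof -
    have "X \<in> O4" "f X \<in> O4" using that(1) maps f by (auto simp: SO4_iff)
    moreover have "lie_deriv W f X = T (X ** W)" if "W \<in> so4" for W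
      by (rule linear_isometry_deriv[OF T _ \<open>X \<in> SO4\<close> that]) (rule f)
    ultimately show ?thesis
      using that by (simp add: mc_form_def O4_inner O4_transpose inner)
  qed
  then show "preserves_metric f"
    using smooth f maps by (simp add: preserves_metric_def)
qed

lemma sign_change_extension:
  assumes "\<sigma> \<in> {1, -1}" "\<upsilon> \<in> {1, -1}"
  obtains \<theta> where "\<theta> = (\<lambda>X. X) \<or> \<theta> = transpose \<or> \<theta> = tau_lin \<or> \<theta> = (\<lambda>X. transpose (tau_lin X))"
    "\<theta> (mat 1) = mat 1" "\<And>u v. \<theta> (lmat u + rmat v) = \<sigma> *\<^sub>R lmat u + \<upsilon> *\<^sub>R rmat v"
proof -
  note tau = tau_lin_mat_1 linear_add[OF linear_tau_lin] tau_lin_lmat tau_lin_rmat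
    transpose_add transpose_diff transpose_minus transpose_lmat transpose_rmat
  consider "\<sigma> = 1" "\<upsilon> = 1" | "\<sigma> = -1" "\<upsilon> = -1" | "\<sigma> = 1" "\<upsilon> = -1" | "\<sigma> = -1" "\<upsilon> = 1"
    using assms by blast
  then show thesis
  proof cases
    case 1
    show thesis by (rule that[of "\<lambda>X. X"]) (simp_all add: 1)
  next
    case 2
    show thesis by (rule that[of transpose]) (simp_all add: 2 tau)
  next
    case 3
    show thesis by (rule that[of tau_lin]) (simp_all add: 3 tau)
  next
    case 4
    show thesis by (rule that[of "\<lambda>X. transpose (tau_lin X)"]) (simp_all add: 4 tau)
  qed
qed

lemma det_O4: "A \<in> O4 \<Longrightarrow> det A = 1 \<or> det A = -1"
  by (simp add: O4_def det_orthogonal_matrix)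

lemma preserves_metric_form:
  assumes f: "preserves_metric f"
  obtains A B \<theta> where "A \<in> SO4 \<and> B \<in> SO4 \<or> A \<in> O4 - SO4 \<and> B \<in> O4 - SO4"
    "\<theta> = (\<lambda>X. X) \<or> \<theta> = transpose \<or> \<theta> = tau_lin \<or> \<theta> = (\<lambda>X. transpose (tau_lin X))"
    "\<forall>X\<in>SO4. f X = A ** \<theta> X ** B"
proof -
  have f': "smooth_map SO4 f" "\<And>X. X \<in> SO4 \<Longrightarrow> f X \<in> SO4"
    "\<And>X U V. \<lbrakk>X \<in> SO4; U \<in> so4; V \<in> so4\<rbrakk> \<Longrightarrow> mc_form f U X \<bullet> mc_form f V X = U \<bullet> V"
    using f by (auto simp: preserves_metric_def)
  obtain L where L: "linear L" "\<And>V. V \<in> so4 \<Longrightarrow> mc_form f V (mat 1) = L V"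
    by (rule mc_form_linear[OF f'(1,2) SO4_mat_1], assumption, rule that)
  obtain A B C \<sigma> \<upsilon> where AB: "A \<in> lunits" "B \<in> runits" and C: "C = A ** B \<or> C = A ** B ** J4"
    and signs: "\<sigma> \<in> {1, -1}" "\<upsilon> \<in> {1, -1}"
    and LC: "\<And>u v. L (lmat u + rmat v) = C ** (\<sigma> *\<^sub>R lmat u + \<upsilon> *\<^sub>R rmat v) ** transpose C"
  proof (rule lie_triple_classification[OF L(1)])
    show "L V \<in> so4" if "V \<in> so4" for V
      using mc_form_so4[OF f'(1,2) SO4_mat_1 that] L(2)[OF that] by simp
    show "L U \<bullet> L V = U \<bullet> V" if "U \<in> so4" "V \<in> so4" for U V
      using f'(3)[OF SO4_mat_1 that] by (simp add: L(2) that)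
    show "ad (ad (L U) (L V)) (L W) = L (ad (ad U V) W)" if "U \<in> so4" "V \<in> so4" "W \<in> so4" for U V W
      using mc_form_lie_triple[OF f' SO4_mat_1 that] by (simp add: L(2) that ad_so4)
  qed (rule that)
  have CO: "C \<in> O4" using AB C by (auto intro: O4_mult O4_lunits O4_runits O4_J4)
  obtain \<theta> where \<theta>: "\<theta> = (\<lambda>X. X) \<or> \<theta> = transpose \<or> \<theta> = tau_lin \<or> \<theta> = (\<lambda>X. transpose (tau_lin X))"
    "\<theta> (mat 1) = mat 1" "\<And>u v. \<theta> (lmat u + rmat v) = \<sigma> *\<^sub>R lmat u + \<upsilon> *\<^sub>R rmat v"
    by (rule sign_change_extension[OF signs], rule that)
  have fO: "f (mat 1) \<in> O4" "det (f (mat 1)) = 1" using f'(2)[OF SO4_mat_1] by (auto simp: SO4_iff)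
  \<comment> \<open>The candidate with the value and the differential of \<open>f\<close> at the
    identity: \<theta> realizes the signs there, conjugation by \<open>C\<close> the rest, and
    \<open>f (mat 1)\<close> translates to the right base point.\<close>
  define h where "h X = (f (mat 1) ** C) ** \<theta> X ** transpose C" for X
  have iso_\<theta>: "linear_isometry \<theta>"
    using \<theta>(1) linear_isometry_id linear_isometry_transpose linear_isometry_tau_lin
      linear_isometry_comp[OF linear_isometry_transpose linear_isometry_tau_lin] by auto
  have "det (f (mat 1) ** C) * det (transpose C) = 1"
    using fO(2) det_O4[OF CO] by (auto simp: det_mul)
  then have iso: "linear_isometry h"
    unfolding h_def[abs_def]
    by (intro linear_isometry_comp[OF linear_isometry_mult iso_\<theta>] O4_mult O4_transpose fO CO)
  have "mc_form f V (mat 1) = mc_form h V (mat 1)" if V: "V \<in> so4" for V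
  proof -
    obtain u v where uv: "V = lmat u + rmat v" by (rule so4_decompose[OF V])
    have "lie_deriv V h (mat 1) = h V"
      using linear_isometry_deriv[OF iso _ SO4_mat_1 V] by simp
    moreover have "h (mat 1) = f (mat 1)"
      by (simp add: h_def \<theta>(2) O4_cancel[OF CO] flip: matrix_mul_assoc)
    ultimately have "mc_form h V (mat 1) = transpose (f (mat 1)) ** h V"
      by (simp add: mc_form_def)
    also have "\<dots> = C ** \<theta> V ** transpose C"
      by (simp add: h_def O4_cancel[OF fO(1)] flip: matrix_mul_assoc)
    finally show ?thesis unfolding L(2)[OF V] unfolding uv LC \<theta>(3) by (rule sym)
  qed
  moreover have "f (mat 1) = h (mat 1)"
    by (simp add: h_def \<theta>(2) O4_cancel[OF CO] flip: matrix_mul_assoc)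
  ultimately have "\<forall>X\<in>SO4. f X = h X"
    using preserves_metric_unique[OF f linear_isometry_isometry(2)[OF iso refl]] by blast
  moreover have "f (mat 1) ** C \<in> SO4 \<and> transpose C \<in> SO4 \<or> f (mat 1) ** C \<in> O4 - SO4 \<and>
      transpose C \<in> O4 - SO4"
    using fO CO by (auto simp: SO4_iff O4_mult O4_transpose det_mul)
  ultimately show thesis
    using that \<theta>(1) unfolding h_def by blast
qed

theorem theorem3p5:
  fixes f :: "real^4^4 \<Rightarrow> real^4^4"
  shows "isometry_of SO4 (killing_metric SO4) f \<longleftrightarrow>
    (\<exists>A B. (A \<in> SO4 \<and> B \<in> SO4 \<or> A \<in> O4 - SO4 \<and> B \<in> O4 - SO4) \<and>
      ((\<forall>X\<in>SO4. f X = A ** X ** B) \<or>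
       (\<forall>X\<in>SO4. f X = A ** transpose X ** B) \<or>
       (\<forall>X\<in>SO4. f X = A ** \<tau> X ** B) \<or>
       (\<forall>X\<in>SO4. f X = A ** transpose (\<tau> X) ** B)))"
  (is "_ \<longleftrightarrow> ?form")
proof
  assume "isometry_of SO4 (killing_metric SO4) f"
  then have "preserves_metric f" by (simp add: isometry_of_SO4_iff)
  then obtain A B \<theta> where "A \<in> SO4 \<and> B \<in> SO4 \<or> A \<in> O4 - SO4 \<and> B \<in> O4 - SO4"
    "\<theta> = (\<lambda>X. X) \<or> \<theta> = transpose \<or> \<theta> = tau_lin \<or> \<theta> = (\<lambda>X. transpose (tau_lin X))"
    "\<forall>X\<in>SO4. f X = A ** \<theta> X ** B"
    by (rule preserves_metric_form)
  then show ?form by (intro exI[of _ A] exI[of _ B]) (auto simp: cayley_tau_eq)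
next
  assume ?form
  then obtain A B where AB: "A \<in> SO4 \<and> B \<in> SO4 \<or> A \<in> O4 - SO4 \<and> B \<in> O4 - SO4"
    and forms: "(\<forall>X\<in>SO4. f X = A ** X ** B) \<or> (\<forall>X\<in>SO4. f X = A ** transpose X ** B) \<or>
       (\<forall>X\<in>SO4. f X = A ** \<tau> X ** B) \<or> (\<forall>X\<in>SO4. f X = A ** transpose (\<tau> X) ** B)"
    by blast
  have "A \<in> O4" "B \<in> O4" "det A * det B = 1"
    using AB det_O4[of A] det_O4[of B] by (auto simp: SO4_iff)
  note iso = linear_isometry_mult[OF this]
  have *: "isometry_of SO4 (killing_metric SO4) f" if "linear_isometry T" "\<forall>X\<in>SO4. f X = T X" for T
    unfolding isometry_of_SO4_iff using linear_isometry_isometry[of T f, OF that(1)] that(2)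
        by blast
  have "(\<forall>X\<in>SO4. f X = A ** X ** B) \<or> (\<forall>X\<in>SO4. f X = A ** transpose X ** B) \<or>
       (\<forall>X\<in>SO4. f X = A ** tau_lin X ** B) \<or> (\<forall>X\<in>SO4. f X = A ** transpose (tau_lin X) ** B)"
    using forms by (simp add: cayley_tau_eq)
  then show "isometry_of SO4 (killing_metric SO4) f"
    using *[OF iso] *[OF linear_isometry_comp[OF iso linear_isometry_transpose]]
      *[OF linear_isometry_comp[OF iso linear_isometry_tau_lin]]
      *[OF linear_isometry_comp[OF iso linear_isometry_comp[OF linear_isometry_transpose
          linear_isometry_tau_lin]]]
    by blast
qed

end
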